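(* Let $m\geq 4$ and $g_0\in L^\infty_m(\mathbb{S}^1)$, and let $g,G$ be the solution of \[ \partial_t g+2G\,\partial_\theta g=0,\qquad (4+\partial_{\theta\theta})G=g,\qquad g(0,\cdot)=g_0 . \] Denote by $\chi$ the Lagrangian flow map on $\mathbb{S}^1$, i.e. the solution of \[ \frac{d}{dt}\chi(t,\theta)=2G(t,\chi(t,\theta)),\qquad \chi(0,\theta)=\theta . \] Then for every $\theta\in\mathbb{S}^1$ there exists $T(\theta)\in[0,\infty]$ such that $t\mapsto\partial_\theta\chi(t,\theta)$ is increasing on $[0,T(\theta))$ and decreasing on $[T(\theta),\infty)$. In other words, the set \[ C(t):=\{\theta:\ \partial_t\partial_\theta\chi(t,\theta)<0\} \] is non-decreasing in $t$ with respect to set inclusion. Moreover, the set $E:=\{\theta:\ T(\theta)=+\infty\}$ (the expanding set) is closed, and the set $C:=\{\theta:\ T(\theta)<\infty\}$ (the eventually contracting set) is open, with $\partial_\theta\chi(t,\theta)$ decreasing to $0$ for $t\in[T(\theta),\infty)$ for every $\theta\in C$. Furthermore, either $g(t,\cdot)$ converges weakly to the constant $\frac{1}{2\pi}\int_{\mathbb{S}^1}g_0$ as $t\to+\infty$, or $E$ is a finite set.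
   Context: $\mathbb{S}^1=\mathbb{R}/2\pi\mathbb{Z}$ with coordinate $\theta$. For $m\in\mathbb{N}$, $L^\infty_m(\mathbb{S}^1)$ denotes the bounded measurable functions $g$ on $\mathbb{S}^1$ that are $m$-fold symmetric, i.e. $g(\theta+2\pi/m)=g(\theta)$. For $m\geq 3$, the operator $4+\partial_{\theta\theta}$ is invertible on $m$-fold symmetric functions (their Fourier modes are multiples of $m$, so the modes $\pm2$ are absent), so $G=(4+\partial_{\theta\theta})^{-1}g$ is well defined; for $g_0\in L^\infty_m(\mathbb{S}^1)$, $m\ge 3$, the system above has a unique global solution $g\in L^\infty(\mathbb{R},L^\infty_m(\mathbb{S}^1))\cap C^0(\mathbb{R},L^1_m(\mathbb{S}^1))$, with $G(t,\cdot)\in W^{2,\infty}$, so the flow $\chi$ is well defined. This system is the equation satisfied by the angular profile $g(t,\theta)=\omega(t,r,\theta)$ of scale-invariant ($0$-homogeneous) $m$-fold symmetric solutions $\omega$ of the 2d Euler equation. *)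

theory Defs
  imports "HOL-Analysis.Analysis"
begin

text \<open>Functions on the circle S^1 = R/2piZ are represented by their 2pi-periodic lifts to R.
  Time-dependent functions are curried: g t theta.\<close>

definition msym :: "nat \<Rightarrow> (real \<Rightarrow> real) \<Rightarrow> bool" where
  "msym m f \<longleftrightarrow> (\<forall>\<theta>. f (\<theta> + 2 * pi / real m) = f \<theta>)"

definition Linf_m :: "nat \<Rightarrow> (real \<Rightarrow> real) \<Rightarrow> bool" where
  "Linf_m m f \<longleftrightarrow> f \<in> borel_measurable lborel \<and> (\<exists>B. \<forall>\<theta>. \<bar>f \<theta>\<bar> \<le> B) \<and> msym m f"

text \<open>G(t) = (4 + d^2/dtheta^2)^{-1} g(t) in the m-fold symmetric class, in the W^{2,infinity} sense:
  G(t) is m-fold symmetric, differentiable, and its derivative is absolutely continuous with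
  (G(t))'' = g(t) - 4 G(t) a.e.\<close>
definition inv_op :: "nat \<Rightarrow> (real \<Rightarrow> real) \<Rightarrow> (real \<Rightarrow> real) \<Rightarrow> bool" where
  "inv_op m g G \<longleftrightarrow> msym m G \<and> (\<forall>\<theta>. G differentiable (at \<theta>)) \<and>
     (\<forall>a b. a \<le> b \<longrightarrow> set_integrable lborel {a..b} (\<lambda>s. g s - 4 * G s) \<and>
        deriv G b - deriv G a = (LINT s:{a..b}|lborel. g s - 4 * G s))"

definition test_fun :: "(real \<Rightarrow> real \<Rightarrow> real) \<Rightarrow> (real \<Rightarrow> real \<Rightarrow> real) \<Rightarrow> (real \<Rightarrow> real \<Rightarrow> real) \<Rightarrow> bool" where
  "test_fun \<phi> \<phi>t \<phi>x \<longleftrightarrow>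
     (\<forall>t \<theta>. ((\<lambda>s. \<phi> s \<theta>) has_real_derivative \<phi>t t \<theta>) (at t)) \<and>
     (\<forall>t \<theta>. ((\<lambda>y. \<phi> t y) has_real_derivative \<phi>x t \<theta>) (at \<theta>)) \<and>
     continuous_on UNIV (\<lambda>p. \<phi>t (fst p) (snd p)) \<and>
     continuous_on UNIV (\<lambda>p. \<phi>x (fst p) (snd p)) \<and>
     (\<exists>R. \<forall>t \<theta>. \<bar>t\<bar> \<ge> R \<longrightarrow> \<phi> t \<theta> = 0) \<and>
     (\<forall>t \<theta>. \<phi> t (\<theta> + 2 * pi) = \<phi> t \<theta>)"

text \<open>(g, G) is the (global, t in R) solution of
  d_t g + 2 G d_theta g = 0, (4 + d_theta theta) G = g, g(0) = g0,
  in the class g in L^infinity(R, L^infinity_m) \<inter> C^0(R, L^1_m), G(t) in W^{2,infinity};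
  the transport equation holds in the sense of distributions on R x S^1:
  int int g (d_t phi + 2 G d_theta phi + 2 (d_theta G) phi) = 0.\<close>
definition is_solution :: "nat \<Rightarrow> (real \<Rightarrow> real) \<Rightarrow> (real \<Rightarrow> real \<Rightarrow> real) \<Rightarrow> (real \<Rightarrow> real \<Rightarrow> real) \<Rightarrow> bool" where
  "is_solution m g0 g G \<longleftrightarrow>
     (\<lambda>p. g (fst p) (snd p)) \<in> borel_measurable lborel \<and>
     (\<exists>B. \<forall>t \<theta>. \<bar>g t \<theta>\<bar> \<le> B) \<and>
     (\<forall>t. msym m (g t)) \<and>
     (\<forall>t0. ((\<lambda>t. LINT \<theta>:{0..2*pi}|lborel. \<bar>g t \<theta> - g t0 \<theta>\<bar>) \<longlongrightarrow> 0) (at t0)) \<and>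
     (AE \<theta> in lborel. \<theta> \<in> {0..2*pi} \<longrightarrow> g 0 \<theta> = g0 \<theta>) \<and>
     (\<forall>t. inv_op m (g t) (G t)) \<and>
     (\<forall>\<phi> \<phi>t \<phi>x. test_fun \<phi> \<phi>t \<phi>x \<longrightarrow>
        (let F = (\<lambda>p. g (fst p) (snd p) *
                   (\<phi>t (fst p) (snd p) + 2 * G (fst p) (snd p) * \<phi>x (fst p) (snd p)
                    + 2 * deriv (G (fst p)) (snd p) * \<phi> (fst p) (snd p)))
         in set_integrable lborel (UNIV \<times> {0..2*pi}) F \<and>
            (LINT p:(UNIV \<times> {0..2*pi})|lborel. F p) = 0))"

definition is_flow :: "(real \<Rightarrow> real \<Rightarrow> real) \<Rightarrow> (real \<Rightarrow> real \<Rightarrow> real) \<Rightarrow> bool" where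
  "is_flow G chi \<longleftrightarrow>
     (\<forall>t \<theta>. ((\<lambda>s. chi s \<theta>) has_real_derivative 2 * G t (chi t \<theta>)) (at t)) \<and>
     (\<forall>\<theta>. chi 0 \<theta> = \<theta>)"

definition dchi :: "(real \<Rightarrow> real \<Rightarrow> real) \<Rightarrow> real \<Rightarrow> real \<Rightarrow> real" where
  "dchi chi t \<theta> = deriv (chi t) \<theta>"

definition Cset :: "(real \<Rightarrow> real \<Rightarrow> real) \<Rightarrow> real \<Rightarrow> real set" where
  "Cset chi t = {\<theta>. deriv (\<lambda>s. dchi chi s \<theta>) t < 0}"

definition weak_conv_const :: "(real \<Rightarrow> real \<Rightarrow> real) \<Rightarrow> real \<Rightarrow> bool" where
  "weak_conv_const g c \<longleftrightarrow>
     (\<forall>\<psi>. set_integrable lborel {0..2*pi} \<psi> \<longrightarrow>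
        ((\<lambda>t. LINT \<theta>:{0..2*pi}|lborel. g t \<theta> * \<psi> \<theta>)
           \<longlongrightarrow> c * (LINT \<theta>:{0..2*pi}|lborel. \<psi> \<theta>)) at_top)"

end

theory Submission
  imports Defs
begin

text \<open>
  Put \<open>L = 2\<pi>/m\<close>. On \<open>L\<close>-periodic functions \<open>4 + \<partial>\<^sub>\<theta>\<^sub>\<theta>\<close> is inverted by convolution with
  \<open>cos (2x - L) / (4 sin L)\<close>, \<open>0 \<le> x \<le> L\<close>, which is nonnegative because \<open>m \<ge> 4\<close> means \<open>L \<le> \<pi>/2\<close>. Writing
  \<open>H = (4 + \<partial>\<^sub>\<theta>\<^sub>\<theta>)\<^sup>-\<^sup>1 (3 G'\<^sup>2) \<ge> 0\<close>, the equation becomes \<open>\<partial>\<^sub>t G + 2 G G' = H'\<close>, and along the flow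
  \<open>y = G'(t, \<chi>)\<close> satisfies the Riccati equation \<open>y' = y\<^sup>2 - 4 H\<close>, while \<open>\<partial>\<^sub>t \<partial>\<^sub>\<theta>\<chi> = 2 y \<partial>\<^sub>\<theta>\<chi>\<close>.
  Hence \<open>w = (\<partial>\<^sub>\<theta>\<chi>)\<^sup>-\<^sup>1\<^sup>/\<^sup>2\<close> is convex in time: once \<open>y\<close> is negative it stays negative and \<open>w\<close> grows at least linearly.

  If \<open>G'\<close> tends to 0 uniformly, then \<open>g\<close> converges weakly to its mean. Otherwise there are arbitrarily late time
  windows of fixed length on which \<open>H\<close> is bounded below, and a point that never contracts must have \<open>y \<ge> \<kappa>\<close>
  there for a fixed \<open>\<kappa> > 0\<close>. If there were infinitely many such points, two of them would be so close at
  infinitely many of these times that \<open>y > 0\<close> on the whole arc between them; that arc would then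
  consist of expanding points and its length would grow beyond \<open>2\<pi>\<close>.
\<close>

section \<open>Lipschitz primitives of bounded measurable functions\<close>

text \<open>The identity for H comes from applying 4 + d^2/dx^2 to 2 G G': the result is 2 G g' + 6
  G' G''. The same operator maps the time derivative of G to -2 G g', so the sum of both is mapped
  to (3 G'^2)'. The Riccati equation is the x-derivative of this identity. The identity is therefore
  proved weakly, with test functions that are products of a function of time and a Green potential
  \<open>kop L \<eta>\<close>: the derivative of g falls on the potential, and a one-dimensional du
  Bois-Reymond argument removes the function of time. Along the flow, G'' is avoided by working with
  difference quotients of G. The Green operator is nonlocal, so a large value of G' at one place
  bounds H from below everywhere. Then y' \<le> y^2 - c for every trajectory at once, which is why a
  point that is never to contract needs a definite positive slope. All constants are uniform in
  time.\<close>

lemma bounded_borel_set_integrable: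
  fixes h :: "real \<Rightarrow> real"
  assumes "h \<in> borel_measurable borel" and "\<And>x. \<bar>h x\<bar> \<le> B"
  shows "set_integrable lborel {a..b} h"
  unfolding set_integrable_def
proof (rule Bochner_Integration.integrable_bound)
  show "integrable lborel (\<lambda>x. indicator {a..b} x *\<^sub>R B)"
    using borel_integrable_atLeastAtMost'[of a b "\<lambda>_. B"] by (simp add: set_integrable_def)
  show "(\<lambda>x. indicator {a..b} x *\<^sub>R h x) \<in> borel_measurable lborel"
    using assms(1) by simp
  show "AE x in lborel. norm (indicat_real {a..b} x *\<^sub>R h x) \<le> norm (indicat_real {a..b} x *\<^sub>R B)"
    using assms(2) by (intro AE_I2) (auto simp: indicator_def intro: order_trans[OF _ abs_ge_self])
qed

lemma bounded_borel_integrable_on: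
  fixes h :: "real \<Rightarrow> real"
  assumes "h \<in> borel_measurable borel" and "\<And>x. \<bar>h x\<bar> \<le> B"
  shows "h integrable_on {a..b}"
  using set_borel_integral_eq_integral(1)[OF bounded_borel_set_integrable[OF assms]] .

text \<open>This is W^{1,infinity} without almost-everywhere differentiation: the weak derivative
  enters only through its integrals. Bounds on both \<open>f\<close> and \<open>h\<close> are built
  in so that the class is closed under products, which turns every later integration by parts into
  an application of \<open>wderiv_mult\<close>.\<close>

definition wderiv :: "(real \<Rightarrow> real) \<Rightarrow> (real \<Rightarrow> real) \<Rightarrow> bool" where
  "wderiv f h \<longleftrightarrow> h \<in> borel_measurable borel \<and> (\<exists>B. \<forall>x. \<bar>h x\<bar> \<le> B) \<and> (\<exists>B. \<forall>x. \<bar>f x\<bar> \<le> B) \<and>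
     (\<forall>a b. a \<le> b \<longrightarrow> (h has_integral (f b - f a)) {a..b})"

lemma wderivE:
  assumes "wderiv f h"
  obtains B where "0 < B" "\<And>x. \<bar>h x\<bar> \<le> B" "\<And>x. \<bar>f x\<bar> \<le> B"
proof -
  obtain B C where "\<And>x. \<bar>h x\<bar> \<le> B" "\<And>x. \<bar>f x\<bar> \<le> C"
    using assms unfolding wderiv_def by blast
  then have "0 < max 1 (max B C)" "\<And>x. \<bar>h x\<bar> \<le> max 1 (max B C)" "\<And>x. \<bar>f x\<bar> \<le> max 1 (max B C)"
    by (auto simp: le_max_iff_disj)
  then show ?thesis using that by blast
qed

lemma wderiv_has_integral: "wderiv f h \<Longrightarrow> a \<le> b \<Longrightarrow> (h has_integral (f b - f a)) {a..b}"
  by (simp add: wderiv_def)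

lemma wderiv_borel: "wderiv f h \<Longrightarrow> h \<in> borel_measurable borel"
  by (simp add: wderiv_def)

lemma wderiv_lipschitz_bound:
  assumes "wderiv f h" and "\<And>x. \<bar>h x\<bar> \<le> B"
  shows "\<bar>f b - f a\<bar> \<le> B * \<bar>b - a\<bar>"
proof -
  have *: "\<bar>f b - f a\<bar> \<le> B * (b - a)" if "a \<le> b" for a b
    using has_integral_bound_real[OF _ finite.emptyI wderiv_has_integral[OF assms(1) that], of B] assms(2)
      that order_trans[OF abs_ge_zero assms(2)] by auto
  show ?thesis
    using *[of a b] *[of b a] by (cases "a \<le> b") (auto simp: abs_minus_commute)
qed

lemma wderiv_continuous:
  assumes "wderiv f h"
  shows "continuous_on S f"
proof -
  obtain B where B: "0 < B" "\<And>x. \<bar>h x\<bar> \<le> B" using assms by (metis wderivE)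
  have "lipschitz_on B UNIV f"
    using wderiv_lipschitz_bound[OF assms B(2)] B(1)
    by (intro lipschitz_onI) (auto simp: dist_real_def)
  then show ?thesis
    using lipschitz_on_continuous_on continuous_on_subset by blast
qed

lemma wderiv_borel':
  "wderiv f h \<Longrightarrow> f \<in> borel_measurable borel"
  by (rule borel_measurable_continuous_onI) (rule wderiv_continuous)

lemma wderiv_add:
  assumes "wderiv f h" "wderiv k l"
  shows "wderiv (\<lambda>x. f x + k x) (\<lambda>x. h x + l x)"
proof -
  obtain B C where "\<And>x. \<bar>h x\<bar> \<le> B" "\<And>x. \<bar>f x\<bar> \<le> B" "\<And>x. \<bar>l x\<bar> \<le> C" "\<And>x. \<bar>k x\<bar> \<le> C"
    using assms by (metis wderivE)
  then have "\<forall>x. \<bar>h x + l x\<bar> \<le> B + C" "\<forall>x. \<bar>f x + k x\<bar> \<le> B + C"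
    by (meson abs_triangle_ineq add_mono order_trans)+
  moreover have "((\<lambda>x. h x + l x) has_integral (f b + k b - (f a + k a))) {a..b}" if "a \<le> b" for a b
    using has_integral_add[OF wderiv_has_integral[OF assms(1) that] wderiv_has_integral[OF assms(2) that]]
    by (simp add: algebra_simps)
  ultimately show ?thesis
    using assms unfolding wderiv_def by (auto intro!: borel_measurable_add)
qed

lemma wderiv_cmult:
  assumes "wderiv f h"
  shows "wderiv (\<lambda>x. c * f x) (\<lambda>x. c * h x)"
proof -
  obtain B where "\<And>x. \<bar>h x\<bar> \<le> B" "\<And>x. \<bar>f x\<bar> \<le> B"
    using assms by (metis wderivE)
  then have "\<forall>x. \<bar>c * h x\<bar> \<le> \<bar>c\<bar> * B" "\<forall>x. \<bar>c * f x\<bar> \<le> \<bar>c\<bar> * B"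
    by (auto simp: abs_mult intro: mult_left_mono)
  moreover have "((\<lambda>x. c * h x) has_integral (c * f b - c * f a)) {a..b}" if "a \<le> b" for a b
    using has_integral_mult_right[OF wderiv_has_integral[OF assms that], of c]
    by (simp add: algebra_simps)
  ultimately show ?thesis
    using assms unfolding wderiv_def by (auto intro!: borel_measurable_times)
qed

lemma wderiv_diff:
  assumes "wderiv f h" "wderiv k l"
  shows "wderiv (\<lambda>x. f x - k x) (\<lambda>x. h x - l x)"
  using wderiv_add[OF assms(1) wderiv_cmult[OF assms(2), of "-1"]] by simp

lemma wderivI_deriv:
  assumes "\<And>x. (f has_real_derivative h x) (at x)" "continuous_on UNIV h"
    and "\<And>x. \<bar>h x\<bar> \<le> B" "\<And>x. \<bar>f x\<bar> \<le> C"
  shows "wderiv f h"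
proof -
  have "(h has_integral (f b - f a)) {a..b}" if "a \<le> b" for a b
    by (rule fundamental_theorem_of_calculus[OF that])
      (use assms(1) in \<open>auto simp: has_real_derivative_iff_has_vector_derivative[symmetric]
        intro: has_field_derivative_at_within\<close>)
  then show ?thesis
    unfolding wderiv_def using assms by (auto intro: borel_measurable_continuous_onI)
qed

text \<open>The difference quotients are at most |C| |y - x|, so the derivative is 0. This replaces
  differentiating a product whose factors are differentiable only almost everywhere.\<close>

lemma constant_if_quadratic_increments:
  fixes F :: "real \<Rightarrow> real"
  assumes "\<And>x y. a \<le> x \<Longrightarrow> x \<le> y \<Longrightarrow> y \<le> b \<Longrightarrow> \<bar>F y - F x\<bar> \<le> C * (y - x)^2" and "a \<le> b"
  shows "F b = F a"
proof (cases "a < b")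
  case True
  have der: "(F has_real_derivative 0) (at x within {a..b})" if "x \<in> {a..b}" for x
    unfolding has_field_derivative_iff
  proof (rule Lim_null_comparison)
    show "\<forall>\<^sub>F y in at x within {a..b}. norm ((F y - F x) / (y - x)) \<le> \<bar>C\<bar> * \<bar>y - x\<bar>"
      unfolding eventually_at
    proof (intro exI[of _ 1] conjI ballI impI)
      fix y assume y: "y \<in> {a..b}" "y \<noteq> x \<and> dist y x < 1"
      have "\<bar>F y - F x\<bar> \<le> C * (y - x)^2"
        using assms(1)[of x y] assms(1)[of y x] y(1) that
        by (cases "x \<le> y") (auto simp: abs_minus_commute power2_commute)
      also have "\<dots> \<le> \<bar>C\<bar> * (y - x)^2" by (simp add: mult_right_mono)
      finally have "\<bar>F y - F x\<bar> \<le> (\<bar>C\<bar> * \<bar>y - x\<bar>) * \<bar>y - x\<bar>"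
        by (simp add: power2_eq_square mult.assoc flip: abs_mult)
      then show "norm ((F y - F x) / (y - x)) \<le> \<bar>C\<bar> * \<bar>y - x\<bar>"
        using y(2) by (simp add: divide_le_eq)
    qed simp
    show "((\<lambda>y. \<bar>C\<bar> * \<bar>y - x\<bar>) \<longlongrightarrow> 0) (at x within {a..b})"
      by (rule tendsto_eq_intros refl | simp)+
  qed
  have "continuous_on {a..b} F"
    using der by (meson DERIV_continuous_on)
  moreover have "(F has_real_derivative 0) (at x)" if "a < x" "x < b" for x
    using der[of x] that at_within_Icc_at[of a x b] by auto
  ultimately show ?thesis
    using DERIV_isconst_end[of a b F] True by blast
qed (use assms in auto)

text \<open>Both factors are Lipschitz, so the product rule holds on \<open>{x..y}\<close> up to an error of order
  \<open>(y - x)\<^sup>2\<close>; a function with such increments is constant.\<close>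
lemma wderiv_mult:
  assumes f: "wderiv f h" and k: "wderiv k l"
  shows "wderiv (\<lambda>x. f x * k x) (\<lambda>x. f x * l x + h x * k x)"
proof -
  obtain B where B: "0 < B" "\<And>x. \<bar>h x\<bar> \<le> B" "\<And>x. \<bar>f x\<bar> \<le> B" using f by (metis wderivE)
  obtain C where C: "0 < C" "\<And>x. \<bar>l x\<bar> \<le> C" "\<And>x. \<bar>k x\<bar> \<le> C" using k by (metis wderivE)
  let ?p = "\<lambda>x. f x * l x + h x * k x"
  have meas: "?p \<in> borel_measurable borel"
    using f k by (intro borel_measurable_add borel_measurable_times wderiv_borel' wderiv_borel) 
  have bd: "\<bar>?p x\<bar> \<le> B * C + B * C" for x
    using mult_mono[OF B(3)[of x] C(2)[of x]] mult_mono[OF B(2)[of x] C(3)[of x]] B(1) C(1)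
      abs_triangle_ineq[of "f x * l x" "h x * k x"]
    by (simp add: abs_mult) 
  have bd': "\<bar>f x * k x\<bar> \<le> B * C" for x
    using mult_mono[OF B(3)[of x] C(3)[of x]] B(1) by (simp add: abs_mult)
  have "(?p has_integral (f b * k b - f a * k a)) {a..b}" if "a \<le> b" for a b
  proof -
    have int: "?p integrable_on {x..y}" for x y
      by (rule bounded_borel_integrable_on[OF meas bd])
    define F where "F x = integral {a..x} ?p - f x * k x" for x
    have "F b = F a"
    proof (rule constant_if_quadratic_increments[OF _ that])
      fix x y assume xy: "a \<le> x" "x \<le> y" "y \<le> b"
      have "(?p has_integral (F y - F x + f y * k y - f x * k x)) {x..y}"
      proof -
        have "integral {a..x} ?p + integral {x..y} ?p = integral {a..y} ?p"
          by (rule Henstock_Kurzweil_Integration.integral_combine) (use xy int in auto)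
        then show ?thesis
          unfolding F_def using integrable_integral[OF int, of x y] by (smt (verit))
      qed
      from has_integral_diff[OF this has_integral_add[OF
          has_integral_mult_right[OF wderiv_has_integral[OF k xy(2)], of "f x"]
          has_integral_mult_right[OF wderiv_has_integral[OF f xy(2)], of "k x"]]]
      \<comment> \<open>Freezing each factor at \<open>x\<close> removes the first-order part: what
        is left has size O(y - x) on an interval of length y - x.\<close>
      have I: "((\<lambda>s. (f s - f x) * l s + (k s - k x) * h s) has_integral
          (F y - F x + (f y - f x) * (k y - k x))) {x..y}"
        by (simp add: algebra_simps)
      have "\<bar>(f s - f x) * l s + (k s - k x) * h s\<bar> \<le> 2 * B * C * (y - x)" if "s \<in> {x..y}" for s
      proof -
        have "\<bar>f s - f x\<bar> \<le> B * (y - x)" "\<bar>k s - k x\<bar> \<le> C * (y - x)"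
          using wderiv_lipschitz_bound[OF f B(2), of s x] wderiv_lipschitz_bound[OF k C(2), of s x] that B(1) C(1)
          by (auto intro: order_trans mult_left_mono)
        from mult_mono[OF this(1) C(2)[of s]] mult_mono[OF this(2) B(2)[of s]]
        have "\<bar>(f s - f x) * l s\<bar> \<le> B * (y - x) * C" "\<bar>(k s - k x) * h s\<bar> \<le> C * (y - x) * B"
          using B(1) C(1) xy by (auto simp: abs_mult)
        then show ?thesis by (simp add: algebra_simps)
      qed
      from has_integral_bound_real[OF _ finite.emptyI I, of "2 * B * C * (y - x)"] this
      have "\<bar>F y - F x + (f y - f x) * (k y - k x)\<bar> \<le> 2 * B * C * (y - x) * (y - x)"
        using xy B(1) C(1) by auto
      moreover have "\<bar>(f y - f x) * (k y - k x)\<bar> \<le> (B * (y - x)) * (C * (y - x))"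
        unfolding abs_mult
        using wderiv_lipschitz_bound[OF f B(2), of y x] wderiv_lipschitz_bound[OF k C(2), of y x] xy B(1) C(1)
        by (intro mult_mono) auto
      ultimately show "\<bar>F y - F x\<bar> \<le> 3 * B * C * (y - x)^2"
        by (simp add: algebra_simps power2_eq_square)
    qed
    then show ?thesis
      unfolding F_def using integrable_integral[OF int, of a b] by (smt (verit) content_real_eq_0 integral_singleton atLeastAtMost_singleton)
  qed
  then show ?thesis unfolding wderiv_def using meas bd bd' by auto
qed

lemma wderiv_eq: "wderiv f h \<Longrightarrow> (\<And>x. f x = f' x) \<Longrightarrow> (\<And>x. h x = h' x) \<Longrightarrow> wderiv f' h'"
  using ext[of f f'] ext[of h h'] by simp

section \<open>The Green operator of \<open>4 + d\<^sup>2/dx\<^sup>2\<close>\<close>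

lemma ex_antiderivative:
  fixes f :: "real \<Rightarrow> real"
  assumes "continuous_on UNIV f"
  shows "\<exists>F. \<forall>t. (F has_real_derivative f t) (at t)"
proof -
  have "((\<lambda>u. LBINT y=0..u. f y) has_real_derivative f t) (at t)" for t
  proof -
    have "((\<lambda>u. LBINT y=ereal 0..ereal u. f y) has_vector_derivative f t) (at t within {-\<bar>t\<bar> - 1..\<bar>t\<bar> + 1})"
      by (rule interval_integral_FTC2) (use assms in \<open>auto intro: continuous_on_subset\<close>)
    moreover have "at t within {-\<bar>t\<bar> - 1..\<bar>t\<bar> + 1} = at t"
      by (rule at_within_Icc_at) auto
    ultimately show ?thesis
      by (simp add: has_real_derivative_iff_has_vector_derivative zero_ereal_def)
  qed
  then show ?thesis by blast
qed

lemma integral_antiderivative: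
  fixes F :: "real \<Rightarrow> real"
  assumes "\<And>t. (F has_real_derivative f t) (at t)" "a \<le> b"
  shows "integral {a..b} f = F b - F a"
  by (intro integral_unique fundamental_theorem_of_calculus)
    (use assms in \<open>auto simp: has_real_derivative_iff_has_vector_derivative[symmetric]
        intro: has_field_derivative_at_within\<close>)

lemma periodic_int_mult:
  fixes f :: "real \<Rightarrow> 'a"
  assumes "\<And>x. f (x + L) = f x"
  shows "f (x + of_int n * L) = f x"
proof -
  have *: "f (x + of_nat k * L) = f x" for k x
  proof (induction k)
    case (Suc k)
    then show ?case using assms[of "x + of_nat k * L"] by (simp add: algebra_simps)
  qed simp
  show ?thesis
    using *[of x "nat n"] *[of "x + of_int n * L" "nat (- n)"] by (cases "n \<ge> 0") (auto simp: algebra_simps)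
qed

lemma shift_into_period:
  fixes x a L :: real
  assumes "L > 0"
  obtains n :: int where "a \<le> x + of_int n * L" "x + of_int n * L < a + L"
proof
  let ?n = "- \<lfloor>(x - a) / L\<rfloor>"
  have "of_int \<lfloor>(x - a) / L\<rfloor> * L \<le> x - a" "x - a < (of_int \<lfloor>(x - a) / L\<rfloor> + 1) * L"
    using assms floor_correct[of "(x - a) / L"]
    unfolding pos_le_divide_eq[OF assms] pos_divide_less_eq[OF assms] by auto
  then show "a \<le> x + of_int ?n * L" "x + of_int ?n * L < a + L"
    by (auto simp: algebra_simps)
qed

text \<open>\<open>kop L u\<close> is the \<open>L\<close>-periodic solution \<open>f\<close> of \<open>f'' + 4 f = u\<close> and \<open>dkop L u\<close> its derivative.\<close>
definition kop :: "real \<Rightarrow> (real \<Rightarrow> real) \<Rightarrow> real \<Rightarrow> real" where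
  "kop L u x = integral {x..x + L} (\<lambda>y. cos (2 * (y - x) - L) * u y) / (4 * sin L)"

definition dkop :: "real \<Rightarrow> (real \<Rightarrow> real) \<Rightarrow> real \<Rightarrow> real" where
  "dkop L u x = integral {x..x + L} (\<lambda>y. sin (2 * (y - x) - L) * u y) / (2 * sin L)"

lemma wderiv_cos: "wderiv (\<lambda>y. cos (2 * (y - x) - L)) (\<lambda>y. - 2 * sin (2 * (y - x) - L))"
  by (rule wderivI_deriv[where B = 2 and C = 1])
    (auto intro!: derivative_eq_intros continuous_intros simp: abs_mult)

lemma wderiv_sin: "wderiv (\<lambda>y. sin (2 * (y - x) - L)) (\<lambda>y. 2 * cos (2 * (y - x) - L))"
  by (rule wderivI_deriv[where B = 2 and C = 1])
    (auto intro!: derivative_eq_intros continuous_intros simp: abs_mult)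

text \<open>Integration by parts over one period: the kernel solves k'' + 4 k = 0, so only boundary
  terms remain. The cosine equals cos L at both ends and its terms cancel by periodicity; the sine
  runs from -sin L to sin L and produces the normalising factors 4 sin L and 2 sin L. The datum may
  be merely bounded and Borel, as \<open>g\<close> is; \<open>kop_deriv\<close> is the converse for
  continuous data.\<close>

lemma kop_representation:
  assumes f: "wderiv f f'" and f': "wderiv f' h"
    and per: "\<And>x. f (x + L) = f x" "\<And>x. f' (x + L) = f' x" and L: "0 < L" "L < pi"
  shows "f x = kop L (\<lambda>y. h y + 4 * f y) x" "f' x = dkop L (\<lambda>y. h y + 4 * f y) x"
proof -
  have s: "sin L > 0" using L by (rule sin_gt_zero)
  let ?c = "\<lambda>y. cos (2 * (y - x) - L)" and ?s = "\<lambda>y. sin (2 * (y - x) - L)"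
  have "wderiv (\<lambda>y. ?c y * f' y + 2 * (?s y * f y)) (\<lambda>y. ?c y * (h y + 4 * f y))"
    by (rule wderiv_eq[OF wderiv_add[OF wderiv_mult[OF wderiv_cos[of x L] f'] wderiv_cmult[OF wderiv_mult[OF wderiv_sin[of x L] f], of 2]]])
      (auto simp: algebra_simps)
  from wderiv_has_integral[OF this, of x "x + L"] per[of x] L
  have "((\<lambda>y. ?c y * (h y + 4 * f y)) has_integral (4 * sin L * f x)) {x..x + L}"
    by (simp add: algebra_simps)
  then show "f x = kop L (\<lambda>y. h y + 4 * f y) x"
    unfolding kop_def using s by (simp add: integral_unique)
  have "wderiv (\<lambda>y. ?s y * f' y - 2 * (?c y * f y)) (\<lambda>y. ?s y * (h y + 4 * f y))"
    by (rule wderiv_eq[OF wderiv_diff[OF wderiv_mult[OF wderiv_sin[of x L] f'] wderiv_cmult[OF wderiv_mult[OF wderiv_cos[of x L] f], of 2]]])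
      (auto simp: algebra_simps)
  from wderiv_has_integral[OF this, of x "x + L"] per[of x] L
  have "((\<lambda>y. ?s y * (h y + 4 * f y)) has_integral (2 * sin L * f' x)) {x..x + L}"
    by (simp add: algebra_simps)
  then show "f' x = dkop L (\<lambda>y. h y + 4 * f y) x"
    unfolding dkop_def using s by (simp add: integral_unique)
qed

text \<open>The addition theorems move \<open>x\<close> out of the kernel, leaving integrals that
  depend on \<open>x\<close> through their endpoints alone. As \<open>u\<close> is periodic, the
  endpoint contributions combine to (cos L - cos L) u = 0 in the first derivative and to 2 sin L u
  in the second.\<close>

lemma kop_deriv:
  assumes u: "continuous_on UNIV u" and L: "0 < L" "L < pi" and per: "\<And>x. u (x + L) = u x"
  shows "(kop L u has_real_derivative dkop L u x) (at x)"
    "(dkop L u has_real_derivative u x - 4 * kop L u x) (at x)"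
proof -
  have s: "sin L > 0" using L by (rule sin_gt_zero)
  obtain A where A: "\<And>t. (A has_real_derivative cos (2 * t) * u t) (at t)"
    using ex_antiderivative[OF continuous_on_mult[OF _ u, of "\<lambda>t. cos (2 * t)"]]
    by (metis continuous_on_cos continuous_on_mult_const continuous_on_id)
  obtain B where B: "\<And>t. (B has_real_derivative sin (2 * t) * u t) (at t)"
    using ex_antiderivative[OF continuous_on_mult[OF _ u, of "\<lambda>t. sin (2 * t)"]]
    by (metis continuous_on_sin continuous_on_mult_const continuous_on_id)
  have Ai: "integral {x..x + L} (\<lambda>t. cos (2 * t) * u t) = A (x + L) - A x" for x
    using L by (intro integral_antiderivative A) auto
  have Bi: "integral {x..x + L} (\<lambda>t. sin (2 * t) * u t) = B (x + L) - B x" for x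
    using L by (intro integral_antiderivative B) auto
  have int: "(\<lambda>t. k * (cos (2 * t) * u t)) integrable_on {x..x + L}"
      "(\<lambda>t. k * (sin (2 * t) * u t)) integrable_on {x..x + L}" for x k
    using u by (auto intro!: integrable_continuous_interval continuous_intros intro: continuous_on_subset)
  have dA: "((\<lambda>x. A (x + L)) has_real_derivative cos (2 * x + 2 * L) * u x) (at x)" for x
    using DERIV_shift[of A "cos (2 * (x + L)) * u (x + L)" x L] A[of "x + L"] per[of x]
    by (simp add: algebra_simps)
  have dB: "((\<lambda>x. B (x + L)) has_real_derivative sin (2 * x + 2 * L) * u x) (at x)" for x
    using DERIV_shift[of B "sin (2 * (x + L)) * u (x + L)" x L] B[of "x + L"] per[of x]
    by (simp add: algebra_simps)
  have k: "kop L u = (\<lambda>x. (cos (2 * x + L) * (A (x + L) - A x) + sin (2 * x + L) * (B (x + L) - B x)) / (4 * sin L))"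
  proof
    fix x
    have "(\<lambda>y. cos (2 * (y - x) - L) * u y) =
        (\<lambda>y. cos (2 * x + L) * (cos (2 * y) * u y) + sin (2 * x + L) * (sin (2 * y) * u y))"
    proof
      fix y
      have "cos (2 * (y - x) - L) = cos (2 * y - (2 * x + L))" by (simp add: algebra_simps)
      also have "\<dots> = cos (2 * y) * cos (2 * x + L) + sin (2 * y) * sin (2 * x + L)" by (rule cos_diff)
      finally show "cos (2 * (y - x) - L) * u y =
        cos (2 * x + L) * (cos (2 * y) * u y) + sin (2 * x + L) * (sin (2 * y) * u y)"
        by (simp add: algebra_simps)
    qed
    then show "kop L u x = (cos (2 * x + L) * (A (x + L) - A x) + sin (2 * x + L) * (B (x + L) - B x)) / (4 * sin L)"
      unfolding kop_def Ai[symmetric] Bi[symmetric] 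
      by (simp add: integral_add[OF int(1) int(2)])
  qed
  have d: "dkop L u = (\<lambda>x. (cos (2 * x + L) * (B (x + L) - B x) - sin (2 * x + L) * (A (x + L) - A x)) / (2 * sin L))"
  proof
    fix x
    have "(\<lambda>y. sin (2 * (y - x) - L) * u y) =
        (\<lambda>y. cos (2 * x + L) * (sin (2 * y) * u y) - sin (2 * x + L) * (cos (2 * y) * u y))"
    proof
      fix y
      have "sin (2 * (y - x) - L) = sin (2 * y - (2 * x + L))" by (simp add: algebra_simps)
      also have "\<dots> = sin (2 * y) * cos (2 * x + L) - cos (2 * y) * sin (2 * x + L)" by (rule sin_diff)
      finally have E: "sin (2 * (y - x) - L) = sin (2 * y) * cos (2 * x + L) - cos (2 * y) * sin (2 * x + L)" .
      show "sin (2 * (y - x) - L) * u y =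
        cos (2 * x + L) * (sin (2 * y) * u y) - sin (2 * x + L) * (cos (2 * y) * u y)"
        unfolding E by (simp add: algebra_simps)
    qed
    then show "dkop L u x = (cos (2 * x + L) * (B (x + L) - B x) - sin (2 * x + L) * (A (x + L) - A x)) / (2 * sin L)"
      unfolding dkop_def Ai[symmetric] Bi[symmetric] 
      by (simp add: integral_diff[OF int(2) int(1)])
  qed
  have trig: "cos (2 * x + L) * cos (2 * x + 2 * L) + sin (2 * x + L) * sin (2 * x + 2 * L) = cos L"
    "cos (2 * x + L) * cos (2 * x) + sin (2 * x + L) * sin (2 * x) = cos L"
    "cos (2 * x + L) * sin (2 * x + 2 * L) - sin (2 * x + L) * cos (2 * x + 2 * L) = sin L"
    "cos (2 * x + L) * sin (2 * x) - sin (2 * x + L) * cos (2 * x) = - sin L"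
    using cos_diff[of "2 * x + L" "2 * x + 2 * L"] cos_diff[of "2 * x + L" "2 * x"]
      sin_diff[of "2 * x + 2 * L" "2 * x + L"] sin_diff[of "2 * x" "2 * x + L"]
    by (simp_all add: algebra_simps)
  let ?c = "cos (2 * x + L)" and ?s = "sin (2 * x + L)"
  have dc: "((\<lambda>x. cos (2 * x + L)) has_real_derivative - 2 * ?s) (at x)"
    and ds: "((\<lambda>x. sin (2 * x + L)) has_real_derivative 2 * ?c) (at x)"
    by (auto intro!: derivative_eq_intros)
  let ?dA = "cos (2 * x + 2 * L) * u x - cos (2 * x) * u x" and ?dB = "sin (2 * x + 2 * L) * u x - sin (2 * x) * u x"
  have "(kop L u has_real_derivative ((- 2 * ?s * (A (x + L) - A x) + ?dA * ?c)
      + (2 * ?c * (B (x + L) - B x) + ?dB * ?s)) / (4 * sin L)) (at x)"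
    unfolding k by (intro DERIV_cdivide DERIV_add DERIV_mult dc ds DERIV_diff dA dB A B)
  also have "(- 2 * ?s * (A (x + L) - A x) + ?dA * ?c) + (2 * ?c * (B (x + L) - B x) + ?dB * ?s)
     = 2 * (?c * (B (x + L) - B x) - ?s * (A (x + L) - A x))"
    using arg_cong2[OF trig(1,2), of "\<lambda>a b. (a - b) * u x"] by (simp add: algebra_simps)
  also have "\<dots> / (4 * sin L) = dkop L u x"
    unfolding d using s by (simp add: field_simps)
  finally show "(kop L u has_real_derivative dkop L u x) (at x)" .
  have "(dkop L u has_real_derivative ((- 2 * ?s * (B (x + L) - B x) + ?dB * ?c)
      - (2 * ?c * (A (x + L) - A x) + ?dA * ?s)) / (2 * sin L)) (at x)"
    unfolding d by (intro DERIV_cdivide DERIV_diff DERIV_mult dc ds dA dB A B)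
  also have "(- 2 * ?s * (B (x + L) - B x) + ?dB * ?c) - (2 * ?c * (A (x + L) - A x) + ?dA * ?s)
     = 2 * sin L * u x - 2 * (?c * (A (x + L) - A x) + ?s * (B (x + L) - B x))"
    using arg_cong2[OF trig(3,4), of "\<lambda>a b. (a - b) * u x"] by (simp add: algebra_simps)
  also have "\<dots> / (2 * sin L) = u x - 4 * kop L u x"
    unfolding k using s by (simp add: field_simps)
  finally show "(dkop L u has_real_derivative u x - 4 * kop L u x) (at x)" .
qed

lemma kop_periodic:
  assumes "\<And>x. u (x + L) = u x"
  shows "kop L u (x + L) = kop L u x" "dkop L u (x + L) = dkop L u x"
proof -
  have *: "integral {x + L..x + L + L} (\<lambda>y. k (y - (x + L)) * u y) = integral {x..x + L} (\<lambda>y. k (y - x) * u y)" for k :: "real \<Rightarrow> real"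
    using integral_shift_Icc_real[of x "x + L" "\<lambda>y. k (y - (x + L)) * u y" L] assms
    by (simp add: o_def add.commute[of L])
  show "kop L u (x + L) = kop L u x"
    unfolding kop_def using *[of "\<lambda>z. cos (2 * z - L)"] by simp
  show "dkop L u (x + L) = dkop L u x"
    unfolding dkop_def using *[of "\<lambda>z. sin (2 * z - L)"] by simp
qed

text \<open>Both kernels are bounded by 1. The L^1 distance over a period is the right quantity
  because \<open>g\<close> is continuous in time only as a map into L^1.\<close>

lemma kop_diff_bound:
  assumes u: "u \<in> borel_measurable borel" "\<And>x. \<bar>u x\<bar> \<le> B" and v: "v \<in> borel_measurable borel" "\<And>x. \<bar>v x\<bar> \<le> C"
    and L: "0 < L" "L < pi"
  shows "\<bar>kop L u x - kop L v x\<bar> \<le> integral {x..x + L} (\<lambda>y. \<bar>u y - v y\<bar>) / (4 * sin L)"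
    "\<bar>dkop L u x - dkop L v x\<bar> \<le> integral {x..x + L} (\<lambda>y. \<bar>u y - v y\<bar>) / (2 * sin L)"
proof -
  have s: "sin L > 0" using L by (rule sin_gt_zero)
  have *: "\<bar>integral {x..x + L} (\<lambda>y. k y * u y) - integral {x..x + L} (\<lambda>y. k y * v y)\<bar>
      \<le> integral {x..x + L} (\<lambda>y. \<bar>u y - v y\<bar>)"
    if k: "continuous_on UNIV k" "\<And>y. \<bar>k y\<bar> \<le> 1" for k :: "real \<Rightarrow> real"
  proof -
    have meas: "k \<in> borel_measurable borel" using k(1) by (rule borel_measurable_continuous_onI)
    have int: "(\<lambda>y. k y * w y) integrable_on {x..x + L}"
      if "w \<in> borel_measurable borel" "\<And>x. \<bar>w x\<bar> \<le> D" for w D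
      by (rule bounded_borel_integrable_on[where B = D])
        (use that meas mult_mono[OF k(2) that(2)] in \<open>auto simp: abs_mult\<close>)
    have "integral {x..x + L} (\<lambda>y. k y * u y) - integral {x..x + L} (\<lambda>y. k y * v y)
        = integral {x..x + L} (\<lambda>y. k y * u y - k y * v y)"
      using int[OF u] int[OF v] by (simp add: integral_diff)
    also have "\<bar>\<dots>\<bar> \<le> integral {x..x + L} (\<lambda>y. \<bar>u y - v y\<bar>)"
    proof (unfold real_norm_def[symmetric], rule integral_norm_bound_integral)
      show "(\<lambda>y. k y * u y - k y * v y) integrable_on {x..x + L}"
        using int[OF u] int[OF v] by (rule integrable_diff)
      show "(\<lambda>y. norm (u y - v y)) integrable_on {x..x + L}"
        by (rule bounded_borel_integrable_on[where B = "B + C"])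
          (use u v in \<open>auto intro: order_trans[OF abs_triangle_ineq4 add_mono]\<close>)
      show "norm (k y * u y - k y * v y) \<le> norm (u y - v y)" for y
        using mult_right_mono[OF k(2)[of y] abs_ge_zero[of "u y - v y"]]
        by (simp add: right_diff_distrib[symmetric] abs_mult)
    qed
    finally show ?thesis .
  qed
  have c: "continuous_on UNIV (\<lambda>y. 2 * (y - x) - L)" by (intro continuous_intros)
  show "\<bar>kop L u x - kop L v x\<bar> \<le> integral {x..x + L} (\<lambda>y. \<bar>u y - v y\<bar>) / (4 * sin L)"
    unfolding kop_def diff_divide_distrib[symmetric] 
    using s *[OF continuous_on_cos[OF c]]
    by (auto intro!: divide_right_mono simp: abs_divide simp del: right_diff_distrib_numeral)
  show "\<bar>dkop L u x - dkop L v x\<bar> \<le> integral {x..x + L} (\<lambda>y. \<bar>u y - v y\<bar>) / (2 * sin L)"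
    unfolding dkop_def diff_divide_distrib[symmetric] 
    using s *[OF continuous_on_sin[OF c]]
    by (auto intro!: divide_right_mono simp: abs_divide simp del: right_diff_distrib_numeral)
qed

lemma kop_diff_bound_sup:
  assumes "u \<in> borel_measurable borel" "\<And>x. \<bar>u x\<bar> \<le> B" "v \<in> borel_measurable borel" "\<And>x. \<bar>v x\<bar> \<le> C"
    and L: "0 < L" "L < pi" and D: "\<And>x. \<bar>u x - v x\<bar> \<le> D"
  shows "\<bar>kop L u x - kop L v x\<bar> \<le> L * D / (2 * sin L)"
    "\<bar>dkop L u x - dkop L v x\<bar> \<le> L * D / (2 * sin L)"
proof -
  have s: "sin L > 0" using L by (rule sin_gt_zero)
  have D0: "D \<ge> 0" using D[of 0] by linarith
  have "integral {x..x + L} (\<lambda>y. \<bar>u y - v y\<bar>) \<le> integral {x..x + L} (\<lambda>y. D)"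
  proof (rule integral_le)
    show "(\<lambda>y. \<bar>u y - v y\<bar>) integrable_on {x..x + L}"
      using assms by (intro bounded_borel_integrable_on[where B = D]) auto
  qed (use D in auto)
  then have I: "integral {x..x + L} (\<lambda>y. \<bar>u y - v y\<bar>) \<le> L * D"
    using L by simp
  show "\<bar>dkop L u x - dkop L v x\<bar> \<le> L * D / (2 * sin L)"
    using kop_diff_bound(2)[OF assms(1-6), of x] divide_right_mono[OF I, of "2 * sin L"] s by simp
  have "L * D / (4 * sin L) \<le> L * D / (2 * sin L)"
    using s L D0 by (simp add: field_simps)
  then show "\<bar>kop L u x - kop L v x\<bar> \<le> L * D / (2 * sin L)"
    using kop_diff_bound(1)[OF assms(1-6), of x] divide_right_mono[OF I, of "4 * sin L"] s by simp
qed

lemma kop_bound: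
  assumes "u \<in> borel_measurable borel" "\<And>x. \<bar>u x\<bar> \<le> B" and L: "0 < L" "L < pi"
  shows "\<bar>kop L u x\<bar> \<le> L * B / (2 * sin L)" "\<bar>dkop L u x\<bar> \<le> L * B / (2 * sin L)"
  using kop_diff_bound_sup[OF assms(1,2) _ _ L, of "\<lambda>_. 0" 0 B] assms(2)
  by (auto simp: kop_def dkop_def)

lemma kop_nonneg:
  assumes "continuous_on UNIV u" "\<And>x. 0 \<le> u x" and L: "0 < L" "L \<le> pi / 2"
  shows "0 \<le> kop L u x"
proof -
  have "sin L > 0" using L by (intro sin_gt_zero) auto
  moreover have "0 \<le> integral {x..x + L} (\<lambda>y. cos (2 * (y - x) - L) * u y)"
  proof (rule integral_nonneg)
    show "(\<lambda>y. cos (2 * (y - x) - L) * u y) integrable_on {x..x + L}"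
      using assms(1) by (auto intro!: integrable_continuous_interval continuous_intros intro: continuous_on_subset)
    show "0 \<le> cos (2 * (y - x) - L) * u y" if "y \<in> {x..x + L}" for y
      using that L assms(2) by (intro mult_nonneg_nonneg cos_ge_zero) auto
  qed
  ultimately show ?thesis unfolding kop_def by simp
qed

text \<open>The kernel may vanish at the ends of the period (it does for \<open>L = pi / 2\<close>), hence the
  restriction to the middle part of a one-sided neighbourhood of \<open>x0\<close>.\<close>
lemma kop_lower_bound:
  assumes u: "continuous_on UNIV u" "\<And>x. 0 \<le> u x" and per: "\<And>x. u (x + L) = u x"
    and L: "0 < L" "L \<le> pi / 2" and r: "0 < r" "r \<le> L / 2"
    and big: "\<And>z. \<bar>z - x0\<bar> \<le> r \<Longrightarrow> e \<le> u z" and e: "0 \<le> e"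
  shows "r / 2 * (sin (r / 2) * e) / (4 * sin L) \<le> kop L u x"
proof -
  have s: "sin L > 0" using L by (intro sin_gt_zero) auto
  obtain n :: int where n: "x \<le> x0 + of_int n * L" "x0 + of_int n * L < x + L"
    using shift_into_period[OF L(1)] by blast
  define z where "z = x0 + of_int n * L"
  have big': "e \<le> u y" if "\<bar>y - z\<bar> \<le> r" for y
    using big[of "y + of_int (-n) * L"] periodic_int_mult[of u L y "-n", OF per] that
    by (simp add: z_def algebra_simps)
  \<comment> \<open>A piece of length r/2 on the side of \<open>z\<close> that faces the midpoint of
    the period: it stays within \<open>r\<close> of \<open>z\<close> and, since r \<le> L/2, at
    distance at least r/4 from both ends.\<close>
  obtain c d where cd: "d - c = r / 2" "x + r / 4 \<le> c" "d \<le> x + L - r / 4"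
      "\<And>y. y \<in> {c..d} \<Longrightarrow> \<bar>y - z\<bar> \<le> r"
  proof (cases "z \<le> x + L / 2")
    case True
    then show ?thesis using n r that[of "z + 3 * r / 4" "z + r / 4"] by (auto simp: z_def)
  next
    case False
    then show ?thesis using n r that[of "z - r / 4" "z - 3 * r / 4"] by (auto simp: z_def)
  qed
  let ?f = "\<lambda>y. cos (2 * (y - x) - L) * u y"
  have pos: "0 \<le> ?f y" if "y \<in> {x..x + L}" for y
    using that L u(2) by (intro mult_nonneg_nonneg cos_ge_zero) auto
  have sr: "0 \<le> sin (r / 2)" using r L by (intro sin_ge_zero) auto
  have lo: "sin (r / 2) * e \<le> ?f y" if y: "y \<in> {c..d}" for y
  proof (rule mult_mono)
    \<comment> \<open>At distance at least r/4 from the ends, the argument of the cosine is at most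
      L - r/2 \<le> pi/2 - r/2 in absolute value.\<close>
    have "sin (r / 2) = cos (pi / 2 - r / 2)" by (simp add: cos_diff)
    also have "\<dots> \<le> cos \<bar>2 * (y - x) - L\<bar>"
      using y cd L r by (intro cos_monotone_0_pi_le) auto
    finally show "sin (r / 2) \<le> cos (2 * (y - x) - L)" by simp
    then show "0 \<le> cos (2 * (y - x) - L)" using sr by simp
  qed (use big' cd(4) y e in auto)
  have int: "?f integrable_on {a..b}" for a b
    using u(1) by (auto intro!: integrable_continuous_interval continuous_intros intro: continuous_on_subset)
  have "r / 2 * (sin (r / 2) * e) = integral {c..d} (\<lambda>_. sin (r / 2) * e)"
    using cd(1) r by simp
  also have "\<dots> \<le> integral {c..d} ?f"
    by (rule integral_le) (use lo int in auto)
  also have "\<dots> \<le> integral {x..x + L} ?f"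
    by (rule integral_subset_le) (use cd r int pos in auto)
  finally show ?thesis
    unfolding kop_def using s by (intro divide_right_mono) auto
qed

section \<open>Uniformly continuous families and the du Bois-Reymond lemma\<close>

text \<open>A class that is closed under products and under the Green operator and contains
  \<open>G\<close>, \<open>dG\<close>, \<open>H\<close>, \<open>dH\<close> and \<open>V\<close>.
  Bound and Lipschitz constant are uniform over all times, as the long-time argument demands; the
  modulus of continuity in time may depend on \<open>t0\<close>, because nothing better is known for
  \<open>g\<close>.\<close>

definition ufam :: "(real \<Rightarrow> real \<Rightarrow> real) \<Rightarrow> bool" where
  "ufam f \<longleftrightarrow> (\<exists>B. \<forall>t x. \<bar>f t x\<bar> \<le> B) \<and> (\<exists>M. \<forall>t x y. \<bar>f t x - f t y\<bar> \<le> M * \<bar>x - y\<bar>) \<and>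
     (\<forall>t0 e. 0 < e \<longrightarrow> (\<exists>d>0. \<forall>t. \<bar>t - t0\<bar> < d \<longrightarrow> (\<forall>x. \<bar>f t x - f t0 x\<bar> \<le> e)))"

lemma ufam_bounded:
  assumes "ufam f" obtains B where "0 < B" "\<And>t x. \<bar>f t x\<bar> \<le> B"
proof -
  obtain B where "\<And>t x. \<bar>f t x\<bar> \<le> B" using assms unfolding ufam_def by blast
  then show ?thesis using that[of "max 1 B"] by (auto simp: le_max_iff_disj)
qed

lemma ufam_lipschitz:
  assumes "ufam f" obtains M where "0 < M" "\<And>t x y. \<bar>f t x - f t y\<bar> \<le> M * \<bar>x - y\<bar>"
proof -
  obtain M where M: "\<And>t x y. \<bar>f t x - f t y\<bar> \<le> M * \<bar>x - y\<bar>" using assms unfolding ufam_def by blast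
  show ?thesis
  proof (rule that[of "max 1 M"])
    show "\<bar>f t x - f t y\<bar> \<le> max 1 M * \<bar>x - y\<bar>" for t x y
      using order_trans[OF M mult_right_mono[of M "max 1 M" "\<bar>x - y\<bar>"]] by auto
  qed auto
qed

lemma ufam_near:
  assumes "ufam f" "0 < e" obtains d where "0 < d" "\<And>t x. \<bar>t - t0\<bar> < d \<Longrightarrow> \<bar>f t x - f t0 x\<bar> \<le> e"
  using assms unfolding ufam_def by metis

lemma ufam_continuous:
  assumes "ufam f" shows "continuous_on UNIV (\<lambda>p. f (fst p) (snd p))"
proof -
  obtain M where M: "0 < M" "\<And>t x y. \<bar>f t x - f t y\<bar> \<le> M * \<bar>x - y\<bar>" using assms by (metis ufam_lipschitz)
  show ?thesis
    unfolding continuous_on_iff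
  proof safe
    fix t0 x0 e :: real assume e: "0 < e"
    obtain d where d: "0 < d" "\<And>t x. \<bar>t - t0\<bar> < d \<Longrightarrow> \<bar>f t x - f t0 x\<bar> \<le> e / 3"
      using ufam_near[OF assms, of "e / 3" t0] e by auto
    show "\<exists>d>0. \<forall>x'\<in>UNIV. dist x' (t0, x0) < d \<longrightarrow> dist (f (fst x') (snd x')) (f (fst (t0, x0)) (snd (t0, x0))) < e"
    proof (intro exI[of _ "min d (e / (3 * M))"] conjI ballI impI)
      show "0 < min d (e / (3 * M))" using d e M by simp
      fix p :: "real \<times> real" assume p: "dist p (t0, x0) < min d (e / (3 * M))"
      have "\<bar>fst p - t0\<bar> < d" "\<bar>snd p - x0\<bar> \<le> e / (3 * M)"
        using dist_fst_le[of p "(t0, x0)"] dist_snd_le[of p "(t0, x0)"] p by (auto simp: dist_real_def)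
      then have "\<bar>f (fst p) (snd p) - f t0 (snd p)\<bar> \<le> e / 3" "M * \<bar>snd p - x0\<bar> \<le> e / 3"
        using d(2) M(1) by (auto simp: field_simps)
      then show "dist (f (fst p) (snd p)) (f (fst (t0, x0)) (snd (t0, x0))) < e"
        using M(2)[of t0 "snd p" x0] e
          abs_triangle_ineq[of "f (fst p) (snd p) - f t0 (snd p)" "f t0 (snd p) - f t0 x0"]
        by (simp add: dist_real_def)
    qed
  qed
qed

lemma ufam_continuous_compose:
  assumes "ufam f" "continuous_on S a" "continuous_on S b"
  shows "continuous_on S (\<lambda>s. f (a s) (b s))"
  using continuous_on_compose2[OF ufam_continuous[OF assms(1)] continuous_on_Pair[OF assms(2,3)]] by simp

lemma ufam_section_continuous: "ufam f \<Longrightarrow> continuous_on S (f t)"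
  by (rule ufam_continuous_compose[of f S "\<lambda>_. t" "\<lambda>x. x", simplified]) (auto intro: continuous_intros)

lemma ufam_time_continuous: "ufam f \<Longrightarrow> continuous_on S (\<lambda>t. f t x)"
  by (rule ufam_continuous_compose) (auto intro: continuous_intros)

lemma ufam_add:
  assumes "ufam f" "ufam k" shows "ufam (\<lambda>t x. f t x + k t x)"
proof -
  obtain B C where "\<And>t x. \<bar>f t x\<bar> \<le> B" "\<And>t x. \<bar>k t x\<bar> \<le> C" using assms by (metis ufam_bounded)
  then have 1: "\<bar>f t x + k t x\<bar> \<le> B + C" for t x by (meson abs_triangle_ineq add_mono order_trans)
  obtain M N where MN: "\<And>t x y. \<bar>f t x - f t y\<bar> \<le> M * \<bar>x - y\<bar>" "\<And>t x y. \<bar>k t x - k t y\<bar> \<le> N * \<bar>x - y\<bar>"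
    using assms by (metis ufam_lipschitz)
  have 2: "\<bar>(f t x + k t x) - (f t y + k t y)\<bar> \<le> (M + N) * \<bar>x - y\<bar>" for t x y
    using MN[of t x y] unfolding distrib_right by linarith
  have 3: "\<exists>d>0. \<forall>t. \<bar>t - t0\<bar> < d \<longrightarrow> (\<forall>x. \<bar>(f t x + k t x) - (f t0 x + k t0 x)\<bar> \<le> e)" if "0 < e" for t0 e
  proof -
    have e: "0 < e / 2" using that by simp
    obtain d where d: "0 < d" "\<And>t x. \<bar>t - t0\<bar> < d \<Longrightarrow> \<bar>f t x - f t0 x\<bar> \<le> e / 2"
      using ufam_near[OF assms(1) e] by blast
    obtain d' where d': "0 < d'" "\<And>t x. \<bar>t - t0\<bar> < d' \<Longrightarrow> \<bar>k t x - k t0 x\<bar> \<le> e / 2"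
      using ufam_near[OF assms(2) e] by blast
    have "\<bar>(f t x + k t x) - (f t0 x + k t0 x)\<bar> \<le> e" if "\<bar>t - t0\<bar> < min d d'" for t x
      using d(2)[of t x] d'(2)[of t x] that by (simp only: abs_le_iff) linarith
    then show ?thesis using d(1) d'(1) by (intro exI[of _ "min d d'"]) auto
  qed
  show ?thesis unfolding ufam_def using 1 2 3 by blast
qed

lemma ufam_mult:
  assumes "ufam f" "ufam k" shows "ufam (\<lambda>t x. f t x * k t x)"
proof -
  obtain B C where B: "0 < B" "\<And>t x. \<bar>f t x\<bar> \<le> B" and C: "0 < C" "\<And>t x. \<bar>k t x\<bar> \<le> C"
    using assms by (metis ufam_bounded)
  have 1: "\<bar>f t x * k t x\<bar> \<le> B * C" for t x 
    using mult_mono[OF B(2)[of t x] C(2)[of t x]] B(1) by (simp add: abs_mult)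
  have key: "\<bar>f t x * k t x - f s y * k s y\<bar> \<le> C * \<bar>f t x - f s y\<bar> + B * \<bar>k t x - k s y\<bar>" for t x s y
  proof -
    have "f t x * k t x - f s y * k s y = (f t x - f s y) * k t x + f s y * (k t x - k s y)"
      by (simp add: algebra_simps)
    also have "\<bar>\<dots>\<bar> \<le> \<bar>f t x - f s y\<bar> * \<bar>k t x\<bar> + \<bar>f s y\<bar> * \<bar>k t x - k s y\<bar>"
      using abs_triangle_ineq[of "(f t x - f s y) * k t x" "f s y * (k t x - k s y)"] by (simp add: abs_mult)
    also have "\<dots> \<le> \<bar>f t x - f s y\<bar> * C + B * \<bar>k t x - k s y\<bar>"
      using B C by (intro add_mono mult_mono) auto
    finally show ?thesis by (simp add: mult.commute)
  qed
  obtain M N where M: "\<And>t x y. \<bar>f t x - f t y\<bar> \<le> M * \<bar>x - y\<bar>" and N: "\<And>t x y. \<bar>k t x - k t y\<bar> \<le> N * \<bar>x - y\<bar>"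
    using assms by (metis ufam_lipschitz)
  have 2: "\<bar>f t x * k t x - f t y * k t y\<bar> \<le> (C * M + B * N) * \<bar>x - y\<bar>" for t x y
    using key[of t x t y] mult_left_mono[OF M[of t x y] less_imp_le[OF C(1)]]
      mult_left_mono[OF N[of t x y] less_imp_le[OF B(1)]]
    unfolding distrib_right mult.assoc by linarith
  have 3: "\<exists>d>0. \<forall>t. \<bar>t - t0\<bar> < d \<longrightarrow> (\<forall>x. \<bar>f t x * k t x - f t0 x * k t0 x\<bar> \<le> e)" if "0 < e" for t0 e
  proof -
    have e: "0 < e / (2 * C)" "0 < e / (2 * B)" using that B C by auto
    obtain d where d: "0 < d" "\<And>t x. \<bar>t - t0\<bar> < d \<Longrightarrow> \<bar>f t x - f t0 x\<bar> \<le> e / (2 * C)"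
      using ufam_near[OF assms(1) e(1)] by blast
    obtain d' where d': "0 < d'" "\<And>t x. \<bar>t - t0\<bar> < d' \<Longrightarrow> \<bar>k t x - k t0 x\<bar> \<le> e / (2 * B)"
      using ufam_near[OF assms(2) e(2)] by blast
    have "\<bar>f t x * k t x - f t0 x * k t0 x\<bar> \<le> e" if "\<bar>t - t0\<bar> < min d d'" for t x
    proof -
      have "C * \<bar>f t x - f t0 x\<bar> \<le> C * (e / (2 * C))" "B * \<bar>k t x - k t0 x\<bar> \<le> B * (e / (2 * B))"
        using d(2)[of t x] d'(2)[of t x] that B(1) C(1) by (auto intro: mult_left_mono simp del: times_divide_eq_right)
      then show ?thesis using key[of t x t0 x] B(1) C(1) by simp
    qed
    then show ?thesis using d(1) d'(1) by (intro exI[of _ "min d d'"]) auto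
  qed
  show ?thesis unfolding ufam_def using 1 2 3 by blast
qed

lemma ufam_const: "ufam (\<lambda>t x. c)"
  unfolding ufam_def by (auto intro: exI[of _ 1] exI[of _ 0])

lemma ufam_cmult: "ufam f \<Longrightarrow> ufam (\<lambda>t x. c * f t x)"
  by (rule ufam_mult[OF ufam_const])

lemma ufam_diff: "ufam f \<Longrightarrow> ufam k \<Longrightarrow> ufam (\<lambda>t x. f t x - k t x)"
  using ufam_add[OF _ ufam_cmult, of f k "-1"] by simp

lemma lipschitz_of_deriv_bound:
  fixes f :: "real \<Rightarrow> real"
  assumes "\<And>x. (f has_real_derivative f' x) (at x)" "\<And>x. \<bar>f' x\<bar> \<le> M"
  shows "\<bar>f x - f y\<bar> \<le> M * \<bar>x - y\<bar>"
proof -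
  have "\<exists>z. f x - f y = (x - y) * f' z"
    using MVT2[of x y f f'] MVT2[of y x f f'] assms(1)
    by (cases x y rule: linorder_cases) (auto simp: algebra_simps, metis)
  then obtain z where "f x - f y = (x - y) * f' z" by blast
  then show ?thesis
    using mult_right_mono[OF assms(2)[of z] abs_ge_zero[of "x - y"]] by (simp add: abs_mult mult.commute)
qed

text \<open>The derivatives of \<open>kop L u\<close> and \<open>dkop L u\<close> are
  \<open>dkop L u\<close> and \<open>u - 4 * kop L u\<close>, bounded uniformly in time, which gives
  the Lipschitz constants. Continuity in time is inherited from \<open>u\<close> through the
  sup-norm estimate for differences.\<close>

lemma ufam_kop:
  assumes u: "ufam u" and per: "\<And>t x. u t (x + L) = u t x" and L: "0 < L" "L < pi"
  shows "ufam (\<lambda>t. kop L (u t))" "ufam (\<lambda>t. dkop L (u t))"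
proof -
  have s: "sin L > 0" using L by (rule sin_gt_zero)
  obtain B where B: "0 < B" "\<And>t x. \<bar>u t x\<bar> \<le> B" using ufam_bounded[OF u] by blast
  have cont: "continuous_on UNIV (u t)" for t
    by (rule ufam_continuous_compose[OF u]) (auto intro: continuous_intros)
  then have meas: "u t \<in> borel_measurable borel" for t by (rule borel_measurable_continuous_onI)
  let ?B = "L * B / (2 * sin L)"
  note b = kop_bound[OF meas B(2) L]
  have lip: "\<bar>kop L (u t) x - kop L (u t) y\<bar> \<le> ?B * \<bar>x - y\<bar>" for t x y
    by (rule lipschitz_of_deriv_bound[OF kop_deriv(1)[OF cont L per] b(2)])
  have "\<bar>u t x - 4 * kop L (u t) x\<bar> \<le> B + 4 * ?B" for t x
    using B(2)[of t x] b(1)[of t x] by (simp only: abs_le_iff) linarith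
  then have lip': "\<bar>dkop L (u t) x - dkop L (u t) y\<bar> \<le> (B + 4 * ?B) * \<bar>x - y\<bar>" for t x y
    by (rule lipschitz_of_deriv_bound[OF kop_deriv(2)[OF cont L per]])
  have near: "\<exists>d>0. \<forall>t. \<bar>t - t0\<bar> < d \<longrightarrow> (\<forall>x. \<bar>kop L (u t) x - kop L (u t0) x\<bar> \<le> e \<and>
      \<bar>dkop L (u t) x - dkop L (u t0) x\<bar> \<le> e)" if e: "0 < e" for t0 e
  proof -
    have "0 < e * (2 * sin L) / L" using e s L by simp
    then obtain d where d: "0 < d" "\<And>t x. \<bar>t - t0\<bar> < d \<Longrightarrow> \<bar>u t x - u t0 x\<bar> \<le> e * (2 * sin L) / L"
      using ufam_near[OF u] by blast
    show ?thesis
    proof (intro exI[of _ d] conjI allI impI d(1))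
      fix t x assume "\<bar>t - t0\<bar> < d"
      then show "\<bar>kop L (u t) x - kop L (u t0) x\<bar> \<le> e" "\<bar>dkop L (u t) x - dkop L (u t0) x\<bar> \<le> e"
        using kop_diff_bound_sup[OF meas B(2) meas B(2) L d(2), of t x] s L by auto
    qed
  qed
  show "ufam (\<lambda>t. kop L (u t))" unfolding ufam_def using b(1) lip near by blast
  show "ufam (\<lambda>t. dkop L (u t))" unfolding ufam_def using b(2) lip' near by blast
qed

text \<open>The test function is the primitive of \<open>(t - a) * (b - t) * (\<Phi> t - c)\<close>, where
  \<open>\<Phi> t = F t - (\<integral>\<^sub>a\<^sup>t R)\<close> and \<open>c\<close> is the weighted mean of \<open>\<Phi>\<close>.\<close>
lemma du_bois_reymond:
  fixes F R :: "real \<Rightarrow> real"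
  assumes F: "continuous_on UNIV F" and R: "continuous_on UNIV R" and ab: "a < b"
    and test: "\<And>\<alpha> \<alpha>'. (\<And>t. (\<alpha> has_real_derivative \<alpha>' t) (at t)) \<Longrightarrow> continuous_on UNIV \<alpha>' \<Longrightarrow>
        (\<And>t. t \<notin> {a..b} \<Longrightarrow> \<alpha> t = 0) \<Longrightarrow> (\<And>t. t \<notin> {a..b} \<Longrightarrow> \<alpha>' t = 0) \<Longrightarrow>
        integral {a..b} (\<lambda>t. \<alpha>' t * F t + \<alpha> t * R t) = 0"
  shows "F b - F a = integral {a..b} R"
proof -
  obtain P where P: "\<And>t. (P has_real_derivative R t) (at t)" using ex_antiderivative[OF R] by blast
  have Pc: "continuous_on UNIV P" using P by (meson DERIV_continuous_on has_field_derivative_at_within)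
  define \<Phi> where "\<Phi> t = F t - P t" for t
  have \<Phi>c: "continuous_on S \<Phi>" for S
    unfolding \<Phi>_def using F Pc by (auto intro!: continuous_intros intro: continuous_on_subset)
  \<comment> \<open>The weight vanishes at and outside the ends, so \<beta> is continuous on the
    whole line and its primitive is an admissible C^1 test function.\<close>
  define w where "w t = max 0 ((t - a) * (b - t))" for t
  have wc: "continuous_on S w" for S
    unfolding w_def by (auto intro!: continuous_intros)
  have w0: "w t = 0" if "t \<notin> {a..b}" for t
    using that ab mult_nonneg_nonpos[of "t - a" "b - t"] mult_nonpos_nonneg[of "t - a" "b - t"]
    unfolding w_def by (cases "t < a") auto
  have wpos: "0 < w t" if "a < t" "t < b" for t using that unfolding w_def by (auto simp: max_def)
  have wnn: "0 \<le> w t" for t unfolding w_def by simp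
  have ci: "f integrable_on {a..b}" if "continuous_on UNIV f" for f :: "real \<Rightarrow> real"
    using that by (auto intro: integrable_continuous_interval continuous_on_subset)
  have W: "0 < integral {a..b} w"
  proof -
    have "integral {a..b} w \<noteq> 0"
      using integral_eq_0_iff[of a b w] wc wnn wpos[of "(a + b) / 2"] ab by fastforce
    moreover have "0 \<le> integral {a..b} w" using wnn ci[OF wc] by (intro integral_nonneg) auto
    ultimately show ?thesis by simp
  qed
  define c where "c = integral {a..b} (\<lambda>t. w t * \<Phi> t) / integral {a..b} w"
  define \<beta> where "\<beta> t = w t * (\<Phi> t - c)" for t
  have \<beta>c: "continuous_on S \<beta>" for S
    unfolding \<beta>_def by (intro continuous_intros wc \<Phi>c)
  have \<beta>0: "\<beta> t = 0" if "t \<notin> {a..b}" for t using w0[OF that] by (simp add: \<beta>_def)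
  obtain A where A: "\<And>t. (A has_real_derivative \<beta> t) (at t)" using ex_antiderivative[OF \<beta>c] by blast
  define \<alpha> where "\<alpha> t = A t - A a" for t
  have d\<alpha>: "(\<alpha> has_real_derivative \<beta> t) (at t)" for t
    unfolding \<alpha>_def using A by (auto intro!: derivative_eq_intros)
  \<comment> \<open>This makes the primitive \<alpha> return to 0 at \<open>b\<close>, hence vanish
    on both sides of the interval.\<close>
  have i\<beta>: "integral {a..b} \<beta> = 0"
  proof -
    have "integral {a..b} \<beta> = integral {a..b} (\<lambda>t. w t * \<Phi> t - c * w t)"
      unfolding \<beta>_def by (simp add: algebra_simps)
    also have "\<dots> = integral {a..b} (\<lambda>t. w t * \<Phi> t) - c * integral {a..b} w"
      by (subst integral_diff) (auto intro!: ci continuous_intros wc \<Phi>c)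
    finally show ?thesis using W by (simp add: c_def)
  qed
  have \<alpha>0: "\<alpha> t = 0" if "t \<notin> {a..b}" for t
  proof (cases "t < a")
    case True
    have "integral {t..a} \<beta> = A a - A t" using True by (intro integral_antiderivative A) auto
    moreover have "integral {t..a} \<beta> = 0"
      using \<beta>0 by (intro integral_unique has_integral_spike_finite[of "{a}" _ \<beta> "\<lambda>_. 0", OF _ _ has_integral_0]) auto
    ultimately show ?thesis by (simp add: \<alpha>_def)
  next
    case False
    then have t: "b < t" using that by auto
    have "integral {b..t} \<beta> = A t - A b" using t by (intro integral_antiderivative A) auto
    moreover have "integral {b..t} \<beta> = 0"
      using \<beta>0 by (intro integral_unique has_integral_spike_finite[of "{b}" _ \<beta> "\<lambda>_. 0", OF _ _ has_integral_0]) auto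
    moreover have "integral {a..b} \<beta> = A b - A a" using ab by (intro integral_antiderivative A) auto
    ultimately show ?thesis using i\<beta> by (simp add: \<alpha>_def)
  qed
  have \<alpha>c: "continuous_on UNIV \<alpha>" using d\<alpha> by (meson DERIV_continuous_on has_field_derivative_at_within)
  have \<alpha>b: "\<alpha> b = 0" using i\<beta> integral_antiderivative[OF A, of a b] ab by (simp add: \<alpha>_def)
  have "((\<lambda>t. \<alpha> t * P t) has_real_derivative (\<beta> t * P t + \<alpha> t * R t)) (at t)" for t
    using DERIV_mult[OF d\<alpha> P, of t] by (simp add: algebra_simps)
  from integral_antiderivative[OF this, of a b]
  have 1: "integral {a..b} (\<lambda>t. \<beta> t * P t + \<alpha> t * R t) = 0" using ab \<alpha>b by (simp add: \<alpha>_def)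
  have 2: "integral {a..b} (\<lambda>t. \<beta> t * F t + \<alpha> t * R t) = 0"
    using test[OF d\<alpha> \<beta>c \<alpha>0 \<beta>0] by simp
  have "integral {a..b} (\<lambda>t. \<beta> t * \<Phi> t)
      = integral {a..b} (\<lambda>t. (\<beta> t * F t + \<alpha> t * R t) - (\<beta> t * P t + \<alpha> t * R t))"
    unfolding \<Phi>_def by (simp add: algebra_simps)
  also have "\<dots> = 0"
    by (subst integral_diff) (use 1 2 F R Pc \<alpha>c in \<open>auto intro!: ci continuous_intros \<beta>c\<close>)
  finally have 3: "integral {a..b} (\<lambda>t. \<beta> t * \<Phi> t) = 0" .
  \<comment> \<open>Since \<beta> has integral 0, subtracting c \<beta> costs nothing and completes
    the square.\<close>
  have "integral {a..b} (\<lambda>t. w t * (\<Phi> t - c)^2) = integral {a..b} (\<lambda>t. \<beta> t * \<Phi> t - c * \<beta> t)"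
    unfolding \<beta>_def by (simp add: algebra_simps power2_eq_square)
  also have "\<dots> = 0"
    by (subst integral_diff) (use 3 i\<beta> in \<open>auto intro!: ci continuous_intros \<beta>c \<Phi>c\<close>)
  finally have z: "w t * (\<Phi> t - c)^2 = 0" if "t \<in> {a..b}" for t
    using integral_eq_0_iff[of a b "\<lambda>t. w t * (\<Phi> t - c)^2"] that ab wnn wc \<Phi>c
    by (fastforce intro!: continuous_intros)
  have eq: "\<Phi> t = c" if "t \<in> {a<..<b}" for t using z[of t] that wpos[of t] by auto
  have "\<Phi> t = c" if "t \<in> closure {a<..<b}" for t
    using continuous_constant_on_closure[OF \<Phi>c eq that] by simp
  then have "\<Phi> a = c" "\<Phi> b = c" using ab by auto
  then show ?thesis using integral_antiderivative[OF P, of a b] ab by (simp add: \<Phi>_def)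
qed

section \<open>The evolution of \<open>G\<close>\<close>

lemma continuous_periodic_bounded:
  fixes f :: "real \<Rightarrow> real"
  assumes "continuous_on UNIV f" "\<And>x. f (x + L) = f x" "L > 0"
  obtains B where "\<And>x. \<bar>f x\<bar> \<le> B"
proof -
  have "bounded (f ` {0..L})"
    using assms(1) by (intro compact_imp_bounded compact_continuous_image) (auto intro: continuous_on_subset)
  then obtain B where B: "\<And>x. x \<in> {0..L} \<Longrightarrow> \<bar>f x\<bar> \<le> B" by (metis bounded_iff imageI real_norm_def)
  have "\<bar>f x\<bar> \<le> B" for x
  proof -
    obtain n :: int where "0 \<le> x + of_int n * L" "x + of_int n * L < 0 + L"
      using shift_into_period[OF assms(3)] by blast
    then show ?thesis using B[of "x + of_int n * L"] periodic_int_mult[of f L x n, OF assms(2)] by auto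
  qed
  then show ?thesis using that by blast
qed

locale euler_profile =
  fixes m :: nat and g0 :: "real \<Rightarrow> real" and g G :: "real \<Rightarrow> real \<Rightarrow> real"
  assumes m4: "m \<ge> 4" and sol: "is_solution m g0 g G"
begin

definition L :: real where "L = 2 * pi / real m"

lemma L: "0 < L" "L \<le> pi / 2" "L < pi"
proof -
  show "0 < L" using m4 by (simp add: L_def)
  show "L \<le> pi / 2" using m4 by (simp add: L_def field_simps)
  then show "L < pi" using pi_gt_zero by linarith
qed

lemma sin_L: "0 < sin L" using L by (intro sin_gt_zero)

lemma two_pi: "2 * pi = of_int (int m) * L" using m4 by (simp add: L_def)

lemma period_2pi:
  fixes f :: "real \<Rightarrow> real" assumes "\<And>x. f (x + L) = f x" shows "f (x + 2 * pi) = f x"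
  unfolding two_pi by (rule periodic_int_mult[of f L, OF assms])

lemma G_per: "G t (x + L) = G t x"
  using sol by (auto simp: is_solution_def inv_op_def msym_def L_def)

lemma g_bound: obtains B where "0 < B" "\<And>t x. \<bar>g t x\<bar> \<le> B"
proof -
  obtain B where "\<And>t x. \<bar>g t x\<bar> \<le> B" using sol unfolding is_solution_def by blast
  then show ?thesis using that[of "max 1 B"] by (auto simp: le_max_iff_disj)
qed

lemma g_borel: "g t \<in> borel_measurable borel"
proof -
  have "(\<lambda>p. g (fst p) (snd p)) \<in> borel_measurable borel" using sol by (simp add: is_solution_def)
  from measurable_compose[OF _ this, of "\<lambda>x. (t, x)" borel]
  show ?thesis by (simp add: borel_measurable_continuous_onI continuous_on_Pair)
qed

definition dG :: "real \<Rightarrow> real \<Rightarrow> real" where "dG t = deriv (G t)"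

lemma G_deriv: "(G t has_real_derivative dG t x) (at x)"
  using sol unfolding is_solution_def inv_op_def dG_def
  by (metis DERIV_deriv_iff_real_differentiable)

lemma G_cont: "continuous_on S (G t)"
  using G_deriv by (meson DERIV_continuous_on has_field_derivative_at_within)

lemma dG_per: "dG t (x + L) = dG t x"
proof -
  have "((\<lambda>x. G t (x + L)) has_real_derivative dG t (x + L)) (at x)"
    using G_deriv[of t "x + L"] DERIV_shift by blast
  then show ?thesis using G_deriv[of t x] G_per DERIV_unique by force
qed

lemma wderiv_dG: "wderiv (dG t) (\<lambda>x. g t x - 4 * G t x)"
proof -
  have meas: "(\<lambda>x. g t x - 4 * G t x) \<in> borel_measurable borel"
    using g_borel borel_measurable_continuous_onI[OF G_cont] by measurable
  obtain B where B: "\<And>x. \<bar>g t x\<bar> \<le> B" using g_bound by metis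
  obtain C where C: "\<And>x. \<bar>G t x\<bar> \<le> C" using continuous_periodic_bounded[OF G_cont G_per L(1)] by metis
  have bd: "\<bar>g t x - 4 * G t x\<bar> \<le> B + 4 * C" for x
    using B[of x] C[of x] by (simp only: abs_le_iff) linarith
  have int: "((\<lambda>x. g t x - 4 * G t x) has_integral (dG t b - dG t a)) {a..b}" if "a \<le> b" for a b
  proof -
    have *: "set_integrable lborel {a..b} (\<lambda>s. g t s - 4 * G t s)"
        "dG t b - dG t a = (LINT s:{a..b}|lborel. g t s - 4 * G t s)"
      using sol that unfolding is_solution_def inv_op_def dG_def by blast+
    show ?thesis unfolding *(2) set_borel_integral_eq_integral(2)[OF *(1)]
      using set_borel_integral_eq_integral(1)[OF *(1)] by (rule integrable_integral)
  qed
  have "\<bar>dG t x\<bar> \<le> \<bar>dG t 0\<bar> + (B + 4 * C) * L" for x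
  proof -
    obtain n :: int where n: "0 \<le> x + of_int n * L" "x + of_int n * L < 0 + L"
      using shift_into_period[OF L(1)] by blast
    let ?x = "x + of_int n * L"
    have BC: "0 \<le> B + 4 * C" using order_trans[OF abs_ge_zero bd[of 0]] .
    have "\<bar>dG t ?x - dG t 0\<bar> \<le> (B + 4 * C) * (?x - 0)"
      using has_integral_bound_real[OF BC finite.emptyI int[OF n(1)]] bd n by auto
    also have "\<dots> \<le> (B + 4 * C) * L" using BC n by (intro mult_left_mono) auto
    finally show ?thesis using periodic_int_mult[of "dG t" L x n, OF dG_per] by simp
  qed
  then show ?thesis unfolding wderiv_def using meas bd int by blast
qed

lemma wderiv_G: "wderiv (G t) (dG t)"
proof -
  obtain B where "\<And>x. \<bar>dG t x\<bar> \<le> B" using wderiv_dG by (metis wderivE)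
  moreover obtain C where "\<And>x. \<bar>G t x\<bar> \<le> C" using continuous_periodic_bounded[OF G_cont G_per L(1)] by metis
  ultimately show ?thesis by (intro wderivI_deriv[OF G_deriv wderiv_continuous[OF wderiv_dG]])
qed

text \<open>With h = g - 4 G the datum h + 4 G of the representation formula is \<open>g\<close>
  itself, so bounds on \<open>G\<close> and \<open>dG\<close> reduce to bounds on integrals of
  \<open>g\<close>.\<close>

lemma G_eq_kop: "G t x = kop L (g t) x" and dG_eq_dkop: "dG t x = dkop L (g t) x"
  using kop_representation[OF wderiv_G wderiv_dG G_per dG_per L(1,3), of t x] by auto

lemma period_sup:
  fixes f :: "real \<Rightarrow> real" assumes "\<And>x. f (x + L) = f x" "\<And>x. 0 \<le> x \<Longrightarrow> x < L \<Longrightarrow> \<bar>f x\<bar> \<le> e"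
  shows "\<bar>f x\<bar> \<le> e"
proof -
  obtain n :: int where n: "0 \<le> x + of_int n * L" "x + of_int n * L < 0 + L"
    using shift_into_period[OF L(1)] by blast
  then show ?thesis
    using assms(2)[of "x + of_int n * L"] periodic_int_mult[of f L x n, OF assms(1)] by auto
qed

text \<open>A window of length L starting in [0, L) lies inside [0, 2 pi], so L^1 continuity of
  \<open>g\<close> on the circle controls the Green integrals there, and periodicity extends the
  estimate to all \<open>x\<close>. The threshold e * (2 sin L) undoes the normalisation of
  \<open>dkop\<close>; for \<open>kop\<close> a factor 2 is left over.\<close>

lemma G_time_continuity:
  assumes "0 < e"
  shows "\<exists>d>0. \<forall>t. \<bar>t - t0\<bar> < d \<longrightarrow> (\<forall>x. \<bar>G t x - G t0 x\<bar> \<le> e \<and> \<bar>dG t x - dG t0 x\<bar> \<le> e)"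
proof -
  obtain B where B: "0 < B" "\<And>t x. \<bar>g t x\<bar> \<le> B" using g_bound by metis
  have gd: "\<bar>g t x - g t0 x\<bar> \<le> B + B" for t x
    using B(2)[of t x] B(2)[of t0 x] by linarith
  have "((\<lambda>t. LINT \<theta>:{0..2*pi}|lborel. \<bar>g t \<theta> - g t0 \<theta>\<bar>) \<longlongrightarrow> 0) (at t0)"
    using sol by (simp add: is_solution_def)
  moreover have "(LINT \<theta>:{0..2*pi}|lborel. \<bar>g t \<theta> - g t0 \<theta>\<bar>) = integral {0..2*pi} (\<lambda>x. \<bar>g t x - g t0 x\<bar>)" for t
    by (intro set_borel_integral_eq_integral bounded_borel_set_integrable[where B = "B + B"])
      (use g_borel gd in auto)
  ultimately have "((\<lambda>t. integral {0..2*pi} (\<lambda>x. \<bar>g t x - g t0 x\<bar>)) \<longlongrightarrow> 0) (at t0)" by simp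
  moreover have "0 < e * (2 * sin L)" using assms sin_L by simp
  ultimately have "\<forall>\<^sub>F t in at t0. dist (integral {0..2*pi} (\<lambda>x. \<bar>g t x - g t0 x\<bar>)) 0 < e * (2 * sin L)"
    by (rule tendstoD)
  then obtain d where d: "0 < d" "\<And>t. t \<noteq> t0 \<Longrightarrow> dist t t0 < d \<Longrightarrow>
      dist (integral {0..2*pi} (\<lambda>x. \<bar>g t x - g t0 x\<bar>)) 0 < e * (2 * sin L)"
    unfolding eventually_at by auto
  have int: "(\<lambda>x. \<bar>g t x - g t0 x\<bar>) integrable_on {a..b}" for a b t
    by (intro bounded_borel_integrable_on[where B = "B + B"])
      (use g_borel gd in auto)
  have I: "integral {x..x + L} (\<lambda>x. \<bar>g t x - g t0 x\<bar>) \<le> e * (2 * sin L)"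
    if "\<bar>t - t0\<bar> < d" "0 \<le> x" "x < L" for t x
  proof -
    have "x + L \<le> 2 * pi" using L that by linarith
    then have "integral {x..x + L} (\<lambda>x. \<bar>g t x - g t0 x\<bar>) \<le> integral {0..2*pi} (\<lambda>x. \<bar>g t x - g t0 x\<bar>)"
      using that by (intro integral_subset_le int) auto
    also have "\<dots> \<le> e * (2 * sin L)"
      using d(2)[of t] that assms sin_L by (cases "t = t0") (auto simp: dist_real_def)
    finally show ?thesis .
  qed
  show ?thesis
  proof (intro exI[of _ d] conjI allI impI d(1))
    fix t x assume t: "\<bar>t - t0\<bar> < d"
    show "\<bar>G t x - G t0 x\<bar> \<le> e"
    proof (rule period_sup[of "\<lambda>x. G t x - G t0 x"])
      fix x assume x: "0 \<le> x" "x < L"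
      have "\<bar>G t x - G t0 x\<bar> \<le> e * (2 * sin L) / (4 * sin L)"
        unfolding G_eq_kop using kop_diff_bound(1)[OF g_borel B(2) g_borel B(2) L(1,3), of t x t0]
          divide_right_mono[OF I[OF t x], of "4 * sin L"] sin_L by auto
      then show "\<bar>G t x - G t0 x\<bar> \<le> e" using sin_L assms by auto
    qed (simp add: G_per)
    show "\<bar>dG t x - dG t0 x\<bar> \<le> e"
    proof (rule period_sup[of "\<lambda>x. dG t x - dG t0 x"])
      fix x assume x: "0 \<le> x" "x < L"
      have "\<bar>dG t x - dG t0 x\<bar> \<le> e * (2 * sin L) / (2 * sin L)"
        unfolding dG_eq_dkop using kop_diff_bound(2)[OF g_borel B(2) g_borel B(2) L(1,3), of t x t0]
          divide_right_mono[OF I[OF t x], of "2 * sin L"] sin_L by auto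
      then show "\<bar>dG t x - dG t0 x\<bar> \<le> e" using sin_L assms by auto
    qed (simp add: dG_per)
  qed
qed

lemma ufam_G: "ufam G" and ufam_dG: "ufam dG"
proof -
  obtain B where B: "0 < B" "\<And>t x. \<bar>g t x\<bar> \<le> B" using g_bound by metis
  note bd = kop_bound[OF g_borel B(2) L(1,3), folded G_eq_kop dG_eq_dkop]
  let ?B = "L * B / (2 * sin L)"
  have "\<bar>g t x - 4 * G t x\<bar> \<le> B + 4 * ?B" for t x
    using B(2)[of t x] bd(1)[of t x] by (simp only: abs_le_iff) linarith
  from wderiv_lipschitz_bound[OF wderiv_dG this]
  have "\<bar>dG t x - dG t y\<bar> \<le> (B + 4 * ?B) * \<bar>x - y\<bar>" for t x y .
  moreover have "\<bar>G t x - G t y\<bar> \<le> ?B * \<bar>x - y\<bar>" for t x y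
    using wderiv_lipschitz_bound[OF wderiv_G bd(2)] .
  ultimately have lip: "\<exists>M. \<forall>t x y. \<bar>G t x - G t y\<bar> \<le> M * \<bar>x - y\<bar>" "\<exists>M. \<forall>t x y. \<bar>dG t x - dG t y\<bar> \<le> M * \<bar>x - y\<bar>"
    by blast+
  have "\<exists>B. \<forall>t x. \<bar>G t x\<bar> \<le> B" "\<exists>B. \<forall>t x. \<bar>dG t x\<bar> \<le> B" using bd by blast+
  then show "ufam G" "ufam dG"
    unfolding ufam_def using lip G_time_continuity by (simp; meson)+
qed

definition H :: "real \<Rightarrow> real \<Rightarrow> real" where "H t = kop L (\<lambda>x. 3 * (dG t x * dG t x))"
definition dH :: "real \<Rightarrow> real \<Rightarrow> real" where "dH t = dkop L (\<lambda>x. 3 * (dG t x * dG t x))"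
text \<open>The prospective time derivative of \<open>G\<close>; differentiability in time is
  reached only in \<open>G_time_deriv\<close>.\<close>

definition V :: "real \<Rightarrow> real \<Rightarrow> real" where "V t x = dH t x - 2 * (G t x * dG t x)"

lemma ufam_H: "ufam H" and ufam_dH: "ufam dH"
  unfolding H_def[abs_def] dH_def[abs_def]
  using ufam_kop[OF ufam_cmult[where c = 3, OF ufam_mult[OF ufam_dG ufam_dG]], where L = L] dG_per L by auto

lemma ufam_V: "ufam V"
  unfolding V_def[abs_def] by (intro ufam_diff ufam_dH ufam_cmult ufam_mult ufam_G ufam_dG)

lemma H_deriv: "(H t has_real_derivative dH t x) (at x)"
  and dH_deriv: "(dH t has_real_derivative 3 * (dG t x * dG t x) - 4 * H t x) (at x)"
proof -
  have "continuous_on UNIV (\<lambda>x. 3 * (dG t x * dG t x))"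
    by (intro continuous_intros ufam_section_continuous ufam_dG)
  from kop_deriv[OF this L(1,3)]
  show "(H t has_real_derivative dH t x) (at x)"
    "(dH t has_real_derivative 3 * (dG t x * dG t x) - 4 * H t x) (at x)"
    unfolding H_def dH_def using dG_per by simp_all
qed

lemma H_per: "H t (x + L) = H t x" and dH_per: "dH t (x + L) = dH t x"
  unfolding H_def dH_def using kop_periodic[of "\<lambda>x. 3 * (dG t x * dG t x)" L x] dG_per by auto

lemma V_per: "V t (x + L) = V t x" by (simp add: V_def dH_per G_per dG_per)

lemma wderiv_H: "wderiv (H t) (dH t)"
proof -
  obtain B where B: "0 < B" "\<And>t x. \<bar>H t x\<bar> \<le> B" using ufam_H by (metis ufam_bounded)
  obtain C where C: "0 < C" "\<And>t x. \<bar>dH t x\<bar> \<le> C" using ufam_dH by (metis ufam_bounded)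
  show ?thesis by (rule wderivI_deriv[OF H_deriv ufam_section_continuous[OF ufam_dH] C(2) B(2)])
qed

lemma wderiv_dH: "wderiv (dH t) (\<lambda>x. 3 * (dG t x * dG t x) - 4 * H t x)"
proof -
  have u: "ufam (\<lambda>t x. 3 * (dG t x * dG t x) - 4 * H t x)"
    by (intro ufam_diff ufam_H ufam_cmult ufam_mult ufam_dG)
  obtain B where B: "\<And>t x. \<bar>3 * (dG t x * dG t x) - 4 * H t x\<bar> \<le> B" using u unfolding ufam_def by blast
  obtain C where C: "0 < C" "\<And>t x. \<bar>dH t x\<bar> \<le> C" using ufam_dH by (metis ufam_bounded)
  show ?thesis by (rule wderivI_deriv[OF dH_deriv ufam_section_continuous[OF u] B C(2)])
qed

text \<open>A periodic potential has no increment around the circle. An integration by parts thus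
  reduces to exhibiting \<open>Q\<close>.\<close>

lemma has_integral_periodic_wderiv:
  assumes "wderiv Q (\<lambda>x. f x - k x)" "\<And>x. Q (x + L) = Q x" "k integrable_on {0..2*pi}"
  shows "(f has_integral (integral {0..2*pi} k)) {0..2*pi}"
proof -
  have "((\<lambda>x. f x - k x) has_integral 0) {0..2*pi}"
    using wderiv_has_integral[OF assms(1), of 0 "2 * pi"] period_2pi[of Q 0, OF assms(2)] by simp
  from has_integral_add[OF this integrable_integral[OF assms(3)]] show ?thesis by simp
qed

section \<open>The transport equation tested against Green potentials\<close>

context
  fixes \<eta> :: "real \<Rightarrow> real"
  assumes \<eta>_cont: "continuous_on UNIV \<eta>" and \<eta>_per: "\<And>x. \<eta> (x + L) = \<eta> x"
begin

lemma \<eta>_cont': "continuous_on S \<eta>"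
  using \<eta>_cont by (rule continuous_on_subset) simp

lemma wderiv_kop: "wderiv (kop L \<eta>) (dkop L \<eta>)"
  and wderiv_dkop: "wderiv (dkop L \<eta>) (\<lambda>x. \<eta> x - 4 * kop L \<eta> x)"
proof -
  obtain B where B: "\<And>x. \<bar>\<eta> x\<bar> \<le> B" using continuous_periodic_bounded[OF \<eta>_cont \<eta>_per L(1)] by metis
  have meas: "\<eta> \<in> borel_measurable borel" using \<eta>_cont by (rule borel_measurable_continuous_onI)
  note bd = kop_bound[OF meas B L(1,3)] and d = kop_deriv[OF \<eta>_cont L(1,3) \<eta>_per]
  have c: "continuous_on UNIV (kop L \<eta>)" "continuous_on UNIV (dkop L \<eta>)"
    using DERIV_continuous_on[OF has_field_derivative_at_within[OF d(1)]]
      DERIV_continuous_on[OF has_field_derivative_at_within[OF d(2)]] by auto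
  show "wderiv (kop L \<eta>) (dkop L \<eta>)" by (rule wderivI_deriv[OF d(1) c(2) bd(2) bd(1)])
  have bnd: "\<bar>\<eta> x - 4 * kop L \<eta> x\<bar> \<le> B + 4 * (L * B / (2 * sin L))" for x
    using B[of x] bd(1)[of x] by (simp only: abs_le_iff) linarith
  show "wderiv (dkop L \<eta>) (\<lambda>x. \<eta> x - 4 * kop L \<eta> x)"
    by (rule wderivI_deriv[OF d(2) _ bnd bd(2)]) (intro continuous_intros c \<eta>_cont)
qed

text \<open>Self-adjointness of the Green operator, with the Wronskian of \<open>G\<close> and
  \<open>kop L \<eta>\<close> as potential. It turns a test of \<open>g\<close> against
  \<open>kop L \<eta>\<close> into a test of \<open>G\<close> against \<eta>.\<close>

lemma pairing_g:
  "((\<lambda>x. g t x * kop L \<eta> x) has_integral integral {0..2*pi} (\<lambda>x. G t x * \<eta> x)) {0..2*pi}"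
proof (rule has_integral_periodic_wderiv)
  show "wderiv (\<lambda>x. dG t x * kop L \<eta> x - G t x * dkop L \<eta> x) (\<lambda>x. g t x * kop L \<eta> x - G t x * \<eta> x)"
    by (rule wderiv_eq[OF wderiv_diff[OF wderiv_mult[OF wderiv_dG wderiv_kop] wderiv_mult[OF wderiv_G wderiv_dkop]]])
      (auto simp: algebra_simps)
  show "(\<lambda>x. G t x * \<eta> x) integrable_on {0..2 * pi}"
    by (intro integrable_continuous_interval continuous_intros G_cont \<eta>_cont')
qed (auto simp: dG_per G_per kop_periodic[of \<eta> L, OF \<eta>_per])

text \<open>The potential is found by repeatedly integrating by parts, using \<open>G'' + 4 G = g\<close>,
  \<open>\<psi>'' + 4 \<psi> = \<eta>\<close> and \<open>H'' + 4 H = 3 G'\<^sup>2\<close>.\<close>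
lemma pairing_flux:
  "((\<lambda>x. g t x * (2 * G t x * dkop L \<eta> x + 2 * dG t x * kop L \<eta> x))
     has_integral integral {0..2*pi} (\<lambda>x. V t x * \<eta> x)) {0..2*pi}"
proof (rule has_integral_periodic_wderiv)
  let ?p = "kop L \<eta>" and ?q = "dkop L \<eta>"
  let ?Q = "\<lambda>x. dG t x * dG t x * ?p x + 2 * (G t x * dG t x * ?q x) + 8 * (G t x * G t x * ?p x)
     - dH t x * ?q x - 4 * (H t x * ?p x)"
  show "wderiv ?Q (\<lambda>x. g t x * (2 * G t x * ?q x + 2 * dG t x * ?p x) - V t x * \<eta> x)"
    by (rule wderiv_eq[OF
        wderiv_diff[OF
          wderiv_diff[OF
            wderiv_add[OF
              wderiv_add[OF wderiv_mult[OF wderiv_mult[OF wderiv_dG[of t] wderiv_dG[of t]] wderiv_kop]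
                wderiv_cmult[OF wderiv_mult[OF wderiv_mult[OF wderiv_G[of t] wderiv_dG[of t]] wderiv_dkop], of 2]]
              wderiv_cmult[OF wderiv_mult[OF wderiv_mult[OF wderiv_G[of t] wderiv_G[of t]] wderiv_kop], of 8]]
            wderiv_mult[OF wderiv_dH[of t] wderiv_dkop]]
          wderiv_cmult[OF wderiv_mult[OF wderiv_H[of t] wderiv_kop], of 4]]])
      (auto simp: algebra_simps V_def)
  show "(\<lambda>x. V t x * \<eta> x) integrable_on {0..2 * pi}"
    by (intro integrable_continuous_interval continuous_intros ufam_section_continuous ufam_V \<eta>_cont')
qed (auto simp: dG_per G_per H_per dH_per kop_periodic[of \<eta> L, OF \<eta>_per])

lemma pairing_continuous:
  assumes "ufam f" shows "continuous_on UNIV (\<lambda>t. integral {0..2*pi} (\<lambda>x. f t x * \<eta> x))"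
  unfolding continuous_on_iff
proof safe
  fix t0 e :: real assume e: "0 < e"
  obtain B where B: "\<And>x. \<bar>\<eta> x\<bar> \<le> B" using continuous_periodic_bounded[OF \<eta>_cont \<eta>_per L(1)] by metis
  have B0: "0 \<le> B" using order_trans[OF abs_ge_zero B[of 0]] .
  \<comment> \<open>The summand 1 covers B = 0 and makes the final inequality strict.\<close>
  have "0 < e / (2 * pi * B + 1)" using e B0 by (simp add: add_nonneg_pos)
  then obtain d where d: "0 < d" "\<And>t x. \<bar>t - t0\<bar> < d \<Longrightarrow> \<bar>f t x - f t0 x\<bar> \<le> e / (2 * pi * B + 1)"
    using ufam_near[OF assms] by blast
  have int: "(\<lambda>x. f t x * \<eta> x) integrable_on {0..2*pi}" for t
    by (intro integrable_continuous_interval continuous_intros ufam_section_continuous assms \<eta>_cont')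
  show "\<exists>d>0. \<forall>t\<in>UNIV. dist t t0 < d \<longrightarrow>
      dist (integral {0..2*pi} (\<lambda>x. f t x * \<eta> x)) (integral {0..2*pi} (\<lambda>x. f t0 x * \<eta> x)) < e"
  proof (intro exI[of _ d] conjI ballI impI d(1))
    fix t assume t: "dist t t0 < d"
    have "dist (integral {0..2*pi} (\<lambda>x. f t x * \<eta> x)) (integral {0..2*pi} (\<lambda>x. f t0 x * \<eta> x))
        = norm (integral {0..2*pi} (\<lambda>x. f t x * \<eta> x - f t0 x * \<eta> x))"
      by (simp add: integral_diff int dist_real_def)
    also have "\<dots> \<le> e / (2 * pi * B + 1) * B * (2 * pi - 0)"
    proof (rule integral_bound)
      show "continuous_on {0..2*pi} (\<lambda>x. f t x * \<eta> x - f t0 x * \<eta> x)"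
        by (intro continuous_intros ufam_section_continuous assms \<eta>_cont')
      show "norm (f t x * \<eta> x - f t0 x * \<eta> x) \<le> e / (2 * pi * B + 1) * B" for x
        unfolding left_diff_distrib[symmetric] real_norm_def abs_mult
        using d(2)[of t x] t B B0 by (intro mult_mono) (auto simp: dist_real_def)
    qed auto
    also have "\<dots> = e * (2 * pi * B) / (2 * pi * B + 1)" by simp
    also have "\<dots> < e"
    proof -
      have "0 < 2 * pi * B + 1" using B0 by (simp add: add_nonneg_pos)
      then show ?thesis using e by (simp add: pos_divide_less_eq distrib_left)
    qed
    finally show "dist (integral {0..2*pi} (\<lambda>x. f t x * \<eta> x)) (integral {0..2*pi} (\<lambda>x. f t0 x * \<eta> x)) < e" .
  qed
qed

text \<open>For the test function \<alpha>(t) \<open>kop L \<eta>\<close> (x), Fubini and the two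
  pairing identities reduce the distributional equation to a vanishing time integral of \<alpha>' F
  + \<alpha> R, where F and R pair \<open>G\<close> and \<open>V\<close> with \<eta>. This is the
  hypothesis of \<open>du_bois_reymond\<close>.\<close>

lemma pairing_weak_evolution:
  assumes "a < b"
  shows "integral {0..2*pi} (\<lambda>x. G b x * \<eta> x) - integral {0..2*pi} (\<lambda>x. G a x * \<eta> x)
    = integral {a..b} (\<lambda>t. integral {0..2*pi} (\<lambda>x. V t x * \<eta> x))"
proof (rule du_bois_reymond[OF pairing_continuous[OF ufam_G] pairing_continuous[OF ufam_V] assms])
  fix \<alpha> \<alpha>' :: "real \<Rightarrow> real"
  assume d\<alpha>: "\<And>t. (\<alpha> has_real_derivative \<alpha>' t) (at t)" and \<alpha>'c: "continuous_on UNIV \<alpha>'"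
    and \<alpha>0: "\<And>t. t \<notin> {a..b} \<Longrightarrow> \<alpha> t = 0" and \<alpha>'0: "\<And>t. t \<notin> {a..b} \<Longrightarrow> \<alpha>' t = 0"
  let ?F = "\<lambda>t. integral {0..2*pi} (\<lambda>x. G t x * \<eta> x)" and ?R = "\<lambda>t. integral {0..2*pi} (\<lambda>x. V t x * \<eta> x)"
  let ?p = "kop L \<eta>" and ?q = "dkop L \<eta>"
  have \<alpha>c: "continuous_on UNIV \<alpha>" using d\<alpha> by (meson DERIV_continuous_on has_field_derivative_at_within)
  have pc: "continuous_on UNIV ?p" "continuous_on UNIV ?q"
    using wderiv_continuous wderiv_kop wderiv_dkop by blast+
  have test: "test_fun (\<lambda>t x. \<alpha> t * ?p x) (\<lambda>t x. \<alpha>' t * ?p x) (\<lambda>t x. \<alpha> t * ?q x)"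
    unfolding test_fun_def
  proof (intro conjI allI)
    show "((\<lambda>s. \<alpha> s * ?p x) has_real_derivative \<alpha>' t * ?p x) (at t)" for t x
      using DERIV_cmult_right[OF d\<alpha>] .
    show "((\<lambda>y. \<alpha> t * ?p y) has_real_derivative \<alpha> t * ?q x) (at x)" for t x
      using DERIV_cmult[OF kop_deriv(1)[OF \<eta>_cont L(1,3) \<eta>_per]] .
    show "continuous_on UNIV (\<lambda>p. \<alpha>' (fst p) * ?p (snd p))" "continuous_on UNIV (\<lambda>p. \<alpha> (fst p) * ?q (snd p))"
      by (auto intro!: continuous_intros continuous_on_compose2[OF \<alpha>'c] continuous_on_compose2[OF \<alpha>c]
          continuous_on_compose2[OF pc(1)] continuous_on_compose2[OF pc(2)])
    show "\<exists>R. \<forall>t \<theta>. R \<le> \<bar>t\<bar> \<longrightarrow> \<alpha> t * ?p \<theta> = 0"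
    proof (intro exI[of _ "\<bar>a\<bar> + \<bar>b\<bar> + 1"] allI impI)
      fix t x assume "\<bar>a\<bar> + \<bar>b\<bar> + 1 \<le> \<bar>t\<bar>"
      then have "t \<notin> {a..b}" by auto
      then show "\<alpha> t * ?p x = 0" using \<alpha>0 by simp
    qed
    show "\<alpha> t * ?p (x + 2 * pi) = \<alpha> t * ?p x" for t x
      using period_2pi[of ?p x, OF kop_periodic(1)[of \<eta> L, OF \<eta>_per]] by simp
  qed
  define \<Phi> where "\<Phi> p = g (fst p) (snd p) * (\<alpha>' (fst p) * ?p (snd p) + 2 * G (fst p) (snd p) * (\<alpha> (fst p) * ?q (snd p))
                    + 2 * deriv (G (fst p)) (snd p) * (\<alpha> (fst p) * ?p (snd p)))" for p :: "real \<times> real"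
  have \<Phi>: "set_integrable lborel (UNIV \<times> {0..2*pi}) \<Phi>" "(LINT p:(UNIV \<times> {0..2*pi})|lborel. \<Phi> p) = 0"
    using sol test unfolding is_solution_def \<Phi>_def[abs_def] Let_def by blast+
  have inner: "((\<lambda>x. \<Phi> (t, x)) has_integral (\<alpha>' t * ?F t + \<alpha> t * ?R t)) {0..2*pi}" for t
  proof -
    have "(\<lambda>x. \<Phi> (t, x)) = (\<lambda>x. \<alpha>' t * (g t x * ?p x) + \<alpha> t * (g t x * (2 * G t x * ?q x + 2 * dG t x * ?p x)))"
      by (auto simp: \<Phi>_def dG_def algebra_simps)
    then show ?thesis
      using has_integral_add[OF has_integral_mult_right[OF pairing_g[of t], of "\<alpha>' t"]
          has_integral_mult_right[OF pairing_flux[of t], of "\<alpha> t"]] by simp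
  qed
  obtain B where B: "\<And>x. \<bar>g t x\<bar> \<le> B" for t using g_bound by metis
  let ?f = "\<lambda>p. indicator (UNIV \<times> {0..2*pi}) p *\<^sub>R \<Phi> p"
  have intf: "integrable (lborel \<Otimes>\<^sub>M lborel) ?f"
    using \<Phi>(1) unfolding set_integrable_def lborel_prod .
  have "(LINT t|lborel. (LINT x|lborel. ?f (t, x))) = 0"
    using lborel_pair.integral_fst'[OF intf] \<Phi>(2) unfolding set_lebesgue_integral_def lborel_prod by simp
  moreover have "(LINT x|lborel. ?f (t, x)) = \<alpha>' t * ?F t + \<alpha> t * ?R t" for t
  proof -
    have eq: "(\<lambda>x. ?f (t, x)) = (\<lambda>x. indicator {0..2*pi} x *\<^sub>R \<Phi> (t, x))"
      by (auto simp: indicator_def)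
    have m: "(\<lambda>x. \<Phi> (t, x)) \<in> borel_measurable borel"
    proof -
      have "(\<lambda>x. \<Phi> (t, x)) = (\<lambda>x. \<alpha>' t * (g t x * ?p x) + \<alpha> t * (g t x * (2 * G t x * ?q x + 2 * dG t x * ?p x)))"
        by (auto simp: \<Phi>_def dG_def algebra_simps)
      moreover have "G t \<in> borel_measurable borel" "dG t \<in> borel_measurable borel" "?p \<in> borel_measurable borel"
        "?q \<in> borel_measurable borel"
        using wderiv_borel' wderiv_G wderiv_dG wderiv_kop wderiv_dkop by blast+
      ultimately show ?thesis using g_borel[of t] by simp
    qed
    have "set_integrable lborel {0..2*pi} (\<lambda>x. \<Phi> (t, x))"
    proof -
      obtain C1 C2 C3 C4 where C: "\<And>x. \<bar>G t x\<bar> \<le> C1" "\<And>x. \<bar>dG t x\<bar> \<le> C2" "\<And>x. \<bar>?p x\<bar> \<le> C3" "\<And>x. \<bar>?q x\<bar> \<le> C4"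
        using wderivE[OF wderiv_G] wderivE[OF wderiv_dG] wderivE[OF wderiv_kop] wderivE[OF wderiv_dkop] by metis
      show ?thesis
      proof (rule bounded_borel_set_integrable[OF m])
        fix x
        have "\<bar>\<Phi> (t, x)\<bar> = \<bar>g t x\<bar> * \<bar>\<alpha>' t * ?p x + 2 * G t x * (\<alpha> t * ?q x) + 2 * dG t x * (\<alpha> t * ?p x)\<bar>"
          by (simp add: \<Phi>_def dG_def abs_mult)
        also have "\<dots> \<le> B * (\<bar>\<alpha>' t * ?p x\<bar> + \<bar>2 * G t x * (\<alpha> t * ?q x)\<bar> + \<bar>2 * dG t x * (\<alpha> t * ?p x)\<bar>)"
          using B[of t x] by (intro mult_mono) auto
        also have "\<dots> \<le> B * (\<bar>\<alpha>' t\<bar> * C3 + 2 * C1 * (\<bar>\<alpha> t\<bar> * C4) + 2 * C2 * (\<bar>\<alpha> t\<bar> * C3))"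
          unfolding abs_mult using C[of x] order_trans[OF abs_ge_zero B[of t x]] 
            order_trans[OF abs_ge_zero C(1)[of x]] order_trans[OF abs_ge_zero C(2)[of x]]
          by (intro mult_left_mono add_mono mult_mono) auto
        finally show "\<bar>\<Phi> (t, x)\<bar> \<le> B * (\<bar>\<alpha>' t\<bar> * C3 + 2 * C1 * (\<bar>\<alpha> t\<bar> * C4) + 2 * C2 * (\<bar>\<alpha> t\<bar> * C3))" .
      qed
    qed
    from set_borel_integral_eq_integral(2)[OF this] integral_unique[OF inner]
    show ?thesis unfolding eq set_lebesgue_integral_def by simp
  qed
  ultimately have 0: "(LINT t|lborel. \<alpha>' t * ?F t + \<alpha> t * ?R t) = 0" by simp
  have c: "continuous_on UNIV (\<lambda>t. \<alpha>' t * ?F t + \<alpha> t * ?R t)"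
    by (intro continuous_intros \<alpha>'c \<alpha>c pairing_continuous ufam_G ufam_V)
  have "integral {a..b} (\<lambda>t. \<alpha>' t * ?F t + \<alpha> t * ?R t) = (LINT t:{a..b}|lborel. \<alpha>' t * ?F t + \<alpha> t * ?R t)"
    by (rule set_borel_integral_eq_integral(2)[symmetric])
      (use c in \<open>auto intro!: borel_integrable_atLeastAtMost' intro: continuous_on_subset\<close>)
  also have "\<dots> = (LINT t|lborel. \<alpha>' t * ?F t + \<alpha> t * ?R t)"
    unfolding set_lebesgue_integral_def
  proof (intro Bochner_Integration.integral_cong refl)
    show "indicator {a..b} t *\<^sub>R (\<alpha>' t * ?F t + \<alpha> t * ?R t) = \<alpha>' t * ?F t + \<alpha> t * ?R t" for t
      using \<alpha>0[of t] \<alpha>'0[of t] by (cases "t \<in> {a..b}") auto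
  qed
  finally show "integral {a..b} (\<lambda>t. \<alpha>' t * ?F t + \<alpha> t * ?R t) = 0" using 0 by simp
qed

end

text \<open>The defect of the identity is itself an admissible \<open>\<eta>\<close>, so its square integrates to zero.\<close>
lemma G_evolution:
  assumes "a \<le> b"
  shows "G b x - G a x = integral {a..b} (\<lambda>t. V t x)"
proof (cases "a = b")
  case False
  then have ab: "a < b" using assms by simp
  define Z where "Z x = G b x - G a x - integral {a..b} (\<lambda>t. V t x)" for x
  have Vc: "continuous_on S (\<lambda>(x, t). V t x)" for S
    using ufam_continuous_compose[OF ufam_V, of S snd fst]
    by (simp add: case_prod_beta continuous_on_snd continuous_on_fst)
  have iVc: "continuous_on UNIV (\<lambda>x. integral {a..b} (\<lambda>t. V t x))"
    using integral_continuous_on_param[of UNIV a b "\<lambda>x t. V t x"] Vc by (simp add: cbox_interval)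
  have Zc: "continuous_on S Z" for S
    unfolding Z_def using iVc by (intro continuous_intros G_cont) (auto intro: continuous_on_subset)
  have Zper: "Z (x + L) = Z x" for x unfolding Z_def by (simp add: G_per V_per)
  have "integral {a..b} (\<lambda>t. integral {0..2*pi} (\<lambda>x. V t x * Z x))
      = integral {0..2*pi} (\<lambda>x. integral {a..b} (\<lambda>t. V t x * Z x))"
  proof -
    have "continuous_on (cbox (a, 0) (b, 2 * pi)) (\<lambda>(t, x). V t x * Z x)"
      unfolding case_prod_beta
      by (intro continuous_intros ufam_continuous_compose[OF ufam_V] continuous_on_compose2[OF Zc[of UNIV]]) auto
    from integral_swap_continuous[OF this] show ?thesis by simp
  qed
  also have "\<dots> = integral {0..2*pi} (\<lambda>x. integral {a..b} (\<lambda>t. V t x) * Z x)"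
    by simp
  finally have *: "integral {a..b} (\<lambda>t. integral {0..2*pi} (\<lambda>x. V t x * Z x))
      = integral {0..2*pi} (\<lambda>x. integral {a..b} (\<lambda>t. V t x) * Z x)" .
  have int: "(\<lambda>x. f x * Z x) integrable_on {0..2*pi}" if "continuous_on UNIV f" for f :: "real \<Rightarrow> real"
    using that Zc by (intro integrable_continuous_interval continuous_intros) (auto intro: continuous_on_subset)
  have "integral {0..2*pi} (\<lambda>x. Z x * Z x) =
      integral {0..2*pi} (\<lambda>x. G b x * Z x - G a x * Z x - integral {a..b} (\<lambda>t. V t x) * Z x)"
    by (simp add: Z_def algebra_simps)
  also have "\<dots> = integral {0..2*pi} (\<lambda>x. G b x * Z x) - integral {0..2*pi} (\<lambda>x. G a x * Z x)
      - integral {0..2*pi} (\<lambda>x. integral {a..b} (\<lambda>t. V t x) * Z x)"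
    by (simp add: integral_diff integrable_diff int[OF iVc] int[OF G_cont])
  also have "\<dots> = 0"
    using pairing_weak_evolution[OF Zc Zper ab] * by simp
  finally have "integral {0..2*pi} (\<lambda>x. Z x * Z x) = 0" .
  then have 0: "\<forall>x\<in>{0..2*pi}. Z x * Z x = 0"
    using integral_eq_0_iff[of 0 "2 * pi" "\<lambda>x. Z x * Z x", OF continuous_on_mult[OF Zc Zc]] by simp
  have "\<bar>Z x\<bar> \<le> 0"
    by (rule period_sup[of Z, OF Zper]) (use 0 L in auto)
  then show ?thesis by (simp add: Z_def)
qed simp

lemma G_time_deriv: "((\<lambda>t. G t x) has_real_derivative V t x) (at t)"
proof -
  have c: "continuous_on UNIV (\<lambda>t. V t x)" by (rule ufam_time_continuous[OF ufam_V])
  obtain P where P: "\<And>t. (P has_real_derivative V t x) (at t)" using ex_antiderivative[OF c] by blast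
  have "G b x = P b + (G 0 x - P 0)" for b
    using G_evolution[of 0 b x] G_evolution[of b 0 x] integral_antiderivative[OF P, of 0 b]
      integral_antiderivative[OF P, of b 0] by (cases "0 \<le> b") auto
  then have "(\<lambda>t. G t x) = (\<lambda>t. P t + (G 0 x - P 0))" by blast
  then show ?thesis using DERIV_add[OF P[of t] DERIV_const[of "G 0 x - P 0"]] by simp
qed

end

section \<open>The flow and the Riccati equation along it\<close>

text \<open>Gronwall in both directions: d^2 exp(-2 C t) decreases and d^2 exp(2 C t) increases.
  Squares are used because |d| need not be differentiable.\<close>

lemma linear_ode_bounds:
  fixes d :: "real \<Rightarrow> real"
  assumes d: "\<And>t. (d has_real_derivative d' t) (at t)" and le: "\<And>t. \<bar>d' t\<bar> \<le> C * \<bar>d t\<bar>"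
  shows "\<bar>d t\<bar> \<le> \<bar>d 0\<bar> * exp (C * \<bar>t\<bar>)" "\<bar>d 0\<bar> \<le> \<bar>d t\<bar> * exp (C * \<bar>t\<bar>)"
proof -
  have dd: "\<bar>d t * d' t\<bar> \<le> C * (d t)^2" for t
  proof -
    have "\<bar>d t * d' t\<bar> \<le> \<bar>d t\<bar> * (C * \<bar>d t\<bar>)" unfolding abs_mult by (rule mult_left_mono[OF le]) simp
    also have "\<dots> = C * (d t)^2" by (metis abs_mult_self_eq mult.left_commute power2_eq_square)
    finally show ?thesis .
  qed
  have up: "(d t)^2 * exp (- 2 * C * t) \<le> (d s)^2 * exp (- 2 * C * s)" if "s \<le> t" for s t
  proof (rule DERIV_nonpos_imp_nonincreasing[OF that])
    fix x
    have "((\<lambda>t. (d t)^2 * exp (- 2 * C * t)) has_real_derivative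
        2 * (d x * d' x - C * (d x)^2) * exp (- 2 * C * x)) (at x)"
      by (auto intro!: derivative_eq_intros d simp: algebra_simps)
    moreover have "2 * (d x * d' x - C * (d x)^2) \<le> 0" using dd[of x] by (simp add: abs_le_iff)
    then have "2 * (d x * d' x - C * (d x)^2) * exp (- 2 * C * x) \<le> 0" by (rule mult_nonpos_nonneg) simp
    ultimately show "\<exists>y. ((\<lambda>t. (d t)^2 * exp (- 2 * C * t)) has_real_derivative y) (at x) \<and> y \<le> 0" by blast
  qed
  have lo: "(d s)^2 * exp (2 * C * s) \<le> (d t)^2 * exp (2 * C * t)" if "s \<le> t" for s t
  proof (rule DERIV_nonneg_imp_nondecreasing[OF that])
    fix x
    have "((\<lambda>t. (d t)^2 * exp (2 * C * t)) has_real_derivative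
        2 * (d x * d' x + C * (d x)^2) * exp (2 * C * x)) (at x)"
      by (auto intro!: derivative_eq_intros d simp: algebra_simps)
    moreover have "0 \<le> 2 * (d x * d' x + C * (d x)^2)" using dd[of x] by (simp add: abs_le_iff)
    then have "0 \<le> 2 * (d x * d' x + C * (d x)^2) * exp (2 * C * x)" by (rule mult_nonneg_nonneg) simp
    ultimately show "\<exists>y. ((\<lambda>t. (d t)^2 * exp (2 * C * t)) has_real_derivative y) (at x) \<and> 0 \<le> y" by blast
  qed
  have e: "(exp r)^2 = exp (2 * r)" for r :: real by (simp add: exp_double)
  have inv: "a \<le> b * exp r" if "a * exp (- r) \<le> b" for a b r :: real
    using mult_right_mono[OF that, of "exp r"] by (simp add: mult.assoc flip: exp_add)
  have "(d t)^2 \<le> (d 0 * exp (C * \<bar>t\<bar>))^2 \<and> (d 0)^2 \<le> (d t * exp (C * \<bar>t\<bar>))^2"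
  proof (cases "0 \<le> t")
    case True
    then show ?thesis using up[OF True] lo[OF True] inv[of "(d t)^2" "2 * C * t" "(d 0)^2"]
      by (simp add: power_mult_distrib e mult.assoc)
  next
    case False
    then have "t \<le> 0" by simp
    then show ?thesis using False up[OF \<open>t \<le> 0\<close>] lo[OF \<open>t \<le> 0\<close>] inv[of "(d t)^2" "- 2 * C * t" "(d 0)^2"]
      by (simp add: power_mult_distrib e mult.assoc)
  qed
  then show "\<bar>d t\<bar> \<le> \<bar>d 0\<bar> * exp (C * \<bar>t\<bar>)" "\<bar>d 0\<bar> \<le> \<bar>d t\<bar> * exp (C * \<bar>t\<bar>)"
    unfolding abs_le_square_iff[symmetric] by (auto simp: abs_mult)
qed

lemma ex_antiderivative_zero:
  fixes f :: "real \<Rightarrow> real"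
  assumes "continuous_on UNIV f"
  shows "\<exists>F. F 0 = 0 \<and> (\<forall>t. (F has_real_derivative f t) (at t))"
proof -
  obtain F where F: "\<And>t. (F has_real_derivative f t) (at t)" using ex_antiderivative[OF assms] by blast
  then have "((\<lambda>t. F t - F 0) has_real_derivative f t) (at t)" for t
    using DERIV_diff[OF F DERIV_const[of "F 0"]] by simp
  then show ?thesis by (intro exI[of _ "\<lambda>t. F t - F 0"]) auto
qed

lemma increment_bound:
  fixes f :: "real \<Rightarrow> real"
  assumes "\<And>s. (f has_real_derivative f' s) (at s)" "\<And>s. \<bar>s\<bar> \<le> \<bar>t\<bar> \<Longrightarrow> \<bar>f' s\<bar> \<le> K"
  shows "\<bar>f t - f 0\<bar> \<le> K * \<bar>t\<bar>"
proof -
  have "\<exists>z. \<bar>z\<bar> \<le> \<bar>t\<bar> \<and> f t - f 0 = t * f' z"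
  proof (cases t "0 :: real" rule: linorder_cases)
    case less
    then obtain z where "t < z" "z < 0" "f 0 - f t = (0 - t) * f' z" using MVT2[of t 0 f f'] assms(1) by auto
    then show ?thesis by (intro exI[of _ z]) auto
  next
    case greater
    then obtain z where "0 < z" "z < t" "f t - f 0 = (t - 0) * f' z" using MVT2[of 0 t f f'] assms(1) by auto
    then show ?thesis by (intro exI[of _ z]) auto
  qed auto
  then obtain z where "\<bar>z\<bar> \<le> \<bar>t\<bar>" "f t - f 0 = t * f' z" by blast
  then show ?thesis
    using mult_right_mono[OF assms(2)[of z] abs_ge_zero[of t]] by (simp add: abs_mult mult.commute)
qed

lemma difference_quotient_bound:
  fixes f :: "real \<Rightarrow> real"
  assumes f: "\<And>x. (f has_real_derivative f' x) (at x)" and lip: "\<And>x y. \<bar>f' x - f' y\<bar> \<le> M * \<bar>x - y\<bar>"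
    and "x \<noteq> y"
  shows "\<bar>(f y - f x) / (y - x) - f' x\<bar> \<le> M * \<bar>y - x\<bar>"
proof -
  have "\<exists>z. \<bar>z - x\<bar> \<le> \<bar>y - x\<bar> \<and> f y - f x = (y - x) * f' z"
  proof (cases x y rule: linorder_cases)
    case less
    then obtain z where "x < z" "z < y" "f y - f x = (y - x) * f' z" using MVT2[of x y f f'] f by auto
    then show ?thesis by (intro exI[of _ z]) auto
  next
    case greater
    then obtain z where "y < z" "z < x" "f x - f y = (x - y) * f' z" using MVT2[of y x f f'] f by auto
    then show ?thesis by (intro exI[of _ z]) (auto simp: algebra_simps)
  qed (use assms in auto)
  then obtain z where z: "\<bar>z - x\<bar> \<le> \<bar>y - x\<bar>" "f y - f x = (y - x) * f' z" by blast
  have "0 \<le> M" using lip[of 0 1] by (simp add: order_trans[OF abs_ge_zero])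
  then have "M * \<bar>z - x\<bar> \<le> M * \<bar>y - x\<bar>" using z(1) by (intro mult_left_mono)
  then show ?thesis using z(2) lip[of z x] assms(3) by simp
qed

text \<open>\<open>F\<close> need not be jointly differentiable: F(s, x s) - F(t, x s) is treated by
  the mean value theorem and joint continuity of \<open>Ft\<close>, F(t, x s) - F(t, x t) by the
  one-variable chain rule.\<close>

lemma total_derivative:
  fixes F :: "real \<Rightarrow> real \<Rightarrow> real"
  assumes Ft: "\<And>t x. ((\<lambda>t. F t x) has_real_derivative Ft t x) (at t)"
    and Fx: "(F t has_real_derivative Fx) (at (x t))"
    and cont: "continuous_on UNIV (\<lambda>p. Ft (fst p) (snd p))"
    and x: "(x has_real_derivative x') (at t)"
  shows "((\<lambda>t. F t (x t)) has_real_derivative Ft t (x t) + Fx * x') (at t)"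
proof -
  have "\<exists>\<sigma>. \<bar>\<sigma> - t\<bar> \<le> \<bar>s - t\<bar> \<and> F s (x s) - F t (x s) = (s - t) * Ft \<sigma> (x s)" for s
  proof (cases s t rule: linorder_cases)
    case less
    then obtain z where "s < z" "z < t" "F t (x s) - F s (x s) = (t - s) * Ft z (x s)"
      using MVT2[of s t "\<lambda>t. F t (x s)" "\<lambda>t. Ft t (x s)"] Ft by auto
    then show ?thesis by (intro exI[of _ z]) (auto simp: algebra_simps)
  next
    case greater
    then obtain z where "t < z" "z < s" "F s (x s) - F t (x s) = (s - t) * Ft z (x s)"
      using MVT2[of t s "\<lambda>t. F t (x s)" "\<lambda>t. Ft t (x s)"] Ft by auto
    then show ?thesis by (intro exI[of _ z]) auto
  qed auto
  then obtain \<sigma> where \<sigma>: "\<And>s. \<bar>\<sigma> s - t\<bar> \<le> \<bar>s - t\<bar>" "\<And>s. F s (x s) - F t (x s) = (s - t) * Ft (\<sigma> s) (x s)"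
    by metis
  have "((\<lambda>s. \<sigma> s - t) \<longlongrightarrow> 0) (at t)"
  proof (rule Lim_null_comparison)
    show "\<forall>\<^sub>F s in at t. norm (\<sigma> s - t) \<le> \<bar>s - t\<bar>" using \<sigma>(1) by simp
    show "((\<lambda>s. \<bar>s - t\<bar>) \<longlongrightarrow> 0) (at t)" by (rule tendsto_eq_intros refl | simp)+
  qed
  then have "(\<sigma> \<longlongrightarrow> t) (at t)" by (simp add: LIM_zero_iff)
  moreover have xt: "(x \<longlongrightarrow> x t) (at t)" using DERIV_isCont[OF x] by (simp add: isCont_def)
  ultimately have "((\<lambda>s. (\<sigma> s, x s)) \<longlongrightarrow> (t, x t)) (at t)" by (rule tendsto_Pair)
  moreover have "isCont (\<lambda>p. Ft (fst p) (snd p)) (t, x t)"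
    using cont by (simp add: continuous_on_eq_continuous_at)
  ultimately have A: "((\<lambda>s. Ft (\<sigma> s) (x s)) \<longlongrightarrow> Ft t (x t)) (at t)"
    using isCont_tendsto_compose by fastforce
  have "((\<lambda>s. F t (x s)) has_real_derivative Fx * x') (at t)"
    using DERIV_chain2[OF Fx x] .
  then have B: "((\<lambda>s. (F t (x s) - F t (x t)) / (s - t)) \<longlongrightarrow> Fx * x') (at t)"
    by (simp add: has_field_derivative_iff)
  have "((\<lambda>s. (F s (x s) - F t (x t)) / (s - t)) \<longlongrightarrow> Ft t (x t) + Fx * x') (at t)"
  proof (rule Lim_transform_eventually[OF tendsto_add[OF A B]])
    have "Ft (\<sigma> s) (x s) + (F t (x s) - F t (x t)) / (s - t) = (F s (x s) - F t (x t)) / (s - t)" if "s \<noteq> t" for s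
      using \<sigma>(2)[of s] that by (simp add: field_simps)
    then show "\<forall>\<^sub>F s in at t. Ft (\<sigma> s) (x s) + (F t (x s) - F t (x t)) / (s - t) = (F s (x s) - F t (x t)) / (s - t)"
      by (auto simp: eventually_at intro: exI[of _ 1])
  qed
  then show ?thesis by (simp add: has_field_derivative_iff)
qed

locale euler_flow = euler_profile +
  fixes chi :: "real \<Rightarrow> real \<Rightarrow> real"
  assumes flow: "is_flow G chi"
begin

lemma chi_deriv: "((\<lambda>s. chi s \<theta>) has_real_derivative 2 * G t (chi t \<theta>)) (at t)"
  and chi_0: "chi 0 \<theta> = \<theta>"
  using flow by (auto simp: is_flow_def)

lemma chi_time_continuous: "continuous_on S (\<lambda>t. chi t \<theta>)"
  by (rule DERIV_continuous_on[OF has_field_derivative_at_within[OF chi_deriv]])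

section \<open>Uniform constants, uniqueness of trajectories and Lipschitz dependence of the
  flow\<close>

definition C where "C = (SOME C. 0 < C \<and> (\<forall>t x. \<bar>dG t x\<bar> \<le> C))"
definition M where "M = (SOME M. 0 < M \<and> (\<forall>t x y. \<bar>dG t x - dG t y\<bar> \<le> M * \<bar>x - y\<bar>))"

lemma C: "0 < C" "\<bar>dG t x\<bar> \<le> C"
proof -
  have "\<exists>C. 0 < C \<and> (\<forall>t x. \<bar>dG t x\<bar> \<le> C)" using ufam_dG by (metis ufam_bounded)
  from someI_ex[OF this] show "0 < C" "\<bar>dG t x\<bar> \<le> C" unfolding C_def by auto
qed

lemma M: "0 < M" "\<bar>dG t x - dG t y\<bar> \<le> M * \<bar>x - y\<bar>"
proof -
  have "\<exists>M. 0 < M \<and> (\<forall>t x y. \<bar>dG t x - dG t y\<bar> \<le> M * \<bar>x - y\<bar>)" using ufam_dG by (metis ufam_lipschitz)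
  from someI_ex[OF this] show "0 < M" "\<bar>dG t x - dG t y\<bar> \<le> M * \<bar>x - y\<bar>" unfolding M_def by auto
qed

text \<open>Two arbitrary trajectories are compared because one of them will be a trajectory of
  \<open>chi\<close> translated by 2 pi. The first bound gives uniqueness and Lipschitz dependence,
  the second that trajectories never merge.\<close>

lemma trajectories_bounds:
  assumes "\<And>t. (x has_real_derivative 2 * G t (x t)) (at t)" "\<And>t. (z has_real_derivative 2 * G t (z t)) (at t)"
  shows "\<bar>x t - z t\<bar> \<le> \<bar>x 0 - z 0\<bar> * exp (2 * C * \<bar>t\<bar>)" "\<bar>x 0 - z 0\<bar> \<le> \<bar>x t - z t\<bar> * exp (2 * C * \<bar>t\<bar>)"
proof -
  have 1: "((\<lambda>t. x t - z t) has_real_derivative 2 * G t (x t) - 2 * G t (z t)) (at t)" for t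
    using DERIV_diff[OF assms(1,2)] .
  have 2: "\<bar>2 * G t (x t) - 2 * G t (z t)\<bar> \<le> 2 * C * \<bar>x t - z t\<bar>" for t
    using lipschitz_of_deriv_bound[OF G_deriv C(2), of t "x t" "z t"] by linarith
  show "\<bar>x t - z t\<bar> \<le> \<bar>x 0 - z 0\<bar> * exp (2 * C * \<bar>t\<bar>)" "\<bar>x 0 - z 0\<bar> \<le> \<bar>x t - z t\<bar> * exp (2 * C * \<bar>t\<bar>)"
    using linear_ode_bounds[OF 1 2, of t] by simp_all
qed

lemma chi_lipschitz: "\<bar>chi t b - chi t a\<bar> \<le> \<bar>b - a\<bar> * exp (2 * C * \<bar>t\<bar>)"
  using trajectories_bounds(1)[OF chi_deriv chi_deriv, of t b a] by (simp add: chi_0)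

lemma chi_inj: "a \<noteq> b \<Longrightarrow> chi t a \<noteq> chi t b"
  using trajectories_bounds(2)[OF chi_deriv chi_deriv, of b a t] by (auto simp: chi_0)

lemma chi_2pi: "chi t (\<theta> + 2 * pi) = chi t \<theta> + 2 * pi"
proof -
  have "((\<lambda>t. chi t (\<theta> + 2 * pi) - 2 * pi) has_real_derivative 2 * G t (chi t (\<theta> + 2 * pi) - 2 * pi)) (at t)" for t
    using DERIV_diff[OF chi_deriv[of "\<theta> + 2 * pi" t] DERIV_const[of "2 * pi"]]
      period_2pi[of "G t" "chi t (\<theta> + 2 * pi) - 2 * pi", OF G_per] by simp
  from trajectories_bounds(1)[OF this chi_deriv, of t \<theta>] show ?thesis by (simp add: chi_0)
qed

definition y :: "real \<Rightarrow> real \<Rightarrow> real" where "y t \<theta> = dG t (chi t \<theta>)"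
text \<open>The finite-difference version of \<open>y\<close>: the chord between two trajectories
  grows at the relative rate 2 q.\<close>

definition q :: "real \<Rightarrow> real \<Rightarrow> real \<Rightarrow> real" where
  "q a b t = (G t (chi t b) - G t (chi t a)) / (chi t b - chi t a)"

lemma y_bound: "\<bar>y t \<theta>\<bar> \<le> C" unfolding y_def by (rule C)

lemma y_2pi: "y t (\<theta> + 2 * pi) = y t \<theta>"
  unfolding y_def chi_2pi by (rule period_2pi[of "dG t", OF dG_per])

lemma y_time_continuous: "continuous_on S (\<lambda>t. y t \<theta>)"
  unfolding y_def by (intro ufam_continuous_compose[OF ufam_dG] chi_time_continuous continuous_intros)

lemma q_y: "a \<noteq> b \<Longrightarrow> \<bar>q a b t - y t a\<bar> \<le> M * \<bar>chi t b - chi t a\<bar>"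
  unfolding q_def y_def by (rule difference_quotient_bound[OF G_deriv M(2)]) (rule chi_inj)

lemma q_y': "a \<noteq> b \<Longrightarrow> \<bar>q a b t - y t a\<bar> \<le> M * (\<bar>b - a\<bar> * exp (2 * C * \<bar>t\<bar>))"
  using q_y[of a b t] mult_left_mono[OF chi_lipschitz[of t b a], of M] M(1) by linarith

lemma q_bound: "a \<noteq> b \<Longrightarrow> \<bar>q a b t\<bar> \<le> C"
  using lipschitz_of_deriv_bound[OF G_deriv C(2), of t "chi t b" "chi t a"] chi_inj[of a b t]
  by (simp add: q_def divide_le_eq)

text \<open>To be the logarithm of the spatial derivative of \<open>chi\<close>, introduced as a
  primitive of 2 y before that derivative is known to exist.\<close>

definition Lam :: "real \<Rightarrow> real \<Rightarrow> real" where
  "Lam \<theta> = (SOME F. F 0 = 0 \<and> (\<forall>t. (F has_real_derivative 2 * y t \<theta>) (at t)))"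

lemma Lam_0: "Lam \<theta> 0 = 0" and Lam_deriv: "(Lam \<theta> has_real_derivative 2 * y t \<theta>) (at t)"
proof -
  have "continuous_on UNIV (\<lambda>t. 2 * y t \<theta>)" by (intro continuous_intros y_time_continuous)
  from someI_ex[OF ex_antiderivative_zero[OF this], folded Lam_def]
  show "Lam \<theta> 0 = 0" "(Lam \<theta> has_real_derivative 2 * y t \<theta>) (at t)" by auto
qed

text \<open>The chord solves the linear equation D' = 2 q D, so exp(-F) is an integrating factor.
  Order preservation and differentiability of the flow both follow from this formula.\<close>

lemma chi_difference:
  assumes "a \<noteq> b"
  obtains F where "F 0 = 0" "\<And>t. (F has_real_derivative 2 * q a b t) (at t)"
    "\<And>t. chi t b - chi t a = (b - a) * exp (F t)"
proof -
  have "continuous_on UNIV (\<lambda>t. 2 * q a b t)"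
    unfolding q_def using chi_inj[OF assms[symmetric]]
    by (intro continuous_intros ufam_continuous_compose[OF ufam_G] chi_time_continuous) auto
  then obtain F where F: "F 0 = 0" "\<And>t. (F has_real_derivative 2 * q a b t) (at t)"
    using ex_antiderivative_zero by blast
  have "((\<lambda>t. (chi t b - chi t a) * exp (- F t)) has_real_derivative 0) (at t)" for t
  proof -
    have "((\<lambda>t. (chi t b - chi t a) * exp (- F t)) has_real_derivative
      (chi t b - chi t a) * (exp (- F t) * (- (2 * q a b t))) + (2 * G t (chi t b) - 2 * G t (chi t a)) * exp (- F t)) (at t)"
      by (auto intro!: derivative_eq_intros F(2) chi_deriv)
    moreover have "q a b t * (chi t b - chi t a) = G t (chi t b) - G t (chi t a)"
      using chi_inj[OF assms, of t] by (simp add: q_def)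
    moreover have "(chi t b - chi t a) * (exp (- F t) * (- (2 * q a b t))) + (2 * G t (chi t b) - 2 * G t (chi t a)) * exp (- F t)
        = 2 * exp (- F t) * ((G t (chi t b) - G t (chi t a)) - q a b t * (chi t b - chi t a))"
      by (simp add: algebra_simps)
    ultimately show ?thesis by simp
  qed
  from DERIV_isconst_all[OF allI[OF this], of _ 0]
  have "(chi t b - chi t a) * exp (- F t) = b - a" for t by (simp add: F(1) chi_0)
  then have "chi t b - chi t a = (b - a) * exp (F t)" for t
    by (metis exp_minus_inverse mult.assoc mult.commute mult.right_neutral)
  then show ?thesis using that F by blast
qed

lemma chi_strict_mono: assumes "a < b" shows "chi t a < chi t b"
proof -
  obtain F where "\<And>t. chi t b - chi t a = (b - a) * exp (F t)" using chi_difference[of a b] assms by blast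
  from this[of t] have "0 < chi t b - chi t a" using assms by simp
  then show ?thesis by simp
qed

lemma chi_continuous: "continuous_on S (chi t)"
proof -
  have "lipschitz_on (exp (2 * C * \<bar>t\<bar>)) UNIV (chi t)"
    using chi_lipschitz[of t] by (intro lipschitz_onI) (auto simp: dist_real_def mult.commute)
  then show ?thesis using lipschitz_on_continuous_on continuous_on_subset by blast
qed

lemma y_continuous: "continuous_on S (y t)"
  unfolding y_def[abs_def] by (intro ufam_continuous_compose[OF ufam_dG] chi_continuous continuous_intros)

text \<open>The difference quotient is exp(F t) for the exponent F of \<open>chi_difference\<close>.
  F and \<open>Lam \<theta>\<close> both vanish at time 0 and their rates differ by O(|b -
  \<theta>|) up to time \<open>t\<close>, so the quotient tends to exp(Lam).\<close>

lemma chi_space_deriv: "(chi t has_real_derivative exp (Lam \<theta> t)) (at \<theta>)"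
proof -
  let ?K = "2 * M * exp (2 * C * \<bar>t\<bar>) * \<bar>t\<bar>"
  have "\<exists>r. \<bar>r - Lam \<theta> t\<bar> \<le> ?K * \<bar>b - \<theta>\<bar> \<and> (b \<noteq> \<theta> \<longrightarrow> (chi t b - chi t \<theta>) / (b - \<theta>) = exp r)" for b
  proof (cases "b = \<theta>")
    case False
    obtain F where F: "F 0 = 0" "\<And>t. (F has_real_derivative 2 * q \<theta> b t) (at t)"
      "\<And>t. chi t b - chi t \<theta> = (b - \<theta>) * exp (F t)" using chi_difference[of \<theta> b] False by metis
    have "\<bar>(F t - Lam \<theta> t) - (F 0 - Lam \<theta> 0)\<bar> \<le> (2 * M * exp (2 * C * \<bar>t\<bar>) * \<bar>b - \<theta>\<bar>) * \<bar>t\<bar>"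
    proof (rule increment_bound)
      show "((\<lambda>t. F t - Lam \<theta> t) has_real_derivative (2 * q \<theta> b s - 2 * y s \<theta>)) (at s)" for s
        by (intro DERIV_diff F(2) Lam_deriv)
      fix s assume s: "\<bar>s\<bar> \<le> \<bar>t\<bar>"
      have "\<bar>2 * q \<theta> b s - 2 * y s \<theta>\<bar> \<le> 2 * (M * (\<bar>b - \<theta>\<bar> * exp (2 * C * \<bar>s\<bar>)))"
        using q_y'[of \<theta> b s] False by linarith
      also have "\<dots> \<le> 2 * (M * (\<bar>b - \<theta>\<bar> * exp (2 * C * \<bar>t\<bar>)))"
        using s M(1) C(1) by (intro mult_left_mono) auto
      finally show "\<bar>2 * q \<theta> b s - 2 * y s \<theta>\<bar> \<le> 2 * M * exp (2 * C * \<bar>t\<bar>) * \<bar>b - \<theta>\<bar>" by (simp add: mult_ac)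
    qed
    then have "\<bar>F t - Lam \<theta> t\<bar> \<le> ?K * \<bar>b - \<theta>\<bar>" by (simp add: F(1) Lam_0 mult_ac)
    moreover have "(chi t b - chi t \<theta>) / (b - \<theta>) = exp (F t)" using False F(3)[of t] by simp
    ultimately show ?thesis by blast
  qed auto
  then obtain r where r: "\<And>b. \<bar>r b - Lam \<theta> t\<bar> \<le> ?K * \<bar>b - \<theta>\<bar>" "\<And>b. b \<noteq> \<theta> \<Longrightarrow> (chi t b - chi t \<theta>) / (b - \<theta>) = exp (r b)"
    by metis
  have "((\<lambda>b. r b - Lam \<theta> t) \<longlongrightarrow> 0) (at \<theta>)"
  proof (rule Lim_null_comparison)
    show "\<forall>\<^sub>F b in at \<theta>. norm (r b - Lam \<theta> t) \<le> ?K * \<bar>b - \<theta>\<bar>" using r(1) by simp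
    show "((\<lambda>b. ?K * \<bar>b - \<theta>\<bar>) \<longlongrightarrow> 0) (at \<theta>)" by (rule tendsto_eq_intros refl | simp)+
  qed
  then have "(r \<longlongrightarrow> Lam \<theta> t) (at \<theta>)" by (simp add: LIM_zero_iff)
  then have "((\<lambda>b. exp (r b)) \<longlongrightarrow> exp (Lam \<theta> t)) (at \<theta>)" by (rule tendsto_exp)
  then have "((\<lambda>b. (chi t b - chi t \<theta>) / (b - \<theta>)) \<longlongrightarrow> exp (Lam \<theta> t)) (at \<theta>)"
    by (rule Lim_transform_eventually) (auto simp: eventually_at r(2) intro: exI[of _ 1])
  then show ?thesis by (simp add: has_field_derivative_iff)
qed

lemma dchi_eq: "dchi chi t \<theta> = exp (Lam \<theta> t)"
  unfolding dchi_def using chi_space_deriv by (rule DERIV_imp_deriv)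

lemma dchi_deriv: "((\<lambda>s. dchi chi s \<theta>) has_real_derivative exp (Lam \<theta> t) * (2 * y t \<theta>)) (at t)"
  unfolding dchi_eq using DERIV_fun_exp[OF Lam_deriv] by simp

lemma Cset_eq: "Cset chi t = {\<theta>. y t \<theta> < 0}"
  unfolding Cset_def DERIV_imp_deriv[OF dchi_deriv] by (simp add: mult_less_0_iff)

text \<open>The transport term 2 G G' of the total derivative cancels the one in
  \<open>V\<close>.\<close>

lemma G_along_flow: "((\<lambda>t. G t (chi t \<theta>)) has_real_derivative dH t (chi t \<theta>)) (at t)"
  using total_derivative[of G V t "dG t (chi t \<theta>)" "\<lambda>t. chi t \<theta>", OF G_time_deriv G_deriv ufam_continuous[OF ufam_V] chi_deriv]
  by (simp add: V_def mult_ac)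

text \<open>Differentiating \<open>G_along_flow\<close> in \<open>\<theta>\<close>; the limit is taken in the difference quotients \<open>q\<close>, since
  the second space derivative of \<open>G\<close> need not exist.\<close>
lemma y_deriv: "((\<lambda>t. y t \<theta>) has_real_derivative (y t \<theta>)^2 - 4 * H t (chi t \<theta>)) (at t)"
proof -
  define R where "R t = (y t \<theta>)^2 - 4 * H t (chi t \<theta>)" for t
  define H2 where "H2 t x = 3 * (dG t x * dG t x) - 4 * H t x" for t x
  have "ufam H2" unfolding H2_def[abs_def] by (intro ufam_diff ufam_H ufam_cmult ufam_mult ufam_dG)
  then obtain K where K: "0 < K" "\<And>t x y. \<bar>H2 t x - H2 t y\<bar> \<le> K * \<bar>x - y\<bar>" by (metis ufam_lipschitz)
  have "continuous_on UNIV R"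
    unfolding R_def by (intro continuous_intros y_time_continuous ufam_continuous_compose[OF ufam_H] chi_time_continuous)
  then obtain P where P: "\<And>t. (P has_real_derivative R t) (at t)" using ex_antiderivative by blast
  have "y t \<theta> - P t = y 0 \<theta> - P 0" for t
  proof -
    let ?E = "exp (2 * C * \<bar>t\<bar>)"
    \<comment> \<open>The terms pay for comparing the rates of q and P up to time \<open>t\<close>,
      and for replacing \<open>y\<close> by \<open>q\<close> at time \<open>t\<close> and at time 0.
      The error is linear in \<delta>, which is arbitrary.\<close>
    let ?B = "(K + 4 * C * M) * ?E * \<bar>t\<bar> + M * ?E + M"
    have est: "\<bar>(y t \<theta> - P t) - (y 0 \<theta> - P 0)\<bar> \<le> ?B * \<delta>" if \<delta>: "0 < \<delta>" for \<delta>
    proof -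
      define b where "b = \<theta> + \<delta>"
      have ne: "\<theta> \<noteq> b" using \<delta> by (simp add: b_def)
      let ?D = "\<lambda>t. chi t b - chi t \<theta>"
      have D: "\<bar>?D s\<bar> \<le> \<delta> * ?E" if "\<bar>s\<bar> \<le> \<bar>t\<bar>" for s
      proof -
        have "\<bar>?D s\<bar> \<le> \<delta> * exp (2 * C * \<bar>s\<bar>)" using chi_lipschitz[of s b \<theta>] \<delta> by (simp add: b_def)
        also have "\<dots> \<le> \<delta> * ?E" using that C(1) \<delta> by (intro mult_left_mono) auto
        finally show ?thesis .
      qed
      \<comment> \<open>As b tends to \<theta>, the slope of \<open>dH\<close> tends to H'' = 3 y^2
        - 4 H and q to y, so q' tends to y^2 - 4 H, which is R.\<close>
      define q' where "q' s = (dH s (chi s b) - dH s (chi s \<theta>)) / ?D s - 2 * (q \<theta> b s)^2" for s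
      have dq: "(q \<theta> b has_real_derivative q' s) (at s)" for s
      proof -
        let ?N = "G s (chi s b) - G s (chi s \<theta>)"
        have "(q \<theta> b has_real_derivative ((dH s (chi s b) - dH s (chi s \<theta>)) * ?D s
            - ?N * (2 * G s (chi s b) - 2 * G s (chi s \<theta>))) / (?D s * ?D s)) (at s)"
          unfolding q_def[abs_def]
          by (intro DERIV_divide DERIV_diff G_along_flow chi_deriv) (use chi_inj[OF ne, of s] in simp)
        moreover have "((dH s (chi s b) - dH s (chi s \<theta>)) * ?D s
            - ?N * (2 * G s (chi s b) - 2 * G s (chi s \<theta>))) / (?D s * ?D s) = q' s"
        proof -
          have gen: "(A * D - N * (2 * N)) / (D * D) = A / D - 2 * (N / D)^2" if "D \<noteq> 0" for A D N :: real
            using that by (simp add: field_simps power2_eq_square)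
          have "2 * G s (chi s b) - 2 * G s (chi s \<theta>) = 2 * ?N" by simp
          then show ?thesis
            unfolding q'_def q_def by (simp only:) (rule gen, use chi_inj[OF ne, of s] in simp)
        qed
        ultimately show ?thesis by simp
      qed
      have q'R: "\<bar>q' s - R s\<bar> \<le> (K + 4 * C * M) * \<bar>?D s\<bar>" for s
      proof -
        have 1: "\<bar>(dH s (chi s b) - dH s (chi s \<theta>)) / ?D s - H2 s (chi s \<theta>)\<bar> \<le> K * \<bar>?D s\<bar>"
          using difference_quotient_bound[of "dH s" "H2 s" K "chi s \<theta>" "chi s b"] dH_deriv K(2) chi_inj[OF ne, of s]
          by (simp add: H2_def)
        have "\<bar>q \<theta> b s + y s \<theta>\<bar> \<le> 2 * C" using q_bound[OF ne, of s] y_bound[of s \<theta>] by linarith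
        then have *: "\<bar>q \<theta> b s + y s \<theta>\<bar> * \<bar>q \<theta> b s - y s \<theta>\<bar> \<le> 2 * C * (M * \<bar>?D s\<bar>)"
          using q_y[OF ne, of s] C(1) by (intro mult_mono) auto
        have 2: "\<bar>2 * (q \<theta> b s)^2 - 2 * (y s \<theta>)^2\<bar> \<le> 4 * C * M * \<bar>?D s\<bar>"
        proof -
          have "2 * (q \<theta> b s)^2 - 2 * (y s \<theta>)^2 = 2 * ((q \<theta> b s + y s \<theta>) * (q \<theta> b s - y s \<theta>))"
            by (simp add: algebra_simps power2_eq_square)
          then have "\<bar>2 * (q \<theta> b s)^2 - 2 * (y s \<theta>)^2\<bar> = 2 * (\<bar>q \<theta> b s + y s \<theta>\<bar> * \<bar>q \<theta> b s - y s \<theta>\<bar>)"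
            by (simp only: abs_mult abs_numeral)
          then show ?thesis using * by linarith
        qed
        have "q' s - R s = ((dH s (chi s b) - dH s (chi s \<theta>)) / ?D s - H2 s (chi s \<theta>)) - (2 * (q \<theta> b s)^2 - 2 * (y s \<theta>)^2)"
          by (simp add: q'_def R_def H2_def y_def power2_eq_square)
        then show ?thesis using 1 2 unfolding distrib_right by linarith
      qed
      have "\<bar>(q \<theta> b t - P t) - (q \<theta> b 0 - P 0)\<bar> \<le> (K + 4 * C * M) * (\<delta> * ?E) * \<bar>t\<bar>"
      proof (rule increment_bound)
        show "((\<lambda>t. q \<theta> b t - P t) has_real_derivative q' s - R s) (at s)" for s by (intro DERIV_diff dq P)
        show "\<bar>q' s - R s\<bar> \<le> (K + 4 * C * M) * (\<delta> * ?E)" if "\<bar>s\<bar> \<le> \<bar>t\<bar>" for s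
          using q'R[of s] mult_left_mono[OF D[OF that], of "K + 4 * C * M"] K(1) C(1) M(1) by force
      qed
      moreover have "\<bar>q \<theta> b t - y t \<theta>\<bar> \<le> M * (\<delta> * ?E)" "\<bar>q \<theta> b 0 - y 0 \<theta>\<bar> \<le> M * \<delta>"
        using q_y'[OF ne, of t] q_y'[OF ne, of 0] \<delta> by (simp_all add: b_def)
      ultimately have "\<bar>(y t \<theta> - P t) - (y 0 \<theta> - P 0)\<bar> \<le> (K + 4 * C * M) * (\<delta> * ?E) * \<bar>t\<bar> + M * (\<delta> * ?E) + M * \<delta>"
        by linarith
      then show ?thesis by (simp add: algebra_simps)
    qed
    have Bp: "0 < ?B" using K(1) C(1) M(1) by (intro add_nonneg_pos) auto
    have "\<bar>(y t \<theta> - P t) - (y 0 \<theta> - P 0)\<bar> \<le> 0"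
    proof (rule field_le_epsilon)
      fix e :: real assume "0 < e"
      then show "\<bar>(y t \<theta> - P t) - (y 0 \<theta> - P 0)\<bar> \<le> 0 + e" using est[of "e / ?B"] Bp by simp
    qed
    then show ?thesis by simp
  qed
  then have "(\<lambda>t. y t \<theta>) = (\<lambda>t. P t + (y 0 \<theta> - P 0))" by (simp add: fun_eq_iff algebra_simps)
  then show ?thesis using DERIV_add[OF P[of t] DERIV_const[of "y 0 \<theta> - P 0"]] by (simp add: R_def)
qed

lemma H_nonneg: "0 \<le> H t x"
  unfolding H_def using L by (intro kop_nonneg continuous_intros ufam_section_continuous ufam_dG) auto

text \<open>\<open>w\<close> is the reciprocal square root of \<open>dchi\<close>, in which the Riccati equation \<open>y_deriv\<close> becomes the linear
  equation \<open>w'' = 4 H w\<close>.\<close>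
definition w :: "real \<Rightarrow> real \<Rightarrow> real" where "w \<theta> t = exp (- Lam \<theta> t / 2)"

lemma w_pos: "0 < w \<theta> t" by (simp add: w_def)

lemma w_deriv: "(w \<theta> has_real_derivative - (y t \<theta> * w \<theta> t)) (at t)"
proof -
  have "((\<lambda>t. - Lam \<theta> t / 2) has_real_derivative - y t \<theta>) (at t)"
    using DERIV_cdivide[OF DERIV_minus[OF Lam_deriv[of \<theta> t]], where c = 2] by simp
  from DERIV_fun_exp[OF this] show ?thesis by (simp add: w_def[abs_def] mult.commute)
qed

text \<open>In (y w)' the quadratic terms cancel and -4 H w is left. As y w = -w', this is the
  convexity of \<open>w\<close>.\<close>

lemma yw_antimono: assumes "s \<le> t" shows "y t \<theta> * w \<theta> t \<le> y s \<theta> * w \<theta> s"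
proof (rule DERIV_nonpos_imp_nonincreasing[OF assms])
  fix x
  have "((\<lambda>t. y t \<theta> * w \<theta> t) has_real_derivative - 4 * H x (chi x \<theta>) * w \<theta> x) (at x)"
    using DERIV_mult[OF y_deriv[of \<theta> x] w_deriv[of \<theta> x]] by (simp add: algebra_simps power2_eq_square)
  moreover have "- 4 * H x (chi x \<theta>) * w \<theta> x \<le> 0"
    using H_nonneg[of x "chi x \<theta>"] w_pos[of \<theta> x] by simp
  ultimately show "\<exists>z. ((\<lambda>t. y t \<theta> * w \<theta> t) has_real_derivative z) (at x) \<and> z \<le> 0" by blast
qed

lemma y_neg_persists: assumes "s \<le> t" "y s \<theta> < 0" shows "y t \<theta> < 0"
proof -
  have "y s \<theta> * w \<theta> s < 0" using assms(2) w_pos by (simp add: mult_less_0_iff)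
  then have "y t \<theta> * w \<theta> t < 0" using yw_antimono[OF assms(1), of \<theta>] by linarith
  then show ?thesis using w_pos[of \<theta> t] by (simp add: mult_less_0_iff)
qed

lemma dchi_tendsto_0:
  assumes "y s \<theta> < 0" shows "((\<lambda>t. dchi chi t \<theta>) \<longlongrightarrow> 0) at_top"
proof -
  \<comment> \<open>The slope of \<open>w\<close> at time \<open>s\<close>; by convexity it bounds
    all later slopes from below, and \<open>dchi\<close> is w^(-2).\<close>
  define k where "k = - (y s \<theta> * w \<theta> s)"
  have k: "0 < k" using assms w_pos[of \<theta> s] by (simp add: k_def mult_less_0_iff)
  have "w \<theta> s + k * (t - s) \<le> w \<theta> t" if "s \<le> t" for t
  proof -
    have "w \<theta> s - k * s \<le> w \<theta> t - k * t"
    proof (rule DERIV_nonneg_imp_nondecreasing[OF that])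
      fix x assume x: "s \<le> x"
      have "((\<lambda>t. w \<theta> t - k * t) has_real_derivative - (y x \<theta> * w \<theta> x) - k) (at x)"
        by (auto intro!: derivative_eq_intros w_deriv)
      moreover have "0 \<le> - (y x \<theta> * w \<theta> x) - k" using yw_antimono[OF x, of \<theta>] by (simp add: k_def)
      ultimately show "\<exists>z. ((\<lambda>t. w \<theta> t - k * t) has_real_derivative z) (at x) \<and> 0 \<le> z" by blast
    qed
    then show ?thesis by (simp add: algebra_simps)
  qed
  then have ge: "\<forall>\<^sub>F t in at_top. w \<theta> s + k * (t - s) \<le> w \<theta> t"
    using eventually_ge_at_top[of s] by (rule eventually_mono[rotated])
  have "filterlim (\<lambda>t. (w \<theta> s - k * s) + k * t) at_top at_top"
    using k by (intro filterlim_tendsto_add_at_top[OF tendsto_const]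
        filterlim_tendsto_pos_mult_at_top[OF tendsto_const _ filterlim_ident])
  then have "filterlim (w \<theta>) at_top at_top"
    by (rule filterlim_at_top_mono) (use ge in \<open>simp add: algebra_simps\<close>)
  then have "((\<lambda>t. inverse (w \<theta> t)) \<longlongrightarrow> 0) at_top" by (rule tendsto_inverse_0_at_top)
  from tendsto_power[OF this, of 2] have "((\<lambda>t. (inverse (w \<theta> t))^2) \<longlongrightarrow> 0) at_top" by simp
  moreover have "(inverse (w \<theta> t))^2 = dchi chi t \<theta>" for t
    by (simp add: w_def dchi_eq power2_eq_square flip: exp_minus exp_add)
  ultimately show ?thesis by simp
qed

end

section \<open>Weak convergence\<close>

context finite_measure begin

lemma integrable_indicator: "A \<in> sets M \<Longrightarrow> integrable M (indicat_real A)"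
  by (rule integrable_real_indicator) (simp_all add: less_top[symmetric])

text \<open>Integrability is part of the predicate because the Bochner integral of a non-integrable
  function is 0, which could make the limit hold spuriously and would spoil additivity.\<close>

definition vanishes_against :: "(real \<Rightarrow> 'a \<Rightarrow> real) \<Rightarrow> ('a \<Rightarrow> real) \<Rightarrow> bool" where
  "vanishes_against f \<psi> \<longleftrightarrow> integrable M \<psi> \<and> ((\<lambda>t. \<integral>x. f t x * \<psi> x \<partial>M) \<longlongrightarrow> 0) at_top"

context
  fixes f :: "real \<Rightarrow> 'a \<Rightarrow> real" and B :: real
  assumes f_meas: "\<And>t. f t \<in> borel_measurable M" and f_bound: "\<And>t x. \<bar>f t x\<bar> \<le> B"
begin

lemma integrable_times_bounded:
  assumes "integrable M \<psi>" shows "integrable M (\<lambda>x. f t x * \<psi> x)"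
proof (rule Bochner_Integration.integrable_bound)
  show "integrable M (\<lambda>x. B * \<psi> x)" using assms by simp
  show "(\<lambda>x. f t x * \<psi> x) \<in> borel_measurable M" using f_meas assms by measurable
  have "norm (f t x * \<psi> x) \<le> norm (B * \<psi> x)" for x
    using mult_right_mono[OF order_trans[OF f_bound[of t x] abs_ge_self] abs_ge_zero[of "\<psi> x"]] by (simp add: abs_mult)
  then show "AE x in M. norm (f t x * \<psi> x) \<le> norm (B * \<psi> x)" by simp
qed

lemma vanishes_against_add:
  "vanishes_against f \<phi> \<Longrightarrow> vanishes_against f \<psi> \<Longrightarrow> vanishes_against f (\<lambda>x. \<phi> x + \<psi> x)"
  using tendsto_add[of "\<lambda>t. \<integral>x. f t x * \<phi> x \<partial>M" 0 at_top "\<lambda>t. \<integral>x. f t x * \<psi> x \<partial>M" 0]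
  unfolding vanishes_against_def by (auto simp: distrib_left integrable_times_bounded)

lemma vanishes_against_cmult:
  "vanishes_against f \<psi> \<Longrightarrow> vanishes_against f (\<lambda>x. c * \<psi> x)"
  using tendsto_mult_left[of "\<lambda>t. \<integral>x. f t x * \<psi> x \<partial>M" 0 at_top c]
  unfolding vanishes_against_def by (auto simp: mult.left_commute)

lemma vanishes_against_sum:
  "finite I \<Longrightarrow> (\<And>i. i \<in> I \<Longrightarrow> vanishes_against f (\<psi> i)) \<Longrightarrow> vanishes_against f (\<lambda>x. \<Sum>i\<in>I. \<psi> i x)"
proof (induction I rule: finite_induct)
  case empty
  then show ?case by (simp add: vanishes_against_def)
next
  case (insert i I)
  then show ?case using vanishes_against_add[of "\<psi> i"] by simp
qed

text \<open>Domination gives convergence of \<open>s n\<close> to \<psi> in L^1. As \<open>f\<close>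
  is bounded uniformly in t, the integrals are then close uniformly in t, so the limits in n and t
  may be interchanged.\<close>

lemma vanishes_against_lim:
  assumes s: "\<And>n. vanishes_against f (s n)" and lim: "\<And>x. x \<in> space M \<Longrightarrow> (\<lambda>n. s n x) \<longlonglongrightarrow> \<psi> x"
    and dom: "\<And>n x. x \<in> space M \<Longrightarrow> \<bar>s n x\<bar> \<le> w x" and w: "integrable M w" and \<psi>: "\<psi> \<in> borel_measurable M"
  shows "vanishes_against f \<psi>"
proof -
  have si: "integrable M (s n)" for n using s by (simp add: vanishes_against_def)
  have \<psi>i: "integrable M \<psi>"
    by (rule integrable_dominated_convergence[OF \<psi> _ w, of s]) (use si lim dom in auto)
  have "(\<lambda>n. \<integral>x. \<bar>s n x - \<psi> x\<bar> \<partial>M) \<longlonglongrightarrow> (\<integral>x. 0 \<partial>M)"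
  proof (rule integral_dominated_convergence)
    show "integrable M (\<lambda>x. 2 * w x)" using w by simp
    show "AE x in M. (\<lambda>n. \<bar>s n x - \<psi> x\<bar>) \<longlonglongrightarrow> 0"
      using lim by (intro AE_I2) (simp add: LIM_zero tendsto_rabs_zero)
    show "AE x in M. norm \<bar>s n x - \<psi> x\<bar> \<le> 2 * w x" for n
    proof (rule AE_I2)
      fix x assume x: "x \<in> space M"
      have "\<bar>\<psi> x\<bar> \<le> w x" using lim[OF x] dom[OF x] by (intro Lim_bounded[of "\<lambda>n. \<bar>s n x\<bar>"] tendsto_rabs) auto
      then show "norm \<bar>s n x - \<psi> x\<bar> \<le> 2 * w x" using dom[OF x, of n] by simp
    qed
  qed (use si \<psi> in measurable)
  then have "(\<lambda>n. B * (\<integral>x. \<bar>s n x - \<psi> x\<bar> \<partial>M)) \<longlonglongrightarrow> 0" using tendsto_mult_right_zero by fastforce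
  moreover have B0: "0 \<le> B" using order_trans[OF abs_ge_zero f_bound] .
  have near: "\<bar>(\<integral>x. f t x * \<psi> x \<partial>M) - (\<integral>x. f t x * s n x \<partial>M)\<bar> \<le> B * (\<integral>x. \<bar>s n x - \<psi> x\<bar> \<partial>M)" for t n
  proof -
    have "(\<integral>x. f t x * \<psi> x \<partial>M) - (\<integral>x. f t x * s n x \<partial>M) = (\<integral>x. f t x * (\<psi> x - s n x) \<partial>M)"
      by (simp add: right_diff_distrib integrable_times_bounded si \<psi>i)
    also have "\<bar>\<dots>\<bar> \<le> (\<integral>x. \<bar>f t x * (\<psi> x - s n x)\<bar> \<partial>M)" by (rule integral_abs_bound)
    also have "\<dots> \<le> (\<integral>x. B * \<bar>s n x - \<psi> x\<bar> \<partial>M)"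
    proof (rule integral_mono)
      show "integrable M (\<lambda>x. \<bar>f t x * (\<psi> x - s n x)\<bar>)"
        using si \<psi>i by (intro integrable_abs integrable_times_bounded Bochner_Integration.integrable_diff)
      show "\<bar>f t x * (\<psi> x - s n x)\<bar> \<le> B * \<bar>s n x - \<psi> x\<bar>" for x
        using mult_right_mono[OF f_bound[of t x] abs_ge_zero[of "\<psi> x - s n x"]]
        by (simp add: abs_mult abs_minus_commute)
    qed (use si \<psi>i in auto)
    finally show ?thesis by simp
  qed
  have "((\<lambda>t. \<integral>x. f t x * \<psi> x \<partial>M) \<longlongrightarrow> 0) at_top"
  proof (rule tendstoI)
    fix e :: real assume e: "0 < e"
    then have "\<forall>\<^sub>F n in sequentially. dist (B * (\<integral>x. \<bar>s n x - \<psi> x\<bar> \<partial>M)) 0 < e / 2"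
      using calculation by (intro tendstoD) auto
    then obtain n where "dist (B * (\<integral>x. \<bar>s n x - \<psi> x\<bar> \<partial>M)) 0 < e / 2"
      unfolding eventually_sequentially by blast
    then have n: "B * (\<integral>x. \<bar>s n x - \<psi> x\<bar> \<partial>M) < e / 2" by (simp add: dist_real_def)
    have "((\<lambda>t. \<integral>x. f t x * s n x \<partial>M) \<longlongrightarrow> 0) at_top" using s by (simp add: vanishes_against_def)
    from tendstoD[OF this, of "e / 2"] e
    have "\<forall>\<^sub>F t in at_top. dist (\<integral>x. f t x * s n x \<partial>M) 0 < e / 2" by simp
    then show "\<forall>\<^sub>F t in at_top. dist (\<integral>x. f t x * \<psi> x \<partial>M) 0 < e"
    proof (rule eventually_mono)
      fix t assume "dist (\<integral>x. f t x * s n x \<partial>M) 0 < e / 2"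
      then show "dist (\<integral>x. f t x * \<psi> x \<partial>M) 0 < e" using near[of t n] n unfolding dist_real_def by linarith
    qed
  qed
  then show ?thesis using \<psi>i by (simp add: vanishes_against_def)
qed

text \<open>Dynkin's lemma extends convergence from a generating \<open>\<inter>\<close>-stable class to all measurable sets.\<close>
lemma vanishes_against_all:
  assumes gen: "sets M = sigma_sets (space M) \<G>" "\<G> \<subseteq> Pow (space M)" "Int_stable \<G>"
    and basic: "\<And>A. A \<in> \<G> \<Longrightarrow> vanishes_against f (indicator A)"
    and whole: "vanishes_against f (\<lambda>_. 1)"
    and \<psi>: "integrable M \<psi>"
  shows "vanishes_against f \<psi>"
proof -
  have ind: "vanishes_against f (indicator A)" if "A \<in> sigma_sets (space M) \<G>" for A
    using gen(3,2) that
  proof (induction rule: sigma_sets_induct_disjoint)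
    case (basic A)
    then show ?case by (rule assms(4))
  next
    case empty
    then show ?case by (simp add: vanishes_against_def)
  next
    case (compl A)
    have "(\<integral>x. f t x * (1 + - 1 * indicator A x) \<partial>M) = (\<integral>x. f t x * indicator (space M - A) x \<partial>M)" for t
      by (intro Bochner_Integration.integral_cong) (auto simp: indicator_def)
    moreover have "integrable M (indicat_real (space M - A))"
      using compl(1) gen(1) sets.compl_sets[of A M] by (intro integrable_indicator) auto
    ultimately show ?case
      using vanishes_against_add[OF whole vanishes_against_cmult[OF compl(2), of "-1"]]
      unfolding vanishes_against_def by simp
  next
    case (union A)
    have sets: "A i \<in> sets M" for i using union(2) gen(1) by auto
    show ?case
    \<comment> \<open>Partial sums of indicators of disjoint sets are indicators of partial unions,
      hence dominated by 1, which is integrable for a finite measure.\<close>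
    proof (rule vanishes_against_lim[where w = "\<lambda>_. 1" and s = "\<lambda>n x. \<Sum>i<n. indicator (A i) x"])
      show "vanishes_against f (\<lambda>x. \<Sum>i<n. indicator (A i) x)" for n
        using union(3) by (intro vanishes_against_sum) auto
      have eq: "(\<Sum>i<n. indicator (A i) x) = (indicator (\<Union>i<n. A i) x :: real)" for n x
        using union(1) by (subst indicator_UN_disjoint) (auto simp: disjoint_family_on_def)
      show "(\<lambda>n. \<Sum>i<n. indicat_real (A i) x) \<longlonglongrightarrow> indicator (\<Union>i. A i) x" for x
      proof (cases "\<exists>i. x \<in> A i")
        case True
        then obtain i where i: "x \<in> A i" by blast
        have "\<forall>\<^sub>F n in sequentially. indicat_real (\<Union>i<n. A i) x = 1"
          using eventually_gt_at_top[of i] by eventually_elim (use i in \<open>auto simp: indicator_def\<close>)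
        then show ?thesis unfolding eq using True by (simp add: tendsto_eventually indicator_def)
      qed (simp add: indicator_def)
      show "\<bar>\<Sum>i<n. indicat_real (A i) x\<bar> \<le> 1" for n x unfolding eq by (simp add: indicator_def)
    qed (use sets in auto)
  qed
  show ?thesis
    using \<psi>
  proof (induction rule: integrable_induct)
    case (base A c)
    then show ?case
      using vanishes_against_cmult[OF ind, of A c] gen(1) by (simp add: mult.commute)
  next
    case (add \<phi> \<psi>)
    then show ?case using vanishes_against_add by blast
  next
    case (lim \<psi> s)
    show ?case
    proof (rule vanishes_against_lim[where w = "\<lambda>x. 2 * \<bar>\<psi> x\<bar>" and s = s])
      show "vanishes_against f (s n)" for n using lim by blast
      show "(\<lambda>n. s n x) \<longlonglongrightarrow> \<psi> x" if "x \<in> space M" for x using lim that by blast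
      show "\<bar>s n x\<bar> \<le> 2 * \<bar>\<psi> x\<bar>" if "x \<in> space M" for n x using lim.hyps(3)[OF that, of n] by simp
      show "integrable M (\<lambda>x. 2 * \<bar>\<psi> x\<bar>)" "\<psi> \<in> borel_measurable M" using lim.hyps(4) by auto
    qed
  qed
qed

end
end

section \<open>Conservation of the mean, and weak convergence when G' decays\<close>

context euler_flow begin

text \<open>\<open>V\<close> is the derivative of the periodic function H - G^2, so testing the
  evolution with the constant 1 gives a conserved quantity.\<close>

lemma G_mass: "integral {0..2*pi} (G t) = integral {0..2*pi} (G 0)"
proof -
  have "wderiv (\<lambda>x. H t x - G t x * G t x) (\<lambda>x. V t x * 1 - 0)" for t
    by (rule wderiv_eq[OF wderiv_diff[OF wderiv_H[of t] wderiv_mult[OF wderiv_G[of t] wderiv_G[of t]]]])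
      (auto simp: V_def)
  from has_integral_periodic_wderiv[OF this _ integrable_0] have "((\<lambda>x. V t x * 1) has_integral 0) {0..2*pi}" for t
    by (simp add: H_per G_per)
  then have "integral {0..2*pi} (\<lambda>x. V t x * 1) = 0" for t by (rule integral_unique)
  then show ?thesis
    using pairing_weak_evolution[of "\<lambda>_. 1" 0 t] pairing_weak_evolution[of "\<lambda>_. 1" t 0]
    by (cases t "0 :: real" rule: linorder_cases) auto
qed

lemma g_integral:
  assumes "a \<le> b" shows "(g t has_integral (integral {a..b} (\<lambda>x. 4 * G t x) + (dG t b - dG t a))) {a..b}"
proof -
  have "(\<lambda>x. 4 * G t x) integrable_on {a..b}"
    by (intro integrable_continuous_interval continuous_intros G_cont)
  from has_integral_add[OF integrable_integral[OF this] wderiv_has_integral[OF wderiv_dG assms, of t]]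
  show ?thesis by simp
qed

lemma g_mass: "integral {0..2*pi} (g t) = 4 * integral {0..2*pi} (G 0)"
  using integral_unique[OF g_integral[of 0 "2 * pi" t]] G_mass[of t] period_2pi[of "dG t" 0, OF dG_per] by simp

lemma set_integral_g0:
  assumes "g0 \<in> borel_measurable borel"
  shows "(LINT \<theta>:{0..2*pi}|lborel. g0 \<theta>) = 4 * integral {0..2*pi} (G 0)"
proof -
  obtain B where B: "\<And>t x. \<bar>g t x\<bar> \<le> B" using g_bound by metis
  have "AE \<theta> in lborel. \<theta> \<in> {0..2*pi} \<longrightarrow> g 0 \<theta> = g0 \<theta>" using sol by (simp add: is_solution_def)
  then have "(LINT \<theta>:{0..2*pi}|lborel. g0 \<theta>) = (LINT \<theta>:{0..2*pi}|lborel. g 0 \<theta>)"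
    unfolding set_lebesgue_integral_def
    by (intro integral_cong_AE) (use assms g_borel in \<open>auto simp: indicator_def\<close>)
  also have "\<dots> = integral {0..2*pi} (g 0)"
    by (intro set_borel_integral_eq_integral bounded_borel_set_integrable[OF g_borel B])
  finally show ?thesis by (simp add: g_mass)
qed

text \<open>By \<open>g_mass\<close> this is the mean of \<open>g\<close> at every time; it is
  written through \<open>G 0\<close> because the mass of \<open>G\<close> is what was shown to be
  conserved.\<close>

definition gmean :: real where "gmean = 4 * integral {0..2*pi} (G 0) / (2 * pi)"

text \<open>\<open>G\<close> oscillates by at most 2 pi e on the interval. Integrating G(x) - G(z)
  over z compares 2 pi G(x) with the conserved mass, and the factor 2 / pi rescales this to 4 G -
  gmean.\<close>

lemma G_near_mean:
  assumes e: "\<And>x. \<bar>dG t x\<bar> \<le> e" and x: "x \<in> {0..2*pi}"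
  shows "\<bar>4 * G t x - gmean\<bar> \<le> 8 * pi * e"
proof -
  have "norm (integral {0..2*pi} (\<lambda>z. G t x - G t z)) \<le> (e * (2 * pi)) * (2 * pi - 0)"
  proof (rule integral_bound)
    show "norm (G t x - G t z) \<le> e * (2 * pi)" if "z \<in> {0..2*pi}" for z
    proof -
      have "\<bar>G t x - G t z\<bar> \<le> e * \<bar>x - z\<bar>" by (rule lipschitz_of_deriv_bound[OF G_deriv e])
      also have "\<dots> \<le> e * (2 * pi)" using x that order_trans[OF abs_ge_zero e] by (intro mult_left_mono) auto
      finally show ?thesis by simp
    qed
  qed (auto intro!: continuous_intros G_cont)
  moreover have "integral {0..2*pi} (\<lambda>z. G t x - G t z) = 2 * pi * G t x - integral {0..2*pi} (G 0)"
    using G_mass[of t] integrable_continuous_interval[OF G_cont[of "{0..2*pi}" t]]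
    by (subst integral_diff) auto
  ultimately have A: "\<bar>2 * pi * G t x - integral {0..2*pi} (G 0)\<bar> \<le> 4 * pi^2 * e"
    by (simp add: power2_eq_square mult_ac)
  have "4 * G t x - gmean = (2 / pi) * (2 * pi * G t x - integral {0..2*pi} (G 0))"
    by (simp add: gmean_def field_simps)
  then have "\<bar>4 * G t x - gmean\<bar> = (2 / pi) * \<bar>2 * pi * G t x - integral {0..2*pi} (G 0)\<bar>"
    by (simp only: abs_mult) simp
  also have "\<dots> \<le> (2 / pi) * (4 * pi^2 * e)" by (rule mult_left_mono[OF A]) simp
  finally show ?thesis by (simp add: power2_eq_square)
qed

text \<open>g - gmean = (4 G - gmean) + G'': the first part is at most 8 pi e on a length of at most
  2 pi, the second integrates to a difference of two values of G'.\<close>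

lemma interval_mean_bound:
  assumes e: "\<And>x. \<bar>dG t x\<bar> \<le> e" and ab: "0 \<le> a" "a \<le> b" "b \<le> 2 * pi"
  shows "\<bar>integral {a..b} (\<lambda>x. g t x - gmean)\<bar> \<le> (16 * pi^2 + 2) * e"
proof -
  have int: "(\<lambda>x. 4 * G t x) integrable_on {a..b}"
    by (intro integrable_continuous_interval continuous_intros G_cont)
  have "integral {a..b} (\<lambda>x. g t x - gmean) = integral {a..b} (\<lambda>x. 4 * G t x - gmean) + (dG t b - dG t a)"
    using integral_unique[OF g_integral[OF ab(2), of t]] has_integral_integrable[OF g_integral[OF ab(2), of t]] int
    by (subst (1 2) integral_diff) auto
  moreover have "norm (integral {a..b} (\<lambda>x. 4 * G t x - gmean)) \<le> 8 * pi * e * (b - a)"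
    by (rule integral_bound) (use G_near_mean[OF e] ab in \<open>auto intro!: continuous_intros G_cont\<close>)
  moreover have "8 * pi * e * (b - a) \<le> 8 * pi * e * (2 * pi)"
    using ab order_trans[OF abs_ge_zero e] by (intro mult_left_mono) auto
  moreover have "\<bar>dG t b - dG t a\<bar> \<le> 2 * e" using e[of a] e[of b] by linarith
  ultimately have "\<bar>integral {a..b} (\<lambda>x. g t x - gmean)\<bar> \<le> 8 * pi * e * (2 * pi) + 2 * e"
    unfolding real_norm_def by linarith
  then show ?thesis by (simp add: algebra_simps power2_eq_square)
qed

text \<open>By \<open>interval_mean_bound\<close> the integrals of g - gmean over the intervals
  [0, b] tend to 0. They are the tests against half-lines, an intersection-stable generator of the
  Borel sets, so \<open>vanishes_against_all\<close> reaches every integrable test function.\<close>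

lemma weak_convergence:
  assumes small: "\<And>e. 0 < e \<Longrightarrow> \<forall>\<^sub>F t in at_top. \<forall>x. \<bar>dG t x\<bar> \<le> e"
  shows "weak_conv_const g gmean"
proof -
  \<comment> \<open>Lebesgue measure on one period, kept on the Borel sets of the whole line so that
    the half-lines \<open>{..a}\<close> can serve as generators.\<close>
  define N where "N = density lborel (indicator {0..2*pi} :: real \<Rightarrow> ennreal)"
  have sp: "space N = UNIV" "sets N = sets borel" by (simp_all add: N_def)
  have "emeasure N (space N) \<noteq> \<infinity>"
    unfolding sp N_def by (subst emeasure_density) (auto simp: nn_integral_indicator)
  then interpret N: finite_measure N by (rule finite_measureI)
  have N_int: "integral\<^sup>L N \<phi> = (LINT x:{0..2*pi}|lborel. \<phi> x)" if "\<phi> \<in> borel_measurable borel" for \<phi> :: "real \<Rightarrow> real"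
    unfolding N_def set_lebesgue_integral_def
    using that integral_density[of \<phi> lborel "indicator {0..2*pi}"] by (simp add: ennreal_indicator) 
  obtain B where B: "\<And>t x. \<bar>g t x\<bar> \<le> B" using g_bound by metis
  define f where "f t x = g t x - gmean" for t x
  have fm: "f t \<in> borel_measurable borel" for t unfolding f_def using g_borel by measurable
  have fb: "\<bar>f t x\<bar> \<le> B + \<bar>gmean\<bar>" for t x unfolding f_def using B[of t x] by linarith
  have lim0: "((\<lambda>t. integral {0..b} (f t)) \<longlongrightarrow> 0) at_top" if b: "0 \<le> b" "b \<le> 2 * pi" for b
  proof (rule tendstoI)
    fix e :: real assume "0 < e"
    define k where "k = 16 * pi^2 + 2"
    define e' where "e' = e / (2 * k)"
    have p: "0 < k" by (simp add: k_def add_nonneg_pos)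
    have e': "0 < e'" "k * e' < e" using \<open>0 < e\<close> p by (auto simp: e'_def)
    show "\<forall>\<^sub>F t in at_top. dist (integral {0..b} (f t)) 0 < e"
      using small[OF e'(1)]
    proof eventually_elim
      case (elim t)
      then have "\<bar>integral {0..b} (f t)\<bar> \<le> k * e'"
        unfolding f_def k_def using interval_mean_bound[of t e' 0 b] b by auto
      then show ?case using e'(2) by (simp add: dist_real_def)
    qed
  qed
  have Nf: "(\<integral>x. f t x * indicator {..a} x \<partial>N) = integral {0..max 0 (min a (2 * pi))} (f t)" if "0 \<le> a" for t a
  proof -
    have "(\<integral>x. f t x * indicator {..a} x \<partial>N) = (LINT x:{0..2*pi}|lborel. f t x * indicator {..a} x)"
      using fm by (intro N_int) auto
    also have "\<dots> = (LINT x:{0..max 0 (min a (2 * pi))}|lborel. f t x)"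
      unfolding set_lebesgue_integral_def using that
      by (intro Bochner_Integration.integral_cong) (auto simp: indicator_def)
    also have "\<dots> = integral {0..max 0 (min a (2 * pi))} (f t)"
      by (intro set_borel_integral_eq_integral bounded_borel_set_integrable[OF fm fb])
    finally show ?thesis .
  qed
  have ind: "N.vanishes_against f (indicator {..a})" for a
  proof (cases "0 \<le> a")
    case True
    have "((\<lambda>t. \<integral>x. f t x * indicator {..a} x \<partial>N) \<longlongrightarrow> 0) at_top"
      unfolding Nf[OF True] by (rule lim0) auto
    moreover have "integrable N (indicat_real {..a})"
      using sp by (intro N.integrable_indicator) auto
    ultimately show ?thesis by (simp add: N.vanishes_against_def)
  next
    case False
    have "(\<integral>x. f t x * indicator {..a} x \<partial>N) = (LINT x:{0..2*pi}|lborel. f t x * indicator {..a} x)" for t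
      using fm by (intro N_int) auto
    also have "\<dots> t = 0" for t
      unfolding set_lebesgue_integral_def using False
      by (intro integral_eq_zero_AE AE_I2) (auto simp: indicator_def)
    finally have "((\<lambda>t. \<integral>x. f t x * indicator {..a} x \<partial>N) \<longlongrightarrow> 0) at_top" by simp
    moreover have "integrable N (indicat_real {..a})"
      using sp by (intro N.integrable_indicator) auto
    ultimately show ?thesis by (simp add: N.vanishes_against_def)
  qed
  have whole: "N.vanishes_against f (\<lambda>_. 1)"
  proof -
    have "(\<integral>x. f t x * indicator {..2*pi} x \<partial>N) = (\<integral>x. f t x * 1 \<partial>N)" for t
      using fm by (subst (1 2) N_int) (auto simp: set_lebesgue_integral_def indicator_def intro!: Bochner_Integration.integral_cong)
    then show ?thesis using ind[of "2 * pi"] by (simp add: N.vanishes_against_def)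
  qed
  have all: "N.vanishes_against f \<psi>" if "integrable N \<psi>" for \<psi>
  proof (rule N.vanishes_against_all[where \<G> = "range (\<lambda>a. {..a})" and f = f and B = "B + \<bar>gmean\<bar>"])
    show "sets N = sigma_sets (space N) (range (\<lambda>a. {..a}))"
      unfolding sp by (subst borel_eq_atMost) (simp add: sets_measure_of_conv)
    show "Int_stable (range (\<lambda>a :: real. {..a}))" by (auto simp: Int_stable_def)
    show "f t \<in> borel_measurable N" for t using fm sp(2) by (simp cong: measurable_cong_sets)
  qed (use fb sp ind whole that in auto)
  show ?thesis
    unfolding weak_conv_const_def
  proof (intro allI impI)
    fix \<psi> :: "real \<Rightarrow> real" assume \<psi>: "set_integrable lborel {0..2*pi} \<psi>"
    \<comment> \<open>Outside the interval nothing is known about \<psi>, not even measurability, so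
      it is cut off first.\<close>
    define \<phi> where "\<phi> x = indicator {0..2*pi} x * \<psi> x" for x
    have \<phi>i: "integrable lborel \<phi>" using \<psi> by (simp add: set_integrable_def \<phi>_def[abs_def])
    then have \<phi>m: "\<phi> \<in> borel_measurable borel" by auto
    have "integrable N \<phi>"
    proof -
      have "(\<lambda>x. indicator {0..2*pi} x *\<^sub>R \<phi> x) = \<phi>" by (auto simp: \<phi>_def indicator_def)
      then show ?thesis
        unfolding N_def using integrable_density[of \<phi> lborel "indicator {0..2*pi}"] \<phi>m \<phi>i
        by (simp add: ennreal_indicator)
    qed
    from all[OF this] have "((\<lambda>t. \<integral>x. f t x * \<phi> x \<partial>N) \<longlongrightarrow> 0) at_top" by (simp add: N.vanishes_against_def)
    moreover have "(\<integral>x. f t x * \<phi> x \<partial>N) = (LINT x:{0..2*pi}|lborel. g t x * \<psi> x) - gmean * (LINT x:{0..2*pi}|lborel. \<psi> x)" for t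
    proof -
      have gi: "integrable lborel (\<lambda>x. g t x * \<phi> x)"
      proof (rule Bochner_Integration.integrable_bound)
        show "integrable lborel (\<lambda>x. B * \<phi> x)" using \<phi>i by simp
        show "(\<lambda>x. g t x * \<phi> x) \<in> borel_measurable lborel" using g_borel \<phi>m by simp
        have "norm (g t x * \<phi> x) \<le> norm (B * \<phi> x)" for x
          using mult_right_mono[OF order_trans[OF B[of t x] abs_ge_self] abs_ge_zero[of "\<phi> x"]] by (simp add: abs_mult)
        then show "AE x in lborel. norm (g t x * \<phi> x) \<le> norm (B * \<phi> x)" by simp
      qed
      have "(\<integral>x. f t x * \<phi> x \<partial>N) = (LINT x:{0..2*pi}|lborel. f t x * \<phi> x)"
        using fm \<phi>m by (intro N_int) simp
      also have "\<dots> = (\<integral>x. g t x * \<phi> x - gmean * \<phi> x \<partial>lborel)"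
        unfolding set_lebesgue_integral_def
        by (intro Bochner_Integration.integral_cong) (auto simp: f_def \<phi>_def indicator_def algebra_simps)
      also have "\<dots> = (\<integral>x. g t x * \<phi> x \<partial>lborel) - gmean * (\<integral>x. \<phi> x \<partial>lborel)"
        using gi \<phi>i by simp
      finally show ?thesis
        by (simp add: set_lebesgue_integral_def \<phi>_def[abs_def] mult.left_commute)
    qed
    ultimately have "((\<lambda>t. (LINT x:{0..2*pi}|lborel. g t x * \<psi> x) - gmean * (LINT x:{0..2*pi}|lborel. \<psi> x)) \<longlongrightarrow> 0) at_top"
      by simp
    then show "((\<lambda>t. LINT \<theta>:{0..2*pi}|lborel. g t \<theta> * \<psi> \<theta>) \<longlongrightarrow> gmean * (LINT \<theta>:{0..2*pi}|lborel. \<psi> \<theta>)) at_top"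
      by (simp add: LIM_zero_iff)
  qed
qed

end

section \<open>Contracting and expanding points\<close>

context euler_flow begin

text \<open>\<open>chi t\<close> is continuous and commutes with translation by 2 pi, hence
  unbounded in both directions.\<close>

lemma chi_surj: "\<exists>\<theta>. chi t \<theta> = x"
proof -
  have per: "chi t (of_int n * (2 * pi)) = chi t 0 + of_int n * (2 * pi)" for n :: int
    using periodic_int_mult[of "\<lambda>\<theta>. chi t \<theta> - \<theta>" "2 * pi" 0 n] by (simp add: chi_2pi)
  obtain n :: nat where "\<bar>x - chi t 0\<bar> / (2 * pi) < real n" using reals_Archimedean2 by blast
  then have n: "\<bar>x - chi t 0\<bar> \<le> real n * (2 * pi)" by (simp add: divide_less_eq)
  have "\<exists>\<theta>\<ge>of_int (- int n) * (2 * pi). \<theta> \<le> of_int (int n) * (2 * pi) \<and> chi t \<theta> = x"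
    by (rule IVT') (use n per[of "- int n"] per[of "int n"] chi_continuous in auto)
  then show ?thesis by blast
qed

section \<open>Uniform lower bounds in time windows where G' is not small\<close>

definition E :: "real set" where "E = {\<theta>. \<forall>t\<ge>0. 0 \<le> y t \<theta>}"

text \<open>G' is Lipschitz with constant \<open>M\<close>, so it keeps at least half of its size
  within distance \<epsilon>/(2 M) of \<open>x0\<close>; the source 3 G'^2 is then at least 3
  (\<epsilon>/2)^2 there and \<open>kop_lower_bound\<close> applies. The result depends neither on
  the time nor on the two positions.\<close>

lemma H_lower_bound:
  assumes "0 < \<epsilon>"
  obtains c where "0 < c" "\<And>t x0 x. \<epsilon> \<le> \<bar>dG t x0\<bar> \<Longrightarrow> c \<le> 4 * H t x"
proof -
  define r where "r = min (L / 2) (\<epsilon> / (2 * M))"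
  have r: "0 < r" "r \<le> L / 2" "M * r \<le> \<epsilon> / 2"
    using assms L M(1) by (auto simp: r_def min_def field_simps)
  define c where "c = 4 * (r / 2 * (sin (r / 2) * (3 * (\<epsilon> / 2 * (\<epsilon> / 2)))) / (4 * sin L))"
  have "0 < sin (r / 2)" using r L by (intro sin_gt_zero) auto
  then have "0 < c" unfolding c_def using r assms sin_L by (auto intro!: divide_pos_pos mult_pos_pos)
  moreover have "c \<le> 4 * H t x" if big: "\<epsilon> \<le> \<bar>dG t x0\<bar>" for t x0 x
  proof -
    have "3 * (\<epsilon> / 2 * (\<epsilon> / 2)) \<le> 3 * (dG t z * dG t z)" if "\<bar>z - x0\<bar> \<le> r" for z
    proof -
      have "\<bar>dG t z - dG t x0\<bar> \<le> M * r"
        using M(2)[of t z x0] mult_left_mono[OF that, of M] M(1) by linarith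
      then have "\<epsilon> / 2 \<le> \<bar>dG t z\<bar>" using big r(3) by linarith
      from mult_mono[OF this this] show ?thesis using assms by simp
    qed
    then have "r / 2 * (sin (r / 2) * (3 * (\<epsilon> / 2 * (\<epsilon> / 2)))) / (4 * sin L) \<le> kop L (\<lambda>x. 3 * (dG t x * dG t x)) x"
      using assms r L dG_per
      by (intro kop_lower_bound[of "\<lambda>x. 3 * (dG t x * dG t x)" L r x0 _ x] continuous_intros
          ufam_section_continuous[OF ufam_dG]) auto
    then show ?thesis unfolding c_def H_def by (rule mult_left_mono) simp
  qed
  ultimately show ?thesis using that by blast
qed

text \<open>G' is followed along the trajectory through \<open>x0\<close>, where the Riccati
  equation bounds its rate by K, so at least \<epsilon>/2 survives for a time \<epsilon>/(2 K).
  Where the large value has moved to does not matter, since \<open>H_lower_bound\<close> is uniform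
  in space.\<close>

lemma H_lower_bound_window:
  assumes "0 < \<epsilon>"
  obtains c \<delta> where "0 < c" "0 < \<delta>" "\<And>t x0 s x. \<epsilon> \<le> \<bar>dG t x0\<bar> \<Longrightarrow> s \<in> {t..t + \<delta>} \<Longrightarrow> c \<le> 4 * H s x"
proof -
  obtain c where c: "0 < c" "\<And>t x0 x. \<epsilon> / 2 \<le> \<bar>dG t x0\<bar> \<Longrightarrow> c \<le> 4 * H t x"
    using H_lower_bound[of "\<epsilon> / 2"] assms by auto
  obtain B where B: "0 < B" "\<And>t x. \<bar>H t x\<bar> \<le> B" using ufam_H by (metis ufam_bounded)
  define K where "K = C^2 + 4 * B"
  have K: "0 < K" using B(1) by (simp add: K_def add_nonneg_pos)
  have rate: "\<bar>(y s \<theta>)^2 - 4 * H s (chi s \<theta>)\<bar> \<le> K" for s \<theta>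
  proof -
    have "(y s \<theta>)^2 \<le> C^2" using y_bound[of s \<theta>] C(1) by (simp add: abs_le_square_iff[symmetric])
    moreover have "0 \<le> (y s \<theta>)^2" by simp
    ultimately show ?thesis using B(2)[of s "chi s \<theta>"] unfolding K_def by linarith
  qed
  have "c \<le> 4 * H s x" if big: "\<epsilon> \<le> \<bar>dG t x0\<bar>" and s: "s \<in> {t..t + \<epsilon> / (2 * K)}" for t x0 s x
  proof -
    obtain \<theta> where \<theta>: "chi t \<theta> = x0" using chi_surj by blast
    have "\<bar>y s \<theta> - y t \<theta>\<bar> \<le> K * \<bar>s - t\<bar>" by (rule lipschitz_of_deriv_bound[OF y_deriv rate])
    also have "\<dots> \<le> K * (\<epsilon> / (2 * K))" using s K by (intro mult_left_mono) auto
    also have "\<dots> = \<epsilon> / 2" using K by simp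
    finally have "\<epsilon> / 2 \<le> \<bar>dG s (chi s \<theta>)\<bar>" using big unfolding y_def \<theta> by linarith
    then show ?thesis by (rule c(2))
  qed
  moreover have "0 < \<epsilon> / (2 * K)" using assms K by simp
  ultimately show ?thesis using that c(1) by blast
qed

text \<open>While 0 \<le> y \<le> C, the Riccati equation gives y' \<le> C y - c, and a smaller
  value of \<open>y\<close> would be negative by the end of the window. Only the first half of the
  window is claimed, so that a time of at least \<delta>/2 remains.\<close>

lemma expanding_y_lower_bound:
  assumes c: "0 < c" "0 < \<delta>" and H: "\<And>s x. s \<in> {t..t + \<delta>} \<Longrightarrow> c \<le> 4 * H s x"
    and \<theta>: "\<theta> \<in> E" and t: "0 \<le> t" and s: "s \<in> {t..t + \<delta> / 2}"
  shows "c * (\<delta> / 2) * exp (- C * \<delta>) \<le> y s \<theta>"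
proof -
  define e where "e = t + \<delta>"
  have se: "s \<le> e" "\<delta> / 2 \<le> e - s" "e - s \<le> \<delta>" using s c by (auto simp: e_def)
  have y0: "0 \<le> y r \<theta>" if "0 \<le> r" for r using \<theta> that by (simp add: E_def)
  \<comment> \<open>The factor exp(-C r) absorbs the term C y; bounding exp(-C r) below by exp(-C e)
    makes the remaining loss a constant rate.\<close>
  let ?h = "\<lambda>r. y r \<theta> * exp (- C * r) + c * exp (- C * e) * r"
  have "?h e \<le> ?h s"
  proof (rule DERIV_nonpos_imp_nonincreasing[OF se(1)])
    fix r assume r: "s \<le> r" "r \<le> e"
    have "(?h has_real_derivative
        ((y r \<theta>)^2 - 4 * H r (chi r \<theta>) - C * y r \<theta>) * exp (- C * r) + c * exp (- C * e)) (at r)"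
      by (auto intro!: derivative_eq_intros y_deriv simp: algebra_simps)
    moreover have "((y r \<theta>)^2 - 4 * H r (chi r \<theta>) - C * y r \<theta>) * exp (- C * r) + c * exp (- C * e) \<le> 0"
    proof -
      have "0 \<le> y r \<theta>" using r s t by (intro y0) auto
      then have "y r \<theta> * y r \<theta> \<le> C * y r \<theta>" using y_bound[of r \<theta>] by (intro mult_right_mono) auto
      moreover have "c \<le> 4 * H r (chi r \<theta>)" using r s by (intro H) (auto simp: e_def)
      ultimately have "(y r \<theta>)^2 - 4 * H r (chi r \<theta>) - C * y r \<theta> \<le> - c" by (simp add: power2_eq_square)
      from mult_right_mono[OF this, of "exp (- C * r)"]
      have "((y r \<theta>)^2 - 4 * H r (chi r \<theta>) - C * y r \<theta>) * exp (- C * r) \<le> - c * exp (- C * r)" by simp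
      moreover have "c * exp (- C * e) \<le> c * exp (- C * r)" using r c C(1) by (intro mult_left_mono) auto
      ultimately show ?thesis by linarith
    qed
    ultimately show "\<exists>z. (?h has_real_derivative z) (at r) \<and> z \<le> 0" by blast
  qed
  moreover have "0 \<le> y e \<theta> * exp (- C * e)" using y0[of e] t c by (simp add: e_def)
  ultimately have "c * exp (- C * e) * (e - s) \<le> y s \<theta> * exp (- C * s)" by (simp add: algebra_simps)
  from mult_right_mono[OF this, of "exp (C * s)"]
  have "c * (e - s) * (exp (- C * e) * exp (C * s)) \<le> y s \<theta> * (exp (- C * s) * exp (C * s))"
    by (simp add: mult_ac)
  then have "c * (e - s) * exp (- C * (e - s)) \<le> y s \<theta>"
    by (simp add: algebra_simps flip: exp_add)
  moreover have "c * (\<delta> / 2) * exp (- C * \<delta>) \<le> c * (e - s) * exp (- C * (e - s))"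
    using se c C(1) by (intro mult_mono) auto
  ultimately show ?thesis by linarith
qed

text \<open>Pigeonhole principle: the images of \<open>S\<close> lie on one turn of the circle
  starting at \<open>chi t 0\<close>, which fewer than card S cells of length \<open>r\<close>
  cover.\<close>

lemma close_pair:
  assumes S: "finite S" "S \<subseteq> {0..<2 * pi}" and r: "0 < r" and card: "2 * pi / r < real N" "N < card S"
  shows "\<exists>a\<in>S. \<exists>b\<in>S. a < b \<and> chi t b - chi t a \<le> r"
proof -
  define f where "f \<theta> = nat \<lfloor>(chi t \<theta> - chi t 0) / r\<rfloor>" for \<theta>
  have rng: "0 \<le> chi t \<theta> - chi t 0 \<and> chi t \<theta> - chi t 0 < 2 * pi" if "\<theta> \<in> S" for \<theta>
    using that S(2) chi_strict_mono[of 0 \<theta> t] chi_strict_mono[of \<theta> "0 + 2 * pi" t] chi_2pi[of t 0]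
    by (cases "\<theta> = 0") (auto simp: subset_iff)
  have "f ` S \<subseteq> {..<N}"
  proof (rule image_subsetI)
    fix \<theta> assume \<theta>: "\<theta> \<in> S"
    have "(chi t \<theta> - chi t 0) / r < 2 * pi / r" using rng[OF \<theta>] r by (intro divide_strict_right_mono) auto
    then have "(chi t \<theta> - chi t 0) / r < real N" using card by linarith
    then have "\<lfloor>(chi t \<theta> - chi t 0) / r\<rfloor> < int N" by (simp add: floor_less_iff)
    moreover have "0 \<le> \<lfloor>(chi t \<theta> - chi t 0) / r\<rfloor>" using rng[OF \<theta>] r by simp
    ultimately show "f \<theta> \<in> {..<N}" by (simp add: f_def nat_less_iff)
  qed
  then have "card (f ` S) < card S" using card(2) card_mono[of "{..<N}" "f ` S"] by simp
  then have "\<not> inj_on f S" by (rule pigeonhole)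
  then obtain a b where ab: "a \<in> S" "b \<in> S" "a < b" "f a = f b"
    unfolding inj_on_def by (metis linorder_less_linear)
  have "\<lfloor>(chi t a - chi t 0) / r\<rfloor> = \<lfloor>(chi t b - chi t 0) / r\<rfloor>"
    using ab rng[of a] rng[of b] r by (auto simp: f_def eq_nat_nat_iff)
  then have "(chi t b - chi t 0) / r - (chi t a - chi t 0) / r < 1"
    using floor_correct[of "(chi t b - chi t 0) / r"] floor_correct[of "(chi t a - chi t 0) / r"] by linarith
  then have "chi t b - chi t a \<le> r" using r by (simp add: field_simps flip: diff_divide_distrib)
  then show ?thesis using ab by blast
qed

text \<open>An arc contained in \<open>E\<close> keeps being stretched by a fixed amount in every window in which \<open>G'\<close> is
  not small, but its length stays below \<open>2\<pi>\<close>.\<close>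
lemma no_expanding_arc:
  assumes c: "0 < c" "0 < \<delta>" and ab: "a < b" "b < a + 2 * pi" and arc: "{a..b} \<subseteq> E"
    and window: "\<And>N. \<exists>t\<ge>N. \<forall>s\<in>{t..t + \<delta>}. \<forall>x. c \<le> 4 * H s x"
  shows False
proof -
  define \<kappa> where "\<kappa> = c * (\<delta> / 2) * exp (- C * \<delta>)"
  have \<kappa>: "0 < \<kappa>" using c by (simp add: \<kappa>_def)
  let ?D = "\<lambda>t. chi t b - chi t a"
  \<comment> \<open>By the mean value theorem the relative growth rate of the chord is 2 y at some
    point of the arc, and all these points lie in \<open>E\<close>.\<close>
  have D': "\<exists>z. (?D has_real_derivative z) (at t) \<and> (\<exists>\<theta>\<in>E. z = 2 * ?D t * y t \<theta>)" for t
  proof -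
    obtain \<xi> where \<xi>: "chi t a < \<xi>" "\<xi> < chi t b" "G t (chi t b) - G t (chi t a) = ?D t * dG t \<xi>"
      using MVT2[of "chi t a" "chi t b" "G t" "dG t"] chi_strict_mono[OF ab(1)] G_deriv by blast
    obtain \<theta> where \<theta>: "chi t \<theta> = \<xi>" using chi_surj by blast
    have "\<theta> \<in> {a..b}"
      using \<xi> \<theta> chi_strict_mono[of \<theta> a t] chi_strict_mono[of b \<theta> t] by (auto simp: not_le[symmetric])
    then have "\<theta> \<in> E" using arc by blast
    moreover have "2 * G t (chi t b) - 2 * G t (chi t a) = 2 * ?D t * y t \<theta>"
      using arg_cong[OF \<xi>(3), of "\<lambda>v. 2 * v"] by (simp add: y_def \<theta> algebra_simps)
    ultimately show ?thesis using DERIV_diff[OF chi_deriv[of b t] chi_deriv[of a t]] by metis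
  qed
  have Dpos: "0 < ?D t" for t using chi_strict_mono[OF ab(1), of t] by simp
  have mono: "?D s \<le> ?D t" if "0 \<le> s" "s \<le> t" for s t
  proof (rule DERIV_nonneg_imp_nondecreasing[OF that(2)])
    fix r assume r: "s \<le> r"
    obtain z \<theta> where z: "(?D has_real_derivative z) (at r)" "\<theta> \<in> E" "z = 2 * ?D r * y r \<theta>" using D' by blast
    have "0 \<le> y r \<theta>" using z(2) r that by (simp add: E_def)
    then have "0 \<le> z" using z(3) Dpos[of r] by simp
    then show "\<exists>z. (?D has_real_derivative z) (at r) \<and> 0 \<le> z" using z(1) by blast
  qed
  have grow: "?D t + \<kappa> * \<delta> * (b - a) \<le> ?D (t + \<delta> / 2)"
    if t: "0 \<le> t" and H: "\<forall>s\<in>{t..t + \<delta>}. \<forall>x. c \<le> 4 * H s x" for t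
  proof -
    \<comment> \<open>In the first half of the window the chord, never shorter than b - a, grows at
      a rate of at least 2 \<kappa> (b - a); over the time \<delta>/2 this gains \<kappa> \<delta>
      (b - a).\<close>
    have "?D t - 2 * \<kappa> * (b - a) * t \<le> ?D (t + \<delta> / 2) - 2 * \<kappa> * (b - a) * (t + \<delta> / 2)"
    proof (rule DERIV_nonneg_imp_nondecreasing[where f = "\<lambda>t. ?D t - 2 * \<kappa> * (b - a) * t"])
      show "t \<le> t + \<delta> / 2" using c by simp
      fix r assume r: "t \<le> r" "r \<le> t + \<delta> / 2"
      obtain z \<theta> where z: "(?D has_real_derivative z) (at r)" "\<theta> \<in> E" "z = 2 * ?D r * y r \<theta>" using D' by blast
      have "\<kappa> \<le> y r \<theta>"
        unfolding \<kappa>_def by (rule expanding_y_lower_bound[OF c _ z(2) t]) (use H r in auto)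
      moreover have "b - a \<le> ?D r" using mono[of 0 r] r t by (simp add: chi_0)
      ultimately have "(b - a) * \<kappa> \<le> ?D r * y r \<theta>" using ab \<kappa> by (intro mult_mono) auto
      then have "0 \<le> z - 2 * \<kappa> * (b - a)" using z(3) by (simp add: algebra_simps)
      moreover have "((\<lambda>t. ?D t - 2 * \<kappa> * (b - a) * t) has_real_derivative z - 2 * \<kappa> * (b - a)) (at r)"
        using DERIV_diff[OF z(1) DERIV_cmult_Id[of "2 * \<kappa> * (b - a)"]] by simp
      ultimately show "\<exists>z. ((\<lambda>t. ?D t - 2 * \<kappa> * (b - a) * t) has_real_derivative z) (at r) \<and> 0 \<le> z" by blast
    qed
    then show ?thesis by (simp add: algebra_simps)
  qed
  have bdd: "bdd_above (?D ` {0..})"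
  proof (rule bdd_aboveI)
    fix d assume "d \<in> ?D ` {0..}"
    then obtain t where "d = ?D t" by blast
    then show "d \<le> 2 * pi" using chi_strict_mono[OF ab(2), of t] chi_2pi[of t a] by simp
  qed
  have "0 < \<kappa> * \<delta> * (b - a)" using \<kappa> c ab by simp
  then have "Sup (?D ` {0..}) - \<kappa> * \<delta> * (b - a) < Sup (?D ` {0..})" by simp
  \<comment> \<open>At \<open>t0\<close> the length is within one gain of its supremum, so the next
    window overshoots it.\<close>
  then obtain t0 where t0: "0 \<le> t0" "Sup (?D ` {0..}) - \<kappa> * \<delta> * (b - a) < ?D t0"
    using less_cSupD[of "?D ` {0..}" "Sup (?D ` {0..}) - \<kappa> * \<delta> * (b - a)"] by auto
  obtain t where t: "t0 \<le> t" "\<forall>s\<in>{t..t + \<delta>}. \<forall>x. c \<le> 4 * H s x" using window by blast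
  have "?D t0 + \<kappa> * \<delta> * (b - a) \<le> ?D (t + \<delta> / 2)"
    using mono[OF t0(1) t(1)] grow[of t] t t0 by auto
  moreover have "?D (t + \<delta> / 2) \<le> Sup (?D ` {0..})" using bdd t t0 c by (intro cSup_upper) auto
  ultimately show False using t0(2) by linarith
qed

text \<open>\<open>E\<close> is invariant under translation by 2 pi, so finiteness on the circle
  means finiteness in one fundamental interval.\<close>

lemma finite_E:
  assumes "\<not> (\<forall>e>0. \<forall>\<^sub>F t in at_top. \<forall>x. \<bar>dG t x\<bar> \<le> e)"
  shows "finite (E \<inter> {0..<2 * pi})"
proof (rule ccontr)
  assume inf: "infinite (E \<inter> {0..<2 * pi})"
  obtain \<epsilon> where \<epsilon>: "0 < \<epsilon>" and freq: "\<not> (\<forall>\<^sub>F t in at_top. \<forall>x. \<bar>dG t x\<bar> \<le> \<epsilon>)" using assms by blast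
  obtain c \<delta> where c: "0 < c" "0 < \<delta>" and win: "\<And>t x0 s x. \<epsilon> \<le> \<bar>dG t x0\<bar> \<Longrightarrow> s \<in> {t..t + \<delta>} \<Longrightarrow> c \<le> 4 * H s x"
    using H_lower_bound_window[OF \<epsilon>] by metis
  define A where "A = {t. 0 \<le> t \<and> (\<forall>s\<in>{t..t + \<delta>}. \<forall>x. c \<le> 4 * H s x)}"
  have freqA: "\<exists>\<^sub>F t in at_top. t \<in> A"
    unfolding frequently_def
  proof
    assume "\<forall>\<^sub>F t in at_top. t \<notin> A"
    then have "\<forall>\<^sub>F t in at_top. \<forall>x. \<bar>dG t x\<bar> \<le> \<epsilon>"
      using eventually_ge_at_top[of 0]
    proof eventually_elim
      case (elim t)
      show ?case
      proof (rule ccontr)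
        assume "\<not> (\<forall>x. \<bar>dG t x\<bar> \<le> \<epsilon>)"
        then obtain x0 where "\<epsilon> \<le> \<bar>dG t x0\<bar>" by (auto simp: not_le intro: less_imp_le)
        then have "t \<in> A" using win elim(2) unfolding A_def by blast
        then show False using elim(1) by blast
      qed
    qed
    then show False using freq by blast
  qed
  define \<kappa> where "\<kappa> = c * (\<delta> / 2) * exp (- C * \<delta>)"
  have \<kappa>: "0 < \<kappa>" using c by (simp add: \<kappa>_def)
  have yA: "\<kappa> \<le> y t \<theta>" if "t \<in> A" "\<theta> \<in> E" for t \<theta>
    unfolding \<kappa>_def using that c by (intro expanding_y_lower_bound[where t = t]) (auto simp: A_def)
  \<comment> \<open>Over an arc of length \<open>r\<close> the slope changes by at most M r =
    \<kappa>/2.\<close>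
  define r where "r = \<kappa> / (2 * M)"
  have r: "0 < r" "M * r = \<kappa> / 2" using \<kappa> M(1) by (auto simp: r_def)
  obtain N :: nat where N: "2 * pi / r < real N" using reals_Archimedean2 by blast
  obtain S where S: "finite S" "card S = Suc N" "S \<subseteq> E \<inter> {0..<2 * pi}"
    using infinite_arbitrarily_large[OF inf] by blast
  \<comment> \<open>Which pair is close varies with the time. There are only finitely many pairs, so
    one of them is close at arbitrarily late times in \<open>A\<close>.\<close>
  have "\<exists>a\<in>S. \<exists>b\<in>S. a < b \<and> (\<exists>\<^sub>F t in at_top. t \<in> A \<and> chi t b - chi t a \<le> r)"
  proof (rule ccontr)
    assume "\<not> ?thesis"
    then have "\<forall>p\<in>S \<times> S. \<forall>\<^sub>F t in at_top. fst p < snd p \<longrightarrow> t \<in> A \<longrightarrow> \<not> chi t (snd p) - chi t (fst p) \<le> r"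
      by (force simp: not_frequently intro: always_eventually elim: eventually_mono)
    then have "\<forall>\<^sub>F t in at_top. \<forall>p\<in>S \<times> S. fst p < snd p \<longrightarrow> t \<in> A \<longrightarrow> \<not> chi t (snd p) - chi t (fst p) \<le> r"
      using S(1) by (intro eventually_ball_finite) auto
    then have "\<forall>\<^sub>F t in at_top. t \<notin> A"
    proof eventually_elim
      case (elim t)
      obtain a b where "a \<in> S" "b \<in> S" "a < b" "chi t b - chi t a \<le> r"
        using close_pair[OF S(1) _ r(1) N, of t] S by auto
      then show ?case using elim by force
    qed
    then show False using freqA by (simp add: frequently_def)
  qed
  then obtain a b where ab: "a \<in> S" "b \<in> S" "a < b" and close: "\<exists>\<^sub>F t in at_top. t \<in> A \<and> chi t b - chi t a \<le> r"
    by blast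
  have "{a..b} \<subseteq> E"
  proof
    fix \<theta> assume \<theta>: "\<theta> \<in> {a..b}"
    show "\<theta> \<in> E"
    proof (rule ccontr)
      assume "\<theta> \<notin> E"
      then obtain s where s: "0 \<le> s" "y s \<theta> < 0" by (auto simp: E_def not_le)
      obtain t where t: "s \<le> t" "t \<in> A" "chi t b - chi t a \<le> r"
        using frequently_eventually_frequently[OF close eventually_ge_at_top[of s]]
        by (auto dest: frequently_ex)
      have "chi t a \<le> chi t \<theta>" "chi t \<theta> \<le> chi t b"
        using \<theta> chi_strict_mono[of a \<theta> t] chi_strict_mono[of \<theta> b t] by (auto simp: le_less)
      then have "\<bar>chi t \<theta> - chi t a\<bar> \<le> r" using t(3) by linarith
      then have "M * \<bar>chi t \<theta> - chi t a\<bar> \<le> \<kappa> / 2"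
        using r(2) M(1) mult_left_mono[of "\<bar>chi t \<theta> - chi t a\<bar>" r M] by linarith
      moreover have "\<bar>y t \<theta> - y t a\<bar> \<le> M * \<bar>chi t \<theta> - chi t a\<bar>" unfolding y_def by (rule M)
      moreover have "\<kappa> \<le> y t a" using yA[OF t(2)] ab(1) S(3) by blast
      ultimately have "0 < y t \<theta>" using \<kappa> by linarith
      then show False using y_neg_persists[OF t(1) s(2)] by linarith
    qed
  qed
  moreover have "0 \<le> a" "b < 2 * pi" using ab(1,2) S(3) by auto
  then have "b < a + 2 * pi" by linarith
  moreover have "\<exists>t\<ge>N. \<forall>s\<in>{t..t + \<delta>}. \<forall>x. c \<le> 4 * H s x" for N
    using frequently_eventually_frequently[OF freqA eventually_ge_at_top[of N]]
    by (auto dest!: frequently_ex simp: A_def)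
  ultimately show False using no_expanding_arc[OF c ab(3)] by blast
qed

section \<open>The turning time \<open>T\<close> and the monotonicity of \<open>dchi\<close>\<close>

lemma closed_E: "closed E"
proof -
  have "E = (\<Inter>t\<in>{0..}. {\<theta>. 0 \<le> y t \<theta>})" by (auto simp: E_def)
  moreover have "closed {\<theta>. 0 \<le> y t \<theta>}" for t
    by (rule closed_Collect_le) (auto intro: continuous_intros y_continuous)
  ultimately show ?thesis by auto
qed

text \<open>The infimum of the empty set is infinity in \<open>ereal\<close>, the value wanted at
  points that never contract.\<close>

definition T :: "real \<Rightarrow> ereal" where "T \<theta> = (INF t\<in>{t. 0 \<le> t \<and> y t \<theta> < 0}. ereal t)"

lemma T_nonneg: "0 \<le> T \<theta>"
  unfolding T_def by (rule INF_greatest) auto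

lemma T_2pi: "T (\<theta> + 2 * pi) = T \<theta>"
  by (simp add: T_def y_2pi)

lemma T_le: "0 \<le> t \<Longrightarrow> y t \<theta> < 0 \<Longrightarrow> T \<theta> \<le> ereal t"
  unfolding T_def by (rule INF_lower) auto

lemma T_infinity_iff: "T \<theta> = \<infinity> \<longleftrightarrow> \<theta> \<in> E"
proof
  assume T: "T \<theta> = \<infinity>"
  show "\<theta> \<in> E" unfolding E_def using T_le[of _ \<theta>] T by (force simp: not_less[symmetric])
next
  assume "\<theta> \<in> E"
  then have empty: "{t. 0 \<le> t \<and> y t \<theta> < 0} = {}" by (auto simp: E_def not_less)
  show "T \<theta> = \<infinity>" unfolding T_def empty by (simp add: top_ereal_def)
qed

lemma y_nonneg_before_T: "0 \<le> t \<Longrightarrow> ereal t < T \<theta> \<Longrightarrow> 0 \<le> y t \<theta>"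
  using T_le[of t \<theta>] by (force simp: not_less[symmetric])

text \<open>Every time later than \<open>T \<theta>\<close> is preceded by one with y < 0, and
  negativity persists. At \<open>T \<theta>\<close> itself the infimum need not be attained, so the
  weak sign is obtained by continuity from the right.\<close>

lemma y_nonpos_after_T:
  assumes "T \<theta> \<le> ereal t" shows "y t \<theta> \<le> 0"
proof (rule tendsto_upperbound)
  show "((\<lambda>s. y s \<theta>) \<longlongrightarrow> y t \<theta>) (at_right t)"
    using y_time_continuous[of UNIV \<theta>] by (auto simp: continuous_on_def intro: filterlim_mono at_le)
  show "\<forall>\<^sub>F s in at_right t. y s \<theta> \<le> 0"
  proof (rule eventually_mono[OF eventually_at_right_less])
    fix s assume s: "t < s"
    have "T \<theta> < ereal s" using assms s by (meson ereal_less_eq(3) le_less_trans less_ereal.simps(1))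
    then obtain r where "y r \<theta> < 0" "r < s" unfolding T_def INF_less_iff by auto
    then show "y s \<theta> \<le> 0" using y_neg_persists[of r s \<theta>] by simp
  qed
qed simp

lemma dchi_mono_before_T: "mono_on {t. 0 \<le> t \<and> ereal t < T \<theta>} (\<lambda>t. dchi chi t \<theta>)"
proof (rule mono_onI)
  fix s t assume st: "s \<in> {t. 0 \<le> t \<and> ereal t < T \<theta>}" "t \<in> {t. 0 \<le> t \<and> ereal t < T \<theta>}" "s \<le> t"
  show "dchi chi s \<theta> \<le> dchi chi t \<theta>"
  proof (rule DERIV_nonneg_imp_nondecreasing[OF st(3)])
    fix r assume r: "s \<le> r" "r \<le> t"
    then have "0 \<le> y r \<theta>"
      using st by (intro y_nonneg_before_T) (auto intro: le_less_trans[of "ereal r" "ereal t"])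
    then show "\<exists>z. ((\<lambda>t. dchi chi t \<theta>) has_real_derivative z) (at r) \<and> 0 \<le> z"
      using dchi_deriv[of \<theta> r] by (intro exI[of _ "exp (Lam \<theta> r) * (2 * y r \<theta>)"]) auto
  qed
qed

lemma dchi_antimono_after_T: "antimono_on {t. T \<theta> \<le> ereal t} (\<lambda>t. dchi chi t \<theta>)"
proof (rule monotone_onI)
  fix s t assume st: "s \<in> {t. T \<theta> \<le> ereal t}" "t \<in> {t. T \<theta> \<le> ereal t}" "s \<le> t"
  show "dchi chi t \<theta> \<le> dchi chi s \<theta>"
  proof (rule DERIV_nonpos_imp_nonincreasing[OF st(3)])
    fix r assume r: "s \<le> r" "r \<le> t"
    then have "y r \<theta> \<le> 0"
      using st by (intro y_nonpos_after_T) (auto intro: order_trans[of _ "ereal s"])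
    then show "\<exists>z. ((\<lambda>t. dchi chi t \<theta>) has_real_derivative z) (at r) \<and> z \<le> 0"
      using dchi_deriv[of \<theta> r] by (intro exI[of _ "exp (Lam \<theta> r) * (2 * y r \<theta>)"]) (auto simp: mult_le_0_iff)
  qed
qed

lemma dchi_tendsto_0_of_finite_T:
  assumes "T \<theta> < \<infinity>" shows "((\<lambda>t. dchi chi t \<theta>) \<longlongrightarrow> 0) at_top"
proof -
  have "\<theta> \<notin> E" using assms T_infinity_iff by auto
  then obtain s where "y s \<theta> < 0" by (auto simp: E_def not_le)
  then show ?thesis by (rule dchi_tendsto_0)
qed

end

theorem mainTheorem1:
  fixes m :: nat and g0 :: "real \<Rightarrow> real" and g G chi :: "real \<Rightarrow> real \<Rightarrow> real"
  assumes "m \<ge> 4"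
    and "Linf_m m g0"
    and "is_solution m g0 g G"
    and "is_flow G chi"
  shows "\<exists>T :: real \<Rightarrow> ereal.
     (\<forall>\<theta>. 0 \<le> T \<theta> \<and> T (\<theta> + 2 * pi) = T \<theta>) \<and>
     (\<forall>\<theta>. mono_on {t. 0 \<le> t \<and> ereal t < T \<theta>} (\<lambda>t. dchi chi t \<theta>) \<and>
          antimono_on {t. T \<theta> \<le> ereal t} (\<lambda>t. dchi chi t \<theta>)) \<and>
     (\<forall>s t. 0 \<le> s \<longrightarrow> s \<le> t \<longrightarrow> Cset chi s \<subseteq> Cset chi t) \<and>
     closed {\<theta>. T \<theta> = \<infinity>} \<and>
     open {\<theta>. T \<theta> < \<infinity>} \<and>
     (\<forall>\<theta>. T \<theta> < \<infinity> \<longrightarrow> ((\<lambda>t. dchi chi t \<theta>) \<longlongrightarrow> 0) at_top) \<and>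
     (weak_conv_const g ((1 / (2 * pi)) * (LINT \<theta>:{0..2*pi}|lborel. g0 \<theta>))
      \<or> finite ({\<theta>. T \<theta> = \<infinity>} \<inter> {0..<2 * pi}))"
proof -
  interpret euler_flow m g0 g G chi
    using assms by unfold_locales
  have E: "{\<theta>. T \<theta> = \<infinity>} = E" by (auto simp: T_infinity_iff)
  have "{\<theta>. T \<theta> < \<infinity>} = - E" by (auto simp: less_top[symmetric] top_ereal_def T_infinity_iff)
  then have "open {\<theta>. T \<theta> < \<infinity>}" using closed_E by (simp add: open_closed)
  moreover have "Cset chi s \<subseteq> Cset chi t" if "s \<le> t" for s t
    using y_neg_persists[OF that] by (auto simp: Cset_eq)
  moreover have "weak_conv_const g ((1 / (2 * pi)) * (LINT \<theta>:{0..2*pi}|lborel. g0 \<theta>)) \<or> finite (E \<inter> {0..<2 * pi})"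
  proof (cases "\<forall>e>0. \<forall>\<^sub>F t in at_top. \<forall>x. \<bar>dG t x\<bar> \<le> e")
    case True
    have "g0 \<in> borel_measurable borel" using assms(2) by (simp add: Linf_m_def)
    then have "(1 / (2 * pi)) * (LINT \<theta>:{0..2*pi}|lborel. g0 \<theta>) = gmean"
      by (simp add: set_integral_g0 gmean_def)
    then show ?thesis using weak_convergence True by simp
  qed (use finite_E in blast)
  ultimately show ?thesis
    using T_nonneg T_2pi dchi_mono_before_T dchi_antimono_after_T closed_E dchi_tendsto_0_of_finite_T
    by (intro exI[of _ T]) (simp add: E)
qed

end
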